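(* Let $n\ge 2$ and $1\le k\le n$ be integers. Suppose $p\ge 1$ is a real number. Then any smooth strictly convex solution $M$ to $$u^{1-p}e^{-\frac{r^2}{2}}P_k(W)=1\quad\text{on }\mathbb{S}^n$$ must be an origin-centred sphere.
   Context: $(\mathbb{S}^n,g_0,\nabla)$ is the unit sphere in $\mathbb{R}^{n+1}$ with its standard metric and Levi-Civita connection. A smooth strictly convex solution $M$ means a smooth closed hypersurface $M\subset\mathbb{R}^{n+1}$ with strictly positive Gauss curvature that bounds a convex body $K$ containing the origin in its interior, and such that the equation holds with the following notation. $u:\mathbb{S}^n\to(0,\infty)$ is the support function of $K$; $X(z)=u(z)z+\nabla u(z)$ is the point of $M$ with unit outer normal $z$; $r(z)=|X(z)|=\sqrt{u^2+|\nabla u|^2}$ is the radial function viewed on $\mathbb{S}^n$ via the Gauss map; $W=\nabla^2u+u g_0$. $P_k(W)=\binom{n}{k}^{-1}\sum_{j_1<\cdots<j_k}\lambda_{j_1}\cdots\lambda_{j_k}$, where $\lambda_1,\dots,\lambda_n$ are the eigenvalues of $W$ with respect to $g_0$. *)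

theory Defs
  imports "HOL-Analysis.Analysis"
begin

text \<open>
  The ambient space $\mathbb{R}^{n+1}$ is an arbitrary Euclidean space \<open>'a\<close> with \<open>DIM('a) = n + 1\<close>,
  and $\mathbb{S}^n$ is \<open>sphere 0 1\<close>. Functions on $\mathbb{S}^n$ or on a hypersurface are total functions
  on \<open>'a\<close>; they are only differentiated within the hypersurface, so their values elsewhere are
  irrelevant.
\<close>

section \<open>Smooth functions and hypersurfaces\<close>

primrec Ck_on :: "nat \<Rightarrow> ('a::euclidean_space \<Rightarrow> 'b::real_normed_vector) \<Rightarrow> 'a set \<Rightarrow> bool" where
  "Ck_on 0 f U \<longleftrightarrow> continuous_on U f"
| "Ck_on (Suc k) f U \<longleftrightarrow>
     f differentiable_on U \<and> (\<forall>v. Ck_on k (\<lambda>x. frechet_derivative f (at x) v) U)"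

text \<open>Only meaningful for open \<open>U\<close>.\<close>
definition smooth_on :: "('a::euclidean_space \<Rightarrow> 'b::real_normed_vector) \<Rightarrow> 'a set \<Rightarrow> bool" where
  "smooth_on f U \<longleftrightarrow> (\<forall>k. Ck_on k f U)"

definition smooth_hypersurface :: "'a::euclidean_space set \<Rightarrow> bool" where
  "smooth_hypersurface M \<longleftrightarrow>
     (\<forall>x\<in>M. \<exists>U (\<phi> :: 'a \<Rightarrow> real). open U \<and> x \<in> U \<and> smooth_on \<phi> U \<and>
        (\<forall>y\<in>U. frechet_derivative \<phi> (at y) \<noteq> (\<lambda>v. 0)) \<and> M \<inter> U = {y\<in>U. \<phi> y = 0})"

text \<open>
  The tangent space of a hypersurface at a point with unit normal \<open>\<nu>\<close>, as a linear subspace;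
  for $\mathbb{S}^n$ it is \<open>tangent_space z\<close> at the point \<open>z\<close>.
\<close>
definition tangent_space :: "'a::euclidean_space \<Rightarrow> 'a set" where
  "tangent_space \<nu> = {v. \<nu> \<bullet> v = 0}"

text \<open>
  The differential of \<open>f\<close> at the point \<open>x\<close> of the hypersurface \<open>M\<close>. As a function on the whole
  of \<open>'a\<close> the derivative within \<open>M\<close> is not unique, but its restriction to the tangent space
  of \<open>M\<close> at \<open>x\<close> is; it is only ever applied to tangent vectors.
\<close>
definition differential ::
  "'a set \<Rightarrow> ('a::euclidean_space \<Rightarrow> 'b::real_normed_vector) \<Rightarrow> 'a \<Rightarrow> 'a \<Rightarrow> 'b" where
  "differential M f x = frechet_derivative f (at x within M)"


section \<open>Eigenvalues of self-adjoint endomorphisms\<close>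

text \<open>
  The eigenvalues of an endomorphism \<open>A\<close> of the subspace \<open>V\<close> in increasing order, each repeated
  according to the dimension of its eigenspace. It is applied to self-adjoint endomorphisms
  only, where this list has \<open>dim V\<close> entries.
\<close>
definition eigenvalues_on :: "'a::euclidean_space set \<Rightarrow> ('a \<Rightarrow> 'a) \<Rightarrow> real list" where
  "eigenvalues_on V A =
     sorted_list_of_multiset (Abs_multiset (\<lambda>t. dim {v\<in>V. A v = t *\<^sub>R v}))"

definition normalized_esym :: "nat \<Rightarrow> real list \<Rightarrow> real" where
  "normalized_esym k xs =
     (\<Sum>J | J \<subseteq> {..<length xs} \<and> card J = k. \<Prod>j\<in>J. xs ! j) / real (length xs choose k)"


section \<open>Convex hypersurfaces\<close>

definition outer_normal :: "'a::euclidean_space set \<Rightarrow> 'a \<Rightarrow> 'a" where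
  "outer_normal K x = (THE z. norm z = 1 \<and> (\<forall>y\<in>K. z \<bullet> y \<le> z \<bullet> x))"

text \<open>
  The Gauss curvature of \<open>frontier K\<close> at \<open>x\<close>: the product of the principal curvatures, i.e. of
  the eigenvalues of the differential of the Gauss map. With the outer normal the sign is such
  that spheres have positive principal curvatures.
\<close>
definition gauss_curvature :: "'a::euclidean_space set \<Rightarrow> 'a \<Rightarrow> real" where
  "gauss_curvature K x =
     prod_list (eigenvalues_on (tangent_space (outer_normal K x))
       (differential (frontier K) (outer_normal K) x))"

text \<open>\<open>M\<close> is without boundary by the level-set definition, so compactness makes it closed.\<close>
definition smooth_strictly_convex :: "'a::euclidean_space set \<Rightarrow> 'a set \<Rightarrow> bool" where
  "smooth_strictly_convex M K \<longleftrightarrow>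
     compact M \<and> smooth_hypersurface M \<and>
     compact K \<and> convex K \<and> 0 \<in> interior K \<and> M = frontier K \<and>
     (\<forall>x\<in>M. gauss_curvature K x > 0)"

definition support_function :: "'a::euclidean_space set \<Rightarrow> 'a \<Rightarrow> real" where
  "support_function K z = (SUP x\<in>K. z \<bullet> x)"


section \<open>Calculus on the unit sphere\<close>

definition sphere_grad :: "('a::euclidean_space \<Rightarrow> real) \<Rightarrow> 'a \<Rightarrow> 'a" where
  "sphere_grad u z = (THE g. g \<in> tangent_space z \<and>
     (\<forall>v\<in>tangent_space z. g \<bullet> v = differential (sphere 0 1) u z v))"

text \<open>
  The Levi-Civita connection of the sphere: \<open>sphere_connection Y z v\<close> is $\nabla_v Y$ at \<open>z\<close>,
  the orthogonal projection to the tangent space of the Euclidean derivative of the tangent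
  field \<open>Y\<close> in the direction of the tangent vector \<open>v\<close>.
\<close>
definition sphere_connection :: "('a::euclidean_space \<Rightarrow> 'a) \<Rightarrow> 'a \<Rightarrow> 'a \<Rightarrow> 'a" where
  "sphere_connection Y z v =
     differential (sphere 0 1) Y z v - (z \<bullet> differential (sphere 0 1) Y z v) *\<^sub>R z"

text \<open>
  The Hessian as an endomorphism of the tangent space; the bilinear form is
  $(v, w) \mapsto g_0(\nabla_v \nabla u, w)$.
\<close>
definition sphere_hessian :: "('a::euclidean_space \<Rightarrow> real) \<Rightarrow> 'a \<Rightarrow> 'a \<Rightarrow> 'a" where
  "sphere_hessian u z v = sphere_connection (sphere_grad u) z v"

text \<open>$W = \nabla^2 u + u g_0$, with its index raised by $g_0$.\<close>
definition W :: "('a::euclidean_space \<Rightarrow> real) \<Rightarrow> 'a \<Rightarrow> 'a \<Rightarrow> 'a" where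
  "W u z v = sphere_hessian u z v + u z *\<^sub>R v"

definition P_W :: "nat \<Rightarrow> ('a::euclidean_space \<Rightarrow> real) \<Rightarrow> 'a \<Rightarrow> real" where
  "P_W k u z = normalized_esym k (eigenvalues_on (tangent_space z) (W u z))"

text \<open>The point of the hypersurface with unit outer normal \<open>z\<close>, and its distance to the origin.\<close>
definition X_map :: "('a::euclidean_space \<Rightarrow> real) \<Rightarrow> 'a \<Rightarrow> 'a" where
  "X_map u z = u z *\<^sub>R z + sphere_grad u z"

definition radial :: "('a::euclidean_space \<Rightarrow> real) \<Rightarrow> 'a \<Rightarrow> real" where
  "radial u z = norm (X_map u z)"

end

theory Submission
  imports Defs
begin

text \<open>
  Write the equation as \<open>P\<^sub>k = Q\<close> with \<open>Q = u\<^sup>p\<^sup>-\<^sup>1 exp (r\<^sup>2 / 2)\<close>, which is nondecreasing in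
  \<open>u\<close> and increasing in \<open>r\<close>. The Newton tensors \<open>T\<^sub>m\<close> of \<open>W\<close> are divergence free, and the divergence of
  \<open>G T\<^sub>m(\<nabla>u)\<close> is a positive multiple of \<open>G (P\<^sub>m\<^sub>+\<^sub>1 - u P\<^sub>m)\<close> plus \<open>\<langle>\<nabla>G, T\<^sub>m(\<nabla>u)\<rangle>\<close>. As
  \<open>\<nabla>(r\<^sup>2 / 2) = W(\<nabla>u)\<close>, the last term is negative wherever \<open>\<nabla>u \<noteq> 0\<close> if \<open>G = Q\<^sup>-\<^sup>\<alpha>\<close> with
  \<open>\<alpha> > 0\<close>. For \<open>k \<ge> 2\<close> take \<open>m = k - 1\<close> and \<open>\<alpha> = 1 - 1/k\<close>; for \<open>k = 1\<close> take
  \<open>m = \<alpha> = 1\<close>. Maclaurin's inequalities then give \<open>G (P\<^sub>m\<^sub>+\<^sub>1 - u P\<^sub>m) \<le> P\<^sub>1 - u\<close>, and the right-hand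
  side is itself a divergence (the case \<open>m = 0\<close>, \<open>G = 1\<close>). Hence a divergence is nonnegative, so it
  vanishes and \<open>\<nabla>u = 0\<close>.

  Integration over the sphere is replaced by integration over \<open>\<real>\<^sup>n\<^sup>+\<^sup>1\<close>: \<open>u\<close> is extended to a function
  homogeneous of degree one, whose Hessian has the eigenvalues of \<open>W\<close> and zero in the radial direction,
  and the fields are multiplied by a radial cut-off.
\<close>

section \<open>Elementary symmetric polynomials\<close>

text \<open>For k >= 2 put s = Q^(1/k). The exponent 1 - 1/k is the one for which G P_k = s, while
  Maclaurin gives s <= P_1 and 1 <= G P_(k-1). For k = 1 it would be 0 and nothing strict would
  remain; there P_2 <= P_1^2 takes over, and n >= 2 keeps m = 1 below n, as strict positivity of the
  term with T_m requires. The bound p >= 1 makes the derivative of u^(p-1) along T_m(\<nabla>u) add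
  to that of exp(r^2 / 2).

  The obstacle that shapes the middle of the proof is regularity. The hypotheses speak of local
  defining functions and of a product of principal curvatures, whereas the divergence computation
  needs the point X(y) with normal direction y to be twice continuously differentiable in y.
  Positive Gauss curvature makes the equations defining X(y) have injective linearization; together
  with the continuity of X this permits differentiating them, and the differentiated system is of
  the same kind.

  The weights also carry a power of |y| that cancels the homogeneity of the divergences, so that
  inequalities on the unit sphere hold along whole rays.\<close>

definition esym :: "nat \<Rightarrow> ('b \<Rightarrow> real) \<Rightarrow> 'b set \<Rightarrow> real" where
  "esym m f B = (\<Sum>J | J \<subseteq> B \<and> card J = m. \<Prod>j\<in>J. f j)"

lemma esym_0 [simp]:
  assumes "finite B"
  shows "esym 0 f B = 1"
proof -
  have "{J. J \<subseteq> B \<and> card J = 0} = {{}}"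
    using assms by (auto dest: finite_subset)
  then show ?thesis by (simp add: esym_def)
qed

lemma esym_eq_0:
  assumes "finite B" "card B < m"
  shows "esym m f B = 0"
proof -
  have "card J \<noteq> m" if "J \<subseteq> B" for J
    using card_mono[OF assms(1) that] assms(2) by simp
  then have "{J. J \<subseteq> B \<and> card J = m} = {}" by blast
  then show ?thesis unfolding esym_def by (simp only: sum.empty)
qed

lemma esym_insert:
  assumes "finite B" "a \<notin> B"
  shows "esym (Suc m) f (insert a B) = esym (Suc m) f B + f a * esym m f B"
proof -
  let ?S = "\<lambda>m B. {J. J \<subseteq> B \<and> card J = m}"
  have fin: "finite (?S k B)" for k using assms(1) by auto
  have eq: "?S (Suc m) (insert a B) = ?S (Suc m) B \<union> insert a ` ?S m B"
  proof (intro equalityI subsetI)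
    fix J assume J: "J \<in> ?S (Suc m) (insert a B)"
    have fJ: "finite J" using J assms(1) finite_subset by blast
    show "J \<in> ?S (Suc m) B \<union> insert a ` ?S m B"
    proof (cases "a \<in> J")
      case True
      then have "J = insert a (J - {a})" "J - {a} \<in> ?S m B" using J fJ by auto
      then show ?thesis by blast
    next
      case False
      then show ?thesis using J by auto
    qed
  next
    fix J assume "J \<in> ?S (Suc m) B \<union> insert a ` ?S m B"
    then show "J \<in> ?S (Suc m) (insert a B)"
    proof
      assume "J \<in> insert a ` ?S m B"
      then obtain I where I: "J = insert a I" "I \<subseteq> B" "card I = m" by auto
      then have "finite I" "a \<notin> I" using assms finite_subset by auto
      then show ?thesis using I by auto
    qed auto
  qed
  have disj: "?S (Suc m) B \<inter> insert a ` ?S m B = {}" using assms(2) by auto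
  have inj: "inj_on (insert a) (?S m B)"
  proof (rule inj_onI)
    fix I J assume "I \<in> ?S m B" "J \<in> ?S m B" "insert a I = insert a J"
    then show "I = J" using assms(2) by (metis (no_types, lifting) insert_ident mem_Collect_eq subsetD)
  qed
  have "esym (Suc m) f (insert a B) =
      esym (Suc m) f B + (\<Sum>J\<in>insert a ` ?S m B. \<Prod>j\<in>J. f j)"
    unfolding esym_def eq using fin disj by (intro sum.union_disjoint) auto
  also have "(\<Sum>J\<in>insert a ` ?S m B. \<Prod>j\<in>J. f j) = (\<Sum>J\<in>?S m B. \<Prod>j\<in>insert a J. f j)"
    using inj by (simp add: sum.reindex)
  also have "\<dots> = (\<Sum>J\<in>?S m B. f a * (\<Prod>j\<in>J. f j))"
  proof (rule sum.cong[OF refl])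
    fix J assume "J \<in> ?S m B"
    then have "finite J" "a \<notin> J" using assms finite_subset by auto
    then show "(\<Prod>j\<in>insert a J. f j) = f a * (\<Prod>j\<in>J. f j)" by simp
  qed
  finally show ?thesis by (simp add: esym_def sum_distrib_left)
qed

lemma esym_remove:
  assumes "finite B" "b \<in> B"
  shows "esym (Suc m) f B = esym (Suc m) f (B - {b}) + f b * esym m f (B - {b})"
  using esym_insert[of "B - {b}" b] assms by (simp add: insert_absorb)

lemma esym_insert_zero:
  assumes "finite B" "f a = 0"
  shows "esym m f (insert a B) = esym m f B"
proof (cases "a \<in> B \<or> m = 0")
  case False
  then obtain l where "m = Suc l" by (cases m) auto
  then show ?thesis using esym_insert[of B a l f] assms False by simp
qed (use assms in \<open>auto simp: insert_absorb\<close>)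

lemma esym_pos:
  assumes "finite B" "\<And>b. b \<in> B \<Longrightarrow> f b > 0" "m \<le> card B"
  shows "esym m f B > 0"
  unfolding esym_def
proof (rule sum_pos)
  show "finite {J. J \<subseteq> B \<and> card J = m}" using assms(1) by auto
  show "{J. J \<subseteq> B \<and> card J = m} \<noteq> {}"
    using obtain_subset_with_card_n[OF assms(3)] by blast
  show "\<And>J. J \<in> {J. J \<subseteq> B \<and> card J = m} \<Longrightarrow> (\<Prod>j\<in>J. f j) > 0"
    using assms(2) by (auto intro!: prod_pos)
qed

text \<open>Double counting: the product over an index set of size m + 1 arises once for each of its
  elements \<open>b\<close>. With eigenvalues for \<open>f\<close> the left side is the trace of T_m
  A, which links these polynomials to \<open>newton_op\<close>.\<close>

lemma sum_mult_esym_remove: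
  assumes "finite B"
  shows "(\<Sum>b\<in>B. f b * esym m f (B - {b})) = real (Suc m) * esym (Suc m) f B"
  using assms
proof (induction B arbitrary: m rule: finite_induct)
  case empty
  then show ?case by (simp add: esym_eq_0)
next
  case (insert a B)
  have rem: "insert a B - {b} = insert a (B - {b})" if "b \<in> B" for b using that insert by auto
  have "(\<Sum>b\<in>insert a B. f b * esym m f (insert a B - {b})) =
      f a * esym m f B + (\<Sum>b\<in>B. f b * esym m f (insert a (B - {b})))"
    using insert rem by simp
  also have "\<dots> = real (Suc m) * esym (Suc m) f (insert a B)"
  proof (cases m)
    case 0
    then show ?thesis using insert.IH[of 0] insert.hyps by (simp add: esym_insert)
  next
    case (Suc l)
    have "(\<Sum>b\<in>B. f b * esym m f (insert a (B - {b}))) =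
        (\<Sum>b\<in>B. f b * esym m f (B - {b})) + f a * (\<Sum>b\<in>B. f b * esym l f (B - {b}))"
      using insert.hyps Suc
      by (simp add: esym_insert sum.distrib sum_distrib_left algebra_simps)
    then show ?thesis using insert Suc by (simp add: esym_insert algebra_simps)
  qed
  finally show ?case .
qed

section \<open>The inequalities of Newton and Maclaurin for positive entries\<close>

definition mean_esym :: "nat \<Rightarrow> ('b \<Rightarrow> real) \<Rightarrow> 'b set \<Rightarrow> real" where
  "mean_esym m f B = esym m f B / real (card B choose m)"

lemma esym_eq_mean_esym:
  assumes "finite B"
  shows "esym m f B = real (card B choose m) * mean_esym m f B"
  using assms esym_eq_0[of B m f] by (cases "m \<le> card B") (auto simp: mean_esym_def)

lemma mean_esym_pos:
  assumes "finite B" "\<And>b. b \<in> B \<Longrightarrow> f b > 0" "m \<le> card B"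
  shows "mean_esym m f B > 0"
  using esym_pos[OF assms] assms(3) by (simp add: mean_esym_def)

lemma mean_esym_eq_0: "finite B \<Longrightarrow> card B < m \<Longrightarrow> mean_esym m f B = 0"
  by (simp add: mean_esym_def esym_eq_0)

lemma mean_esym_nonneg:
  assumes "finite B" "\<And>b. b \<in> B \<Longrightarrow> f b > 0"
  shows "mean_esym m f B \<ge> 0"
  using mean_esym_pos[of B f m] mean_esym_eq_0[of B m f] assms by (cases "m \<le> card B") (auto intro: less_imp_le)

text \<open>Pascal's rule after normalization. With N = |B| + 1 and j = m + 1, the absorption
  identities turn the binomial quotients into the weights (N - j)/N and j/N of an average.\<close>

lemma mean_esym_insert:
  assumes "finite B" "a \<notin> B" "m \<le> card B"
  shows "real (Suc (card B)) * mean_esym (Suc m) f (insert a B) =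
    (real (card B) - real m) * mean_esym (Suc m) f B + real (Suc m) * f a * mean_esym m f B"
proof -
  let ?n = "card B"
  have c: "card (insert a B) = Suc ?n" using assms by simp
  have pos: "real (Suc ?n choose Suc m) > 0" using assms(3) by (simp only: of_nat_0_less_iff zero_less_binomial_iff Suc_le_mono)
  have 1: "real (Suc m) * real (Suc ?n choose Suc m) = real (Suc ?n) * real (?n choose m)"
    by (metis Suc_times_binomial of_nat_mult)
  have "Suc m * (?n choose Suc m) = (?n - m) * (?n choose m)"
    by (metis binomial_absorb_comp binomial_absorption mult.commute)
  then have "real (Suc m) * real (?n choose Suc m) = (real ?n - real m) * real (?n choose m)"
    using assms(3) by (metis of_nat_diff of_nat_mult)
  then have "real (Suc m) * (real (Suc ?n) * real (?n choose Suc m)) =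
      real (Suc m) * ((real ?n - real m) * real (Suc ?n choose Suc m))"
    using 1 by (metis mult.left_commute)
  then have 2: "real (Suc ?n) * real (?n choose Suc m) = (real ?n - real m) * real (Suc ?n choose Suc m)"
    by (metis mult_left_cancel of_nat_eq_0_iff nat.distinct(1))
  have "real (Suc ?n choose Suc m) * (real (Suc ?n) * mean_esym (Suc m) f (insert a B)) =
      real (Suc ?n) * esym (Suc m) f (insert a B)"
    using esym_eq_mean_esym[of "insert a B" "Suc m" f] assms(1) c by simp
  also have "\<dots> = real (Suc ?n) * (real (?n choose Suc m) * mean_esym (Suc m) f B
      + f a * (real (?n choose m) * mean_esym m f B))"
    using assms by (simp add: esym_insert esym_eq_mean_esym[OF assms(1)])
  also have "\<dots> = (real (Suc ?n) * real (?n choose Suc m)) * mean_esym (Suc m) f B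
      + (real (Suc ?n) * real (?n choose m)) * (f a * mean_esym m f B)"
    by (simp add: algebra_simps)
  also have "\<dots> = real (Suc ?n choose Suc m) * ((real ?n - real m) * mean_esym (Suc m) f B
      + real (Suc m) * f a * mean_esym m f B)"
    unfolding 2 1[symmetric] by (simp add: algebra_simps)
  finally show ?thesis using pos by simp
qed

text \<open>The inductive step of Newton's inequality in terms of numbers: \<open>a\<close>,
  \<open>b\<close>, \<open>c\<close>, \<open>d\<close> are four consecutive means of the old set,
  \<open>x\<close> is the new entry, and the three brackets are N times consecutive means of the
  enlarged set. Once the hypotheses have replaced a c, b d and a d, the two sides differ by exactly
  (c - x b)^2.\<close>

lemma newton_step:
  fixes a b c d x N j :: real
  assumes nn: "0 \<le> a" "0 \<le> b" "0 \<le> c" "0 \<le> d" "0 \<le> x" and j: "1 \<le> j" "j + 1 \<le> N"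
    and ineq: "a * c \<le> b\<^sup>2" "b * d \<le> c\<^sup>2" "a * d \<le> b * c"
  shows "((N - j + 1) * b + (j - 1) * x * a) * ((N - j - 1) * d + (j + 1) * x * c)
    \<le> ((N - j) * c + j * x * b)\<^sup>2"
proof -
  have "((N - j + 1) * b + (j - 1) * x * a) * ((N - j - 1) * d + (j + 1) * x * c) =
      ((N - j + 1) * (N - j - 1)) * (b * d) + x * ((N - j + 1) * (j + 1)) * (b * c)
      + (x * ((j - 1) * (N - j - 1))) * (a * d) + (x\<^sup>2 * ((j - 1) * (j + 1))) * (a * c)"
    by (simp add: algebra_simps power2_eq_square)
  also have "\<dots> \<le> ((N - j + 1) * (N - j - 1)) * c\<^sup>2 + x * ((N - j + 1) * (j + 1)) * (b * c)
      + (x * ((j - 1) * (N - j - 1))) * (b * c) + (x\<^sup>2 * ((j - 1) * (j + 1))) * b\<^sup>2"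
    using nn j ineq by (intro add_mono mult_left_mono mult_nonneg_nonneg) auto
  also have "\<dots> = ((N - j) * c + j * x * b)\<^sup>2 - (c - x * b)\<^sup>2"
    by (simp add: algebra_simps power2_eq_square)
  finally show ?thesis using zero_le_power2[of "c - x * b"] by linarith
qed

lemma mean_esym_newton:
  assumes "finite B" "\<And>b. b \<in> B \<Longrightarrow> f b > 0"
  shows "mean_esym m f B * mean_esym (Suc (Suc m)) f B \<le> (mean_esym (Suc m) f B)\<^sup>2"
  using assms
proof (induction B arbitrary: m rule: finite_induct)
  case empty
  then show ?case by (simp add: mean_esym_def esym_eq_0)
next
  case (insert a B)
  let ?p = "\<lambda>m. mean_esym m f B" and ?P = "\<lambda>m. mean_esym m f (insert a B)" and ?n = "card B"
  have pos: "?p i > 0" if "i \<le> ?n" for i using mean_esym_pos insert that by blast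
  have nn: "?p i \<ge> 0" for i using mean_esym_nonneg insert by blast
  have IH: "?p i * ?p (Suc (Suc i)) \<le> (?p (Suc i))\<^sup>2" for i using insert by simp
  have x: "f a > 0" using insert by simp
  show ?case
  proof (cases "Suc m \<le> ?n")
    case False
    then have "?P (Suc (Suc m)) = 0" using insert by (simp add: mean_esym_def esym_eq_0)
    then show ?thesis by simp
  next
    case True
    have N: "real (Suc ?n) > 0" by simp
    define N where "N = real (Suc ?n)"
    define j where "j = real (Suc m)"
    have e2: "N * ?P (Suc (Suc m)) = (N - j - 1) * ?p (Suc (Suc m)) + (j + 1) * f a * ?p (Suc m)"
      using mean_esym_insert[of B a "Suc m" f] insert True by (simp add: N_def j_def)
    have e1: "N * ?P (Suc m) = (N - j) * ?p (Suc m) + j * f a * ?p m"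
      using mean_esym_insert[of B a m f] insert True by (simp add: N_def j_def)
    \<comment> \<open>\<open>q\<close> is the mean of index m - 1. At m = 0 its coefficient j - 1
      vanishes, so the value 0 keeps the recursion for \<open>?P m\<close> valid.\<close>
    define q where "q = (case m of 0 \<Rightarrow> 0 | Suc l \<Rightarrow> ?p l)"
    have e0: "N * ?P m = (N - j + 1) * ?p m + (j - 1) * f a * q"
    proof (cases m)
      case 0
      then show ?thesis using insert by (simp add: N_def j_def q_def mean_esym_def)
    next
      case (Suc l)
      then show ?thesis using mean_esym_insert[of B a l f] insert True by (simp add: N_def j_def q_def)
    qed
    have q0: "q \<ge> 0" using nn by (simp add: q_def split: nat.split)
    have i1: "q * ?p (Suc m) \<le> (?p m)\<^sup>2" using IH by (simp add: q_def split: nat.split)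
    have i2: "?p m * ?p (Suc (Suc m)) \<le> (?p (Suc m))\<^sup>2" by (rule IH)
    have bc: "?p m * ?p (Suc m) > 0" using pos True by simp
    \<comment> \<open>Outer pair against inner pair: multiply the two Newton inequalities and cancel
      the positive product of the middle means.\<close>
    have "(q * ?p (Suc (Suc m))) * (?p m * ?p (Suc m)) = (q * ?p (Suc m)) * (?p m * ?p (Suc (Suc m)))"
      by (simp add: algebra_simps)
    also have "\<dots> \<le> (?p m)\<^sup>2 * (?p (Suc m))\<^sup>2" using i1 i2 nn q0 by (intro mult_mono) auto
    also have "\<dots> = (?p m * ?p (Suc m)) * (?p m * ?p (Suc m))" by (simp add: power2_eq_square)
    finally have i3: "q * ?p (Suc (Suc m)) \<le> ?p m * ?p (Suc m)" using bc
      by (metis mult_le_cancel_right_pos)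
    have "(N * ?P m) * (N * ?P (Suc (Suc m))) \<le> (N * ?P (Suc m))\<^sup>2"
      unfolding e0 e1 e2 using q0 nn x i1 i2 i3 True
      by (intro newton_step) (auto simp: N_def j_def)
    then have "N\<^sup>2 * (?P m * ?P (Suc (Suc m))) \<le> N\<^sup>2 * (?P (Suc m))\<^sup>2"
      by (simp add: power2_eq_square algebra_simps)
    then show ?thesis by (simp add: N_def)
  qed
qed

text \<open>For m > 0 this is P_(m+1)^(1/(m+1)) <= P_m^(1/m), free of roots. In the step, Newton's
  inequality raised to a power meets the induction hypothesis, and a power of P_(m+1)
  cancels.\<close>

lemma mean_esym_maclaurin_Suc:
  assumes "finite B" "\<And>b. b \<in> B \<Longrightarrow> f b > 0"
  shows "(mean_esym (Suc m) f B) ^ m \<le> (mean_esym m f B) ^ Suc m"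
proof (induction m)
  case 0
  then show ?case using assms by (simp add: mean_esym_def)
next
  case (Suc m)
  let ?p = "\<lambda>m. mean_esym m f B"
  have nn: "?p i \<ge> 0" for i using mean_esym_nonneg assms by blast
  show ?case
  proof (cases "Suc m \<le> card B")
    case False
    then show ?thesis using mean_esym_eq_0[of B "Suc (Suc m)" f] assms(1) nn by simp
  next
    case True
    have pp: "?p m > 0" "?p (Suc m) > 0" using mean_esym_pos[of B f] assms True by auto
    have "(?p (Suc m)) ^ m * (?p (Suc (Suc m))) ^ Suc m \<le> (?p m) ^ Suc m * (?p (Suc (Suc m))) ^ Suc m"
      using Suc nn by (intro mult_right_mono) auto
    also have "\<dots> = (?p m * ?p (Suc (Suc m))) ^ Suc m" by (simp add: power_mult_distrib)
    also have "\<dots> \<le> ((?p (Suc m))\<^sup>2) ^ Suc m"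
      using mean_esym_newton[of B f m] assms nn by (intro power_mono) auto
    also have "\<dots> = (?p (Suc m)) ^ m * (?p (Suc m)) ^ Suc (Suc m)"
    proof -
      have "2 * Suc m = m + Suc (Suc m)" by simp
      then show ?thesis by (metis power_add power_mult)
    qed
    finally show ?thesis using pp by simp
  qed
qed

lemma mean_esym_le_mean:
  assumes "finite B" "\<And>b. b \<in> B \<Longrightarrow> f b > 0"
  shows "mean_esym (Suc m) f B \<le> (mean_esym 1 f B) ^ Suc m"
proof (induction m)
  case (Suc m)
  let ?p = "\<lambda>m. mean_esym m f B"
  have nn: "?p i \<ge> 0" for i using mean_esym_nonneg assms by blast
  have "(?p (Suc (Suc m))) ^ Suc m \<le> (?p (Suc m)) ^ Suc (Suc m)"
    by (rule mean_esym_maclaurin_Suc) (use assms in auto)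
  also have "\<dots> \<le> ((?p 1) ^ Suc m) ^ Suc (Suc m)" using Suc nn by (intro power_mono) auto
  also have "\<dots> = ((?p 1) ^ Suc (Suc m)) ^ Suc m" by (metis mult.commute power_mult)
  finally show ?case using nn power_le_imp_le_base by (metis zero_le_power)
qed simp

text \<open>\<open>Q\<close> is the common value of P_k and of the right-hand side of the equation,
  \<open>u\<close> the value of the support function. The two sides are what the two divergences
  amount to on the unit sphere after division by a common constant, apart from the term with the
  derivative of the weight.\<close>

lemma esym_inequality:
  assumes B: "finite B" "\<And>b. b \<in> B \<Longrightarrow> \<mu> b > 0" and n: "card B = n" "2 \<le> n" and k: "1 \<le> k" "k \<le> n"
    and Q: "mean_esym k \<mu> B = Q" "Q > 0" and u: "u > 0"
    and m: "m = (if k = 1 then 1 else k - 1)" and \<alpha>: "\<alpha> = (if k = 1 then 1 else 1 - 1 / real k)"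
  shows "Q powr (- \<alpha>) * (mean_esym (Suc m) \<mu> B - u * mean_esym m \<mu> B) \<le> mean_esym 1 \<mu> B - u"
proof (cases "k = 1")
  case True
  then have m1: "m = 1" "\<alpha> = 1" using m \<alpha> by auto
  have P1: "mean_esym 1 \<mu> B = Q" using Q True by simp
  have "mean_esym (Suc 1) \<mu> B \<le> Q ^ Suc 1" using mean_esym_le_mean[of B \<mu> 1, OF B] P1 by simp
  then have "mean_esym (Suc m) \<mu> B - u * mean_esym m \<mu> B \<le> Q * (Q - u)"
    using m1 P1 by (simp add: algebra_simps power2_eq_square)
  then have "Q powr (- \<alpha>) * (mean_esym (Suc m) \<mu> B - u * mean_esym m \<mu> B) \<le> Q powr (- \<alpha>) * (Q * (Q - u))"
    by (intro mult_left_mono) auto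
  also have "\<dots> = Q - u" using m1 Q(2) by (simp add: powr_minus)
  finally show ?thesis using P1 by simp
next
  case False
  then have k2: "k \<ge> 2" "k = Suc m" "\<alpha> = 1 - 1 / real k" using k m \<alpha> by auto
  \<comment> \<open>\<open>s\<close> is the common value that all P_i^(1/i) would have if the
    entries were equal. The exponent is chosen so that Q^\<alpha> = s^m.\<close>
  define s where "s = Q powr (1 / real k)"
  have s: "s > 0" using Q by (simp add: s_def)
  have sk: "s ^ k = Q" unfolding s_def using Q(2) k by (simp add: powr_realpow[symmetric] powr_powr)
  have \<alpha>m: "\<alpha> * real k = real m" using k2 by (simp add: field_simps)
  have sm: "s ^ m = Q powr \<alpha>"
  proof -
    have "s ^ m = s powr real m" using s by (simp add: powr_realpow)
    also have "\<dots> = Q powr (1 / real k * real m)" by (simp add: s_def powr_powr)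
    also have "1 / real k * real m = \<alpha>" using \<alpha>m k by (simp add: field_simps)
    finally show ?thesis .
  qed
  have P1: "s \<le> mean_esym 1 \<mu> B"
  proof (rule power_le_imp_le_base)
    show "s ^ Suc m \<le> mean_esym 1 \<mu> B ^ Suc m"
      using mean_esym_le_mean[of B \<mu> m, OF B] Q sk k2 by simp
    show "0 \<le> mean_esym 1 \<mu> B" using mean_esym_pos[of B \<mu> 1, OF B] n by simp
  qed
  have Pm: "s ^ m \<le> mean_esym m \<mu> B"
  proof (rule power_le_imp_le_base)
    have "(s ^ m) ^ Suc m = (s ^ Suc m) ^ m" by (simp only: power_mult[symmetric] mult.commute)
    also have "\<dots> = Q ^ m" using sk k2 by simp
    also have "\<dots> \<le> mean_esym m \<mu> B ^ Suc m"
      using mean_esym_maclaurin_Suc[of B \<mu> m, OF B] Q k2 by simp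
    finally show "(s ^ m) ^ Suc m \<le> mean_esym m \<mu> B ^ Suc m" .
    show "0 \<le> mean_esym m \<mu> B" using mean_esym_pos[of B \<mu> m, OF B] n k k2 by simp
  qed
  have "mean_esym (Suc m) \<mu> B - u * mean_esym m \<mu> B \<le> s ^ Suc m - u * s ^ m"
    using Q sk k2 Pm u by simp
  also have "\<dots> = Q powr \<alpha> * (s - u)" unfolding sm[symmetric] by (simp add: algebra_simps)
  finally have "Q powr (- \<alpha>) * (mean_esym (Suc m) \<mu> B - u * mean_esym m \<mu> B) \<le> Q powr (- \<alpha>) * (Q powr \<alpha> * (s - u))"
    by (intro mult_left_mono) auto
  also have "\<dots> = s - u" using Q(2) by (simp add: powr_minus)
  also have "\<dots> \<le> mean_esym 1 \<mu> B - u" using P1 by simp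
  finally show ?thesis .
qed

section \<open>Newton operators\<close>

definition op_trace :: "('a::euclidean_space \<Rightarrow> 'a) \<Rightarrow> real" where
  "op_trace L = (\<Sum>b\<in>Basis. b \<bullet> L b)"

text \<open>Independence of the basis, which allows traces to be read off in an eigenbasis.\<close>

lemma op_trace_orthonormal_basis:
  assumes "linear L" "finite B" "pairwise orthogonal B" "\<And>b. b \<in> B \<Longrightarrow> norm b = 1" "span B = UNIV"
  shows "op_trace L = (\<Sum>b\<in>B. b \<bullet> L b)"
proof -
  interpret linear L by fact
  have ex: "(\<Sum>b\<in>B. (b \<bullet> x) *\<^sub>R b) = x" for x
    using orthonormal_basis_expand[OF assms(3,4) _ assms(2), of x] assms(5) by (simp add: inner_commute)
  have "op_trace L = (\<Sum>e\<in>Basis. e \<bullet> L (\<Sum>b\<in>B. (b \<bullet> e) *\<^sub>R b))"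
    by (simp add: op_trace_def ex)
  also have "\<dots> = (\<Sum>e\<in>Basis. \<Sum>b\<in>B. (b \<bullet> e) * (e \<bullet> L b))"
    by (simp only: sum scale inner_sum_right inner_scaleR_right)
  also have "\<dots> = (\<Sum>b\<in>B. \<Sum>e\<in>Basis. (b \<bullet> e) * (e \<bullet> L b))" by (rule sum.swap)
  also have "\<dots> = (\<Sum>b\<in>B. b \<bullet> L b)"
    by (intro sum.cong refl) (subst euclidean_inner, simp add: inner_commute)
  finally show ?thesis .
qed

lemma op_trace_comm:
  fixes L M :: "'a::euclidean_space \<Rightarrow> 'a"
  assumes "linear L" "linear M"
  shows "op_trace (\<lambda>x. L (M x)) = op_trace (\<lambda>x. M (L x))"
proof -
  have *: "op_trace (\<lambda>x. L (M x)) = (\<Sum>b\<in>Basis. \<Sum>e\<in>Basis. (M b \<bullet> e) * (b \<bullet> L e))"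
    if "linear L" for L M :: "'a \<Rightarrow> 'a"
  proof -
    interpret linear L by fact
    have "b \<bullet> L (M b) = (\<Sum>e\<in>Basis. (M b \<bullet> e) * (b \<bullet> L e))" for b
    proof -
      have "L (M b) = L (\<Sum>e\<in>Basis. (M b \<bullet> e) *\<^sub>R e)" by (simp add: euclidean_representation)
      also have "\<dots> = (\<Sum>e\<in>Basis. (M b \<bullet> e) *\<^sub>R L e)" by (simp add: sum scale)
      finally show ?thesis by (simp add: inner_sum_right)
    qed
    then show ?thesis by (simp add: op_trace_def)
  qed
  show ?thesis unfolding *[OF assms(1)] *[OF assms(2)]
    by (subst sum.swap) (simp add: inner_commute mult.commute)
qed

lemma op_trace_add: "op_trace (\<lambda>x. L x + M x) = op_trace L + op_trace M"
  by (simp add: op_trace_def inner_add_right sum.distrib)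

lemma op_trace_diff: "op_trace (\<lambda>x. L x - M x) = op_trace L - op_trace M"
  by (simp add: op_trace_def inner_diff_right sum_subtractf)

lemma op_trace_scale: "op_trace (\<lambda>x. c *\<^sub>R L x) = c * op_trace L"
  by (simp add: op_trace_def sum_distrib_left)

lemma op_trace_uminus: "op_trace (\<lambda>x. - L x) = - op_trace L"
  by (simp add: op_trace_def sum_negf)

lemma op_trace_sum: "op_trace (\<lambda>x. \<Sum>i\<in>I. L i x) = (\<Sum>i\<in>I. op_trace (L i))"
  by (simp add: op_trace_def inner_sum_right sum.swap[of _ I])

text \<open>The classical recursion T_(m+1) = \<sigma>_(m+1) I - T_m A, with \<sigma>_(m+1)
  expressed as tr(T_m A)/(m + 1). No eigenvalue occurs in this form, so T_m is polynomial in
  \<open>A\<close> and can be differentiated even where eigenvalues cross.\<close>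

primrec newton_op :: "('a::euclidean_space \<Rightarrow> 'a) \<Rightarrow> nat \<Rightarrow> 'a \<Rightarrow> 'a" where
  "newton_op A 0 v = v"
| "newton_op A (Suc m) v =
     (op_trace (\<lambda>x. newton_op A m (A x)) / real (Suc m)) *\<^sub>R v - newton_op A m (A v)"

definition sigma_op :: "('a::euclidean_space \<Rightarrow> 'a) \<Rightarrow> nat \<Rightarrow> real" where
  "sigma_op A m = (case m of 0 \<Rightarrow> 1 | Suc l \<Rightarrow> op_trace (\<lambda>x. newton_op A l (A x)) / real (Suc l))"

lemma sigma_op_0 [simp]: "sigma_op A 0 = 1"
  and sigma_op_Suc: "sigma_op A (Suc m) = op_trace (\<lambda>x. newton_op A m (A x)) / real (Suc m)"
  by (simp_all add: sigma_op_def)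

lemma newton_op_Suc: "newton_op A (Suc m) v = sigma_op A (Suc m) *\<^sub>R v - newton_op A m (A v)"
  by (simp add: sigma_op_Suc)

lemma linear_newton_op:
  assumes "linear A"
  shows "linear (newton_op A m)"
proof (induction m)
  case 0
  have "newton_op A 0 = (\<lambda>v. v)" by auto
  then show ?case by (simp add: linear_id[unfolded id_def])
next
  case (Suc m)
  have "linear (\<lambda>v. newton_op A m (A v))"
    using linear_compose[OF assms Suc] by (simp add: o_def)
  moreover have "linear (\<lambda>v::'a. sigma_op A (Suc m) *\<^sub>R v)" by (simp add: linear_scale_self)
  ultimately have "linear (\<lambda>v. sigma_op A (Suc m) *\<^sub>R v - newton_op A m (A v))"
    by (intro linear_compose_sub)
  then show ?case by (simp only: newton_op_Suc[abs_def])
qed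

lemma newton_op_commute:
  assumes "linear A"
  shows "newton_op A m (A v) = A (newton_op A m v)"
proof (induction m arbitrary: v)
  case (Suc m)
  interpret linear A by fact
  show ?case by (simp only: newton_op_Suc Suc diff scale)
qed simp

lemma newton_op_symmetric:
  assumes "linear A" "\<And>v w. A v \<bullet> w = v \<bullet> A w"
  shows "newton_op A m v \<bullet> w = v \<bullet> newton_op A m w"
proof (induction m arbitrary: v w)
  case (Suc m)
  show ?case
    by (simp only: newton_op_Suc inner_diff_left inner_diff_right inner_scaleR_left inner_scaleR_right
        Suc assms(2) newton_op_commute[OF assms(1)])
qed simp

text \<open>Intended for the radial direction: on the kernel of \<open>A\<close> only the constant
  term of the polynomial T_m survives.\<close>

lemma newton_op_kernel:
  assumes "linear A" "A v = 0"
  shows "newton_op A m v = sigma_op A m *\<^sub>R v"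
proof (cases m)
  case (Suc l)
  interpret N: linear "newton_op A l" using assms(1) by (rule linear_newton_op)
  show ?thesis using assms by (simp only: Suc newton_op_Suc N.zero diff_zero)
qed simp

section \<open>Newton operators as polynomials in A, and their variation\<close>

lemma newton_op_expand:
  assumes "linear A"
  shows "newton_op A m v = (\<Sum>l\<le>m. ((-1) ^ l * sigma_op A (m - l)) *\<^sub>R (A ^^ l) v)"
proof (induction m arbitrary: v)
  case (Suc m)
  have "(\<Sum>l\<le>Suc m. ((-1) ^ l * sigma_op A (Suc m - l)) *\<^sub>R (A ^^ l) v) =
      sigma_op A (Suc m) *\<^sub>R v + (\<Sum>l\<le>m. ((-1) ^ Suc l * sigma_op A (m - l)) *\<^sub>R (A ^^ Suc l) v)"
    by (subst sum.atMost_Suc_shift) simp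
  also have "(\<Sum>l\<le>m. ((-1) ^ Suc l * sigma_op A (m - l)) *\<^sub>R (A ^^ Suc l) v) = - newton_op A m (A v)"
    by (simp add: Suc funpow_swap1 sum_negf)
  finally show ?case by (simp only: newton_op_Suc) simp
qed simp

text \<open>The derivative of \<open>newton_op A m v\<close> when \<open>A\<close> varies with derivative \<open>D\<close>.\<close>
primrec newton_deriv :: "('a::euclidean_space \<Rightarrow> 'a) \<Rightarrow> ('a \<Rightarrow> 'a) \<Rightarrow> nat \<Rightarrow> 'a \<Rightarrow> 'a" where
  "newton_deriv A D 0 v = 0"
| "newton_deriv A D (Suc m) v =
     (op_trace (\<lambda>x. newton_deriv A D m (A x) + newton_op A m (D x)) / real (Suc m)) *\<^sub>R v
     - newton_deriv A D m (A v) - newton_op A m (D v)"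

lemma linear_funpow:
  fixes A :: "'a::real_vector \<Rightarrow> 'a"
  assumes "linear A"
  shows "linear (A ^^ m)"
proof (induction m)
  case 0
  show ?case by (simp add: linear_iff)
next
  case (Suc m)
  then show ?case using linear_compose[OF Suc assms] by (simp add: o_def)
qed

text \<open>Newton's identities for power sums in operator form. The recursion splits each T_(m-l)
  into a multiple of the identity minus T_(m-1-l) A. The multiples assemble to the scalar Newton
  identity and, by \<open>newton_op_expand\<close>, to T_m A; the rest is the induction hypothesis
  at \<open>A v\<close>.\<close>

lemma newton_op_identity:
  assumes "linear A"
  shows "(\<Sum>l<m. (-1) ^ l *\<^sub>R (op_trace (A ^^ Suc l) *\<^sub>R newton_op A (m - Suc l) v
      - newton_op A (m - Suc l) ((A ^^ Suc l) v))) = real m *\<^sub>R newton_op A m v"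
proof (induction m arbitrary: v)
  case (Suc m)
  let ?p = "\<lambda>l. op_trace (A ^^ l)"
  have st: "newton_op A (m - l) v = sigma_op A (m - l) *\<^sub>R v - newton_op A (m - Suc l) (A v)"
    if "l < m" for l v
  proof -
    have "m - l = Suc (m - Suc l)" using that by auto
    then show ?thesis by (metis newton_op_Suc)
  qed
  have t: "real (Suc m) * sigma_op A (Suc m) = (\<Sum>l\<le>m. (-1) ^ l * sigma_op A (m - l) * ?p (Suc l))"
  proof -
    have "real (Suc m) * sigma_op A (Suc m) = op_trace (\<lambda>x. newton_op A m (A x))"
      by (simp add: sigma_op_Suc)
    also have "\<dots> = op_trace (\<lambda>x. \<Sum>l\<le>m. ((-1) ^ l * sigma_op A (m - l)) *\<^sub>R (A ^^ Suc l) x)"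
      by (simp add: newton_op_expand[OF assms] funpow_swap1)
    also have "\<dots> = (\<Sum>l\<le>m. ((-1) ^ l * sigma_op A (m - l)) * ?p (Suc l))"
      by (subst op_trace_sum) (simp only: op_trace_scale)
    finally show ?thesis .
  qed
  have "(\<Sum>l<Suc m. (-1) ^ l *\<^sub>R (?p (Suc l) *\<^sub>R newton_op A (Suc m - Suc l) v
      - newton_op A (Suc m - Suc l) ((A ^^ Suc l) v))) =
    (\<Sum>l<m. (-1) ^ l *\<^sub>R (?p (Suc l) *\<^sub>R (sigma_op A (m - l) *\<^sub>R v - newton_op A (m - Suc l) (A v))
      - (sigma_op A (m - l) *\<^sub>R (A ^^ Suc l) v - newton_op A (m - Suc l) (A ((A ^^ Suc l) v)))))
     + (-1) ^ m *\<^sub>R (?p (Suc m) *\<^sub>R v - (A ^^ Suc m) v)"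
    by (simp add: st del: funpow.simps newton_op.simps(2))
  also have "\<dots> = (\<Sum>l<m. ((-1) ^ l * sigma_op A (m - l) * ?p (Suc l)) *\<^sub>R v)
      - (\<Sum>l<m. ((-1) ^ l * sigma_op A (m - l)) *\<^sub>R (A ^^ Suc l) v)
      - (\<Sum>l<m. (-1) ^ l *\<^sub>R (?p (Suc l) *\<^sub>R newton_op A (m - Suc l) (A v)
          - newton_op A (m - Suc l) ((A ^^ Suc l) (A v))))
      + (-1) ^ m *\<^sub>R (?p (Suc m) *\<^sub>R v - (A ^^ Suc m) v)"
    unfolding sum_subtractf[symmetric]
    by (intro arg_cong2[where f="(+)"] sum.cong refl)
       (simp add: funpow_swap1 scaleR_diff_right ac_simps)
  also have "\<dots> = (\<Sum>l\<le>m. ((-1) ^ l * sigma_op A (m - l) * ?p (Suc l)) *\<^sub>R v)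
      - (\<Sum>l\<le>m. ((-1) ^ l * sigma_op A (m - l)) *\<^sub>R (A ^^ Suc l) v) - real m *\<^sub>R newton_op A m (A v)"
    unfolding Suc lessThan_Suc_atMost[symmetric] by (simp add: scaleR_diff_right del: funpow.simps)
  also have "(\<Sum>l\<le>m. ((-1) ^ l * sigma_op A (m - l)) *\<^sub>R (A ^^ Suc l) v) = newton_op A m (A v)"
    by (simp add: newton_op_expand[OF assms] funpow_swap1)
  also have "(\<Sum>l\<le>m. ((-1) ^ l * sigma_op A (m - l) * ?p (Suc l)) *\<^sub>R v) =
      (real (Suc m) * sigma_op A (Suc m)) *\<^sub>R v"
    by (simp only: t scaleR_sum_left)
  finally show ?case
    by (simp only: newton_op_Suc) (simp add: algebra_simps)
qed simp

text \<open>Equivalent to d\<sigma>_(m+1) = tr(T_m D): differentiating (m + 1) \<sigma>_(m+1) =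
  tr(T_m A) gives tr(T_m' A) + tr(T_m D), so the first trace must be m times the second. Unrolling
  the recursion of T_m' uses the claim at all smaller indices and leads to the trace of
  \<open>newton_op_identity\<close> composed with \<open>D\<close>.\<close>

lemma op_trace_newton_deriv:
  assumes "linear A" "linear D"
  shows "op_trace (\<lambda>x. newton_deriv A D m (A x)) = real m * op_trace (\<lambda>x. newton_op A m (D x))"
proof (induction m rule: less_induct)
  case (less m)
  let ?p = "\<lambda>l. op_trace (A ^^ l)" and ?c = "\<lambda>l. op_trace (\<lambda>x. newton_op A l (D x))"
  interpret A: linear A by fact
  have rec: "newton_deriv A D (Suc l) v = ?c l *\<^sub>R v - newton_deriv A D l (A v) - newton_op A l (D v)"
    if "l < m" for l v
    using less[OF that] by (simp add: op_trace_add field_simps)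
  \<comment> \<open>The exponent \<open>i\<close> is general because every unrolling moves one more
    factor \<open>A\<close> into the argument.\<close>
  have gen: "op_trace (\<lambda>x. newton_deriv A D j ((A ^^ i) x)) =
      (\<Sum>l<j. (-1) ^ l * (?p (i + l) * ?c (j - Suc l)
        - op_trace (\<lambda>x. newton_op A (j - Suc l) (D ((A ^^ (i + l)) x)))))"
    if "j \<le> m" for i j
    using that
  proof (induction j arbitrary: i)
    case 0
    then show ?case by (simp add: op_trace_def)
  next
    case (Suc j)
    have "op_trace (\<lambda>x. newton_deriv A D (Suc j) ((A ^^ i) x)) =
        ?c j * ?p i - op_trace (\<lambda>x. newton_deriv A D j ((A ^^ Suc i) x))
        - op_trace (\<lambda>x. newton_op A j (D ((A ^^ i) x)))"
      using Suc.prems by (simp add: rec op_trace_diff op_trace_scale del: newton_deriv.simps(2))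
    also have "op_trace (\<lambda>x. newton_deriv A D j ((A ^^ Suc i) x)) =
      (\<Sum>l<j. (-1) ^ l * (?p (Suc i + l) * ?c (j - Suc l)
        - op_trace (\<lambda>x. newton_op A (j - Suc l) (D ((A ^^ (Suc i + l)) x)))))"
      using Suc.IH[of "Suc i"] Suc.prems by (simp del: funpow.simps)
    finally show ?case
      unfolding sum.lessThan_Suc_shift by (simp add: sum_negf del: funpow.simps newton_deriv.simps(2))
  qed
  \<comment> \<open>T_j commutes with powers of \<open>A\<close>, so cyclicity of the trace carries
    \<open>A ^^ i\<close> across \<open>D\<close>.\<close>
  have swap: "op_trace (\<lambda>x. newton_op A j (D ((A ^^ i) x))) = op_trace (\<lambda>x. newton_op A j ((A ^^ i) (D x)))" for i j
  proof -
    have 1: "linear (\<lambda>x. newton_op A j (D x))"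
      using linear_compose[OF assms(2) linear_newton_op[OF assms(1)]] by (simp add: o_def)
    have com: "newton_op A j ((A ^^ i) x) = (A ^^ i) (newton_op A j x)" for x
      by (induction i arbitrary: x) (simp_all add: newton_op_commute[OF assms(1)])
    show ?thesis using op_trace_comm[OF 1 linear_funpow[OF assms(1), of i]] by (simp add: com)
  qed
  have "op_trace (\<lambda>x. newton_deriv A D m (A x)) = op_trace (\<lambda>x. newton_deriv A D m ((A ^^ 1) x))" by simp
  also have "\<dots> = (\<Sum>l<m. (-1) ^ l * (?p (Suc l) * ?c (m - Suc l)
        - op_trace (\<lambda>x. newton_op A (m - Suc l) ((A ^^ Suc l) (D x)))))"
    by (simp add: gen swap del: funpow.simps)
  also have "\<dots> = op_trace (\<lambda>x. \<Sum>l<m. (-1) ^ l *\<^sub>R (?p (Suc l) *\<^sub>R newton_op A (m - Suc l) (D x)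
        - newton_op A (m - Suc l) ((A ^^ Suc l) (D x))))"
    by (subst op_trace_sum) (simp only: op_trace_scale op_trace_diff)
  also have "\<dots> = real m * ?c m"
    by (simp only: newton_op_identity[OF assms(1)] op_trace_scale)
  finally show ?case .
qed

lemma newton_deriv_Suc:
  assumes "linear A" "linear D"
  shows "newton_deriv A D (Suc m) v =
    op_trace (\<lambda>x. newton_op A m (D x)) *\<^sub>R v - newton_deriv A D m (A v) - newton_op A m (D v)"
  using op_trace_newton_deriv[OF assms, of m] by (simp add: op_trace_add field_simps)

text \<open>Applied to the derivative \<open>D\<close> of a Hessian \<open>A\<close>, which is symmetric in its two arguments.\<close>
lemma divergence_newton_deriv:
  assumes A: "linear A" "\<And>v w. A v \<bullet> w = v \<bullet> A w"
    and D: "\<And>w. linear (D w)" "\<And>v w. D v w = D w v"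
  shows "(\<Sum>b\<in>Basis. b \<bullet> newton_deriv A (D b) m v) = 0"
proof (induction m arbitrary: v)
  case (Suc m)
  have "(\<Sum>b\<in>Basis. b \<bullet> newton_deriv A (D b) (Suc m) v) =
     (\<Sum>b\<in>Basis. op_trace (\<lambda>x. newton_op A m (D b x)) * (b \<bullet> v))
     - (\<Sum>b\<in>Basis. b \<bullet> newton_deriv A (D b) m (A v)) - (\<Sum>b\<in>Basis. b \<bullet> newton_op A m (D b v))"
    by (simp add: newton_deriv_Suc[OF A(1) D(1)] inner_diff_right sum_subtractf del: newton_deriv.simps(2))
  \<comment> \<open>The first and the last of the three sums both equal tr(T_m D_v), the first by
    linearity of D_v in v, the last by the symmetry of \<open>D\<close> (the Codazzi equation). They
    cancel, and the middle sum vanishes by induction.\<close>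
  also have "(\<Sum>b\<in>Basis. op_trace (\<lambda>x. newton_op A m (D b x)) * (b \<bullet> v)) = op_trace (\<lambda>x. newton_op A m (D v x))"
  proof -
    interpret N: linear "newton_op A m" using A(1) by (rule linear_newton_op)
    have "op_trace (\<lambda>x. newton_op A m (D v x)) = op_trace (\<lambda>x. newton_op A m (D x v))" by (simp add: D(2)[of v])
    have "D v x = (\<Sum>b\<in>Basis. (b \<bullet> v) *\<^sub>R D b x)" for x
    proof -
      interpret Dx: linear "D x" using D(1) .
      have "(\<Sum>b\<in>Basis. (b \<bullet> v) *\<^sub>R b) = v"
        using euclidean_representation[of v] by (simp add: inner_commute)
      then have "D v x = D x (\<Sum>b\<in>Basis. (b \<bullet> v) *\<^sub>R b)" by (simp add: D(2)[of v])
      also have "\<dots> = (\<Sum>b\<in>Basis. (b \<bullet> v) *\<^sub>R D x b)" by (simp add: Dx.sum Dx.scale)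
      finally show ?thesis by (simp add: D(2)[of x])
    qed
    then have "op_trace (\<lambda>x. newton_op A m (D v x)) = op_trace (\<lambda>x. \<Sum>b\<in>Basis. (b \<bullet> v) *\<^sub>R newton_op A m (D b x))"
      by (simp add: N.sum N.scale)
    also have "\<dots> = (\<Sum>b\<in>Basis. op_trace (\<lambda>x. newton_op A m (D b x)) * (b \<bullet> v))"
      by (subst op_trace_sum) (simp only: op_trace_scale mult.commute)
    finally show ?thesis by simp
  qed
  also have "(\<Sum>b\<in>Basis. b \<bullet> newton_op A m (D b v)) = op_trace (\<lambda>x. newton_op A m (D v x))"
    by (simp add: op_trace_def D(2)[of v])
  finally show ?case using Suc by simp
qed simp

text \<open>The two claims alternate: \<sigma>_(m+1) is a trace in the eigenbasis and follows from
  the eigenvalues of T_m; it then determines those of T_(m+1) through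
  \<open>esym_remove\<close>.\<close>

lemma newton_op_eigenvector:
  assumes A: "linear A" and B: "finite B" "pairwise orthogonal B" "\<And>b. b \<in> B \<Longrightarrow> norm b = 1" "span B = UNIV"
    and eig: "\<And>b. b \<in> B \<Longrightarrow> A b = \<mu> b *\<^sub>R b"
  shows "b \<in> B \<Longrightarrow> newton_op A m b = esym m \<mu> (B - {b}) *\<^sub>R b"
    and "sigma_op A m = esym m \<mu> B"
proof -
  have sig: "sigma_op A (Suc m) = esym (Suc m) \<mu> B"
    if "\<And>b. b \<in> B \<Longrightarrow> newton_op A m b = esym m \<mu> (B - {b}) *\<^sub>R b" for m
  proof -
    interpret N: linear "newton_op A m" using A by (rule linear_newton_op)
    have lin: "linear (\<lambda>x. newton_op A m (A x))"
      using linear_compose[OF A linear_newton_op[OF A, of m]] by (simp add: o_def)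
    have "op_trace (\<lambda>x. newton_op A m (A x)) = (\<Sum>b\<in>B. b \<bullet> newton_op A m (A b))"
      by (rule op_trace_orthonormal_basis[OF lin B])
    also have "\<dots> = (\<Sum>b\<in>B. \<mu> b * esym m \<mu> (B - {b}))"
      using that eig B(3) by (intro sum.cong) (auto simp: N.scale norm_eq_1)
    also have "\<dots> = real (Suc m) * esym (Suc m) \<mu> B" by (rule sum_mult_esym_remove[OF B(1)])
    finally show ?thesis by (simp add: sigma_op_Suc)
  qed
  have new: "newton_op A m b = esym m \<mu> (B - {b}) *\<^sub>R b" if "b \<in> B" for m b
    using that
  proof (induction m arbitrary: b)
    case 0
    then show ?case using B(1) by simp
  next
    case (Suc m)
    interpret N: linear "newton_op A m" using A by (rule linear_newton_op)
    have "sigma_op A (Suc m) = esym (Suc m) \<mu> B" by (rule sig) (rule Suc.IH)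
    also have "\<dots> = esym (Suc m) \<mu> (B - {b}) + \<mu> b * esym m \<mu> (B - {b})"
      by (rule esym_remove[OF B(1) Suc.prems])
    finally show ?case
      by (simp only: newton_op_Suc eig[OF Suc.prems] N.scale Suc.IH[OF Suc.prems])
        (simp add: algebra_simps)
  qed
  show "b \<in> B \<Longrightarrow> newton_op A m b = esym m \<mu> (B - {b}) *\<^sub>R b" by (rule new)
  show "sigma_op A m = esym m \<mu> B" using sig new B(1) by (cases m) auto
qed

section \<open>Eigenbases of self-adjoint operators\<close>

text \<open>A maximum point \<open>v\<close> of the Rayleigh quotient on the unit sphere of
  \<open>V\<close> is an eigenvector: otherwise the residual r = A v - t v would be a direction of
  first-order increase.\<close>

lemma self_adjoint_on_eigenvector:
  fixes A :: "'a::euclidean_space \<Rightarrow> 'a"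
  assumes V: "subspace V" "V \<noteq> {0}" and A: "linear A" "\<And>v. v \<in> V \<Longrightarrow> A v \<in> V"
    and sym: "\<And>v w. v \<in> V \<Longrightarrow> w \<in> V \<Longrightarrow> A v \<bullet> w = v \<bullet> A w"
  obtains v t where "v \<in> V" "norm v = 1" "A v = t *\<^sub>R v"
proof -
  interpret linear A by fact
  let ?S = "V \<inter> sphere 0 1"
  have "compact ?S" using V(1) by (intro closed_Int_compact closed_subspace compact_sphere)
  moreover have "?S \<noteq> {}"
  proof -
    obtain v where "v \<in> V" "v \<noteq> 0" using V(2) subspace_0[OF V(1)] by auto
    then have "v /\<^sub>R norm v \<in> ?S" using subspace_scale[OF V(1)] by auto
    then show ?thesis by blast
  qed
  moreover have "continuous_on ?S (\<lambda>v. v \<bullet> A v)"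
    by (intro continuous_intros linear_continuous_on linear_conv_bounded_linear[THEN iffD1] A(1))
  ultimately obtain v where v: "v \<in> ?S" and max: "\<And>w. w \<in> ?S \<Longrightarrow> w \<bullet> A w \<le> v \<bullet> A v"
    using continuous_attains_sup by metis
  define t where "t = v \<bullet> A v"
  have vV: "v \<in> V" and v1: "v \<bullet> v = 1" using v by (auto simp: norm_eq_1)
  have le: "w \<bullet> A w \<le> t * (w \<bullet> w)" if "w \<in> V" for w
  proof (cases "w = 0")
    case False
    have "(w /\<^sub>R norm w) \<bullet> A (w /\<^sub>R norm w) \<le> t"
      unfolding t_def using False that V(1) by (intro max) (auto simp: subspace_scale)
    then have "(w \<bullet> A w) / (norm w)\<^sup>2 \<le> t" by (simp add: scale power2_eq_square field_simps)
    then show ?thesis using False by (simp add: divide_simps dot_square_norm)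
  qed (simp add: zero)
  define r where "r = A v - t *\<^sub>R v"
  have rV: "r \<in> V" using vV A(2) V(1) by (simp add: r_def subspace_diff subspace_scale)
  have rr: "r \<bullet> A v = r \<bullet> r + t * (v \<bullet> r)" by (simp add: r_def inner_diff_left inner_diff_right inner_commute algebra_simps)
  have ineq: "2 * (r \<bullet> r) \<le> s * (t * (r \<bullet> r) - r \<bullet> A r)" if "s > 0" for s :: real
  proof -
    have "(v + s *\<^sub>R r) \<bullet> A (v + s *\<^sub>R r) \<le> t * ((v + s *\<^sub>R r) \<bullet> (v + s *\<^sub>R r))"
      using vV rV V(1) by (intro le) (simp add: subspace_add subspace_scale)
    also have "(v + s *\<^sub>R r) \<bullet> A (v + s *\<^sub>R r) = t + 2 * s * (r \<bullet> A v) + s\<^sup>2 * (r \<bullet> A r)"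
      using sym[OF vV rV] by (simp add: add scale inner_add_left inner_add_right t_def power2_eq_square algebra_simps inner_commute)
    also have "t * ((v + s *\<^sub>R r) \<bullet> (v + s *\<^sub>R r)) = t + 2 * s * t * (v \<bullet> r) + s\<^sup>2 * t * (r \<bullet> r)"
      using v1 by (simp add: inner_add_left inner_add_right power2_eq_square algebra_simps inner_commute)
    finally have "s * (2 * (r \<bullet> r)) \<le> s * (s * (t * (r \<bullet> r) - r \<bullet> A r))"
      by (simp add: rr power2_eq_square algebra_simps)
    then show ?thesis using that by simp
  qed
  have "r \<bullet> r \<le> 0"
  proof (rule ccontr)
    assume c: "\<not> r \<bullet> r \<le> 0"
    define d where "d = t * (r \<bullet> r) - r \<bullet> A r"
    \<comment> \<open>With this step length the second-order term is at most the squared norm of r,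
      half of the first-order gain.\<close>
    have "2 * (r \<bullet> r) \<le> (r \<bullet> r) / (\<bar>d\<bar> + 1) * d"
      unfolding d_def using c by (intro ineq divide_pos_pos) auto
    also have "\<dots> = (r \<bullet> r) * (d / (\<bar>d\<bar> + 1))" by simp
    also have "\<dots> \<le> (r \<bullet> r) * 1" using c by (intro mult_left_mono) (auto simp: divide_simps)
    finally show False using c by simp
  qed
  then have "r = 0" using inner_ge_zero[of r] inner_eq_zero_iff[of r] by linarith
  then have "A v = t *\<^sub>R v" by (simp add: r_def)
  then show thesis using that[of v t] vV v by auto
qed

text \<open>Induction on the dimension: by symmetry, the orthogonal complement within
  \<open>V\<close> of an eigenvector is invariant. Symmetry is assumed on \<open>V\<close> only,
  since a shape operator is symmetric merely on the tangent space.\<close>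

lemma self_adjoint_on_orthonormal_eigenbasis:
  fixes A :: "'a::euclidean_space \<Rightarrow> 'a"
  assumes V: "subspace V" and A: "linear A" "\<And>v. v \<in> V \<Longrightarrow> A v \<in> V"
    and sym: "\<And>v w. v \<in> V \<Longrightarrow> w \<in> V \<Longrightarrow> A v \<bullet> w = v \<bullet> A w"
  obtains B \<mu> where "finite B" "B \<subseteq> V" "pairwise orthogonal B" "\<And>b. b \<in> B \<Longrightarrow> norm b = 1"
    "span B = V" "card B = dim V" "\<And>b. b \<in> B \<Longrightarrow> A b = \<mu> b *\<^sub>R b"
proof -
  have "\<exists>B. finite B \<and> B \<subseteq> V \<and> pairwise orthogonal B \<and> (\<forall>b\<in>B. norm b = 1) \<and> span B = V \<and>
      (\<forall>b\<in>B. \<exists>t. A b = t *\<^sub>R b)"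
    using assms
  proof (induction "dim V" arbitrary: V rule: less_induct)
    case less
    show ?case
    proof (cases "V = {0}")
      case True
      then show ?thesis by (intro exI[of _ "{}"]) auto
    next
      case False
      obtain v t where v: "v \<in> V" "norm v = 1" "A v = t *\<^sub>R v"
        using self_adjoint_on_eigenvector[OF less.prems(1) False less.prems(2-4)] by blast
      define U where "U = {w \<in> V. v \<bullet> w = 0}"
      have U: "subspace U" using less.prems(1) unfolding U_def subspace_def
        by (auto simp: inner_add_right)
      have inv: "A w \<in> U" if "w \<in> U" for w
      proof -
        have "v \<bullet> A w = A v \<bullet> w" using less.prems(4)[OF v(1), of w] that by (simp add: U_def)
        then show ?thesis using that v(3) less.prems(3) by (simp add: U_def)
      qed
      have "U \<subseteq> V" "v \<notin> U" using v(2) by (auto simp: U_def norm_eq_1)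
      then have "U \<subset> V" using v(1) by auto
      then have "dim U < dim V"
        using U less.prems(1) by (metis dim_psubset span_eq_iff)
      then obtain C where C: "finite C" "C \<subseteq> U" "pairwise orthogonal C" "\<forall>b\<in>C. norm b = 1" "span C = U"
          "\<forall>b\<in>C. \<exists>t. A b = t *\<^sub>R b"
        using less.hyps[OF _ U less.prems(2) inv] less.prems(4) by (auto simp: U_def)
      have "pairwise orthogonal (insert v C)"
        using C(2,3) by (auto simp: pairwise_insert orthogonal_def U_def inner_commute)
      moreover have "span (insert v C) = V"
      proof
        show "span (insert v C) \<subseteq> V"
          using v C less.prems(1) by (intro span_minimal) (auto simp: U_def)
        show "V \<subseteq> span (insert v C)"
        proof
          fix w assume w: "w \<in> V"
          have "w - (v \<bullet> w) *\<^sub>R v \<in> U"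
            using w v less.prems(1) by (simp add: U_def subspace_diff subspace_scale inner_diff_right dot_square_norm)
          then show "w \<in> span (insert v C)" using C(5) span_breakdown_eq by metis
        qed
      qed
      ultimately show ?thesis
        using C v by (intro exI[of _ "insert v C"]) (auto simp: U_def)
    qed
  qed
  then obtain B where B: "finite B" "B \<subseteq> V" "pairwise orthogonal B" "\<forall>b\<in>B. norm b = 1" "span B = V"
      "\<forall>b\<in>B. \<exists>t. A b = t *\<^sub>R b" by blast
  obtain \<mu> where mu: "\<And>b. b \<in> B \<Longrightarrow> A b = \<mu> b *\<^sub>R b" using bchoice[OF B(6)] by blast
  have "independent B" using B(3,4) by (intro pairwise_orthogonal_independent) auto
  then have "card B = dim V" using dim_span_eq_card_independent[of B] B(5) by simp
  then show thesis using that[of B \<mu>] B mu by blast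
qed

section \<open>From eigenbases to lists of eigenvalues with multiplicity\<close>

lemma esym_reindex:
  assumes "bij_betw g I B" 
  shows "esym k \<mu> B = esym k (\<mu> \<circ> g) I"
proof -
  have inj: "inj_on g I" and B: "B = g ` I" using assms by (auto simp: bij_betw_def)
  have injJ: "inj_on g J" if "J \<subseteq> I" for J using inj that inj_on_subset by blast
  have eq: "{J. J \<subseteq> B \<and> card J = k} = image g ` {J. J \<subseteq> I \<and> card J = k}"
  proof (intro equalityI subsetI)
    fix J assume J: "J \<in> {J. J \<subseteq> B \<and> card J = k}"
    then obtain J' where "J' \<subseteq> I" "J = g ` J'" using B by (auto simp: subset_image_iff)
    then show "J \<in> image g ` {J. J \<subseteq> I \<and> card J = k}" using J injJ by (auto simp: card_image)
  qed (use B injJ in \<open>auto simp: card_image\<close>)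
  have "inj_on (image g) {J. J \<subseteq> I \<and> card J = k}"
    by (rule inj_on_subset[OF inj_on_image_Pow[OF inj]]) auto
  then have "esym k \<mu> B = (\<Sum>J | J \<subseteq> I \<and> card J = k. \<Prod>j\<in>g ` J. \<mu> j)"
    unfolding esym_def eq by (simp add: sum.reindex)
  also have "\<dots> = esym k (\<mu> \<circ> g) I"
    unfolding esym_def using injJ by (intro sum.cong) (auto simp: prod.reindex)
  finally show ?thesis .
qed

lemma normalized_esym_eq_mean_esym:
  assumes "finite B" "mset xs = image_mset \<mu> (mset_set B)"
  shows "normalized_esym k xs = mean_esym k \<mu> B"
proof -
  obtain bs where bs: "set bs = B" "distinct bs" using finite_distinct_list assms(1) by blast
  have "mset xs = mset (map \<mu> bs)" using assms(2) bs by (metis mset_map mset_set_set)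
  then obtain p where p: "p permutes {..<length (map \<mu> bs)}" "permute_list p (map \<mu> bs) = xs"
    using mset_eq_permutation by blast
  have len: "length xs = length bs" using p(2) by (metis length_map length_permute_list)
  define g where "g i = bs ! p i" for i
  have "bij_betw (\<lambda>i. bs ! i) {..<length bs} B" using bs by (intro bij_betw_nth) auto
  moreover have "bij_betw p {..<length bs} {..<length bs}" using p(1) by (simp add: permutes_imp_bij)
  ultimately have g: "bij_betw g {..<length xs} B"
    unfolding g_def len using bij_betw_trans by (fastforce simp: o_def)
  have nth: "xs ! i = (\<mu> \<circ> g) i" if "i < length xs" for i
  proof -
    have "p i < length bs" using p(1) that len permutes_in_image[of p] by fastforce
    then show ?thesis using that p len permute_list_nth[OF p(1), of i] by (auto simp: g_def)
  qed
  have "(\<Sum>J | J \<subseteq> {..<length xs} \<and> card J = k. \<Prod>j\<in>J. xs ! j) = esym k (\<mu> \<circ> g) {..<length xs}"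
    unfolding esym_def by (intro sum.cong prod.cong refl nth) auto
  then show ?thesis
    using esym_reindex[OF g, of k \<mu>] bij_betw_same_card[OF g]
    by (simp add: normalized_esym_def mean_esym_def)
qed

text \<open>The eigenspace of \<open>t\<close> is spanned by the basis vectors with \<mu> b = t, so
  its dimension counts how often \<open>t\<close> occurs among the \<mu> b.\<close>

lemma mset_eigenvalues_on:
  fixes A :: "'a::euclidean_space \<Rightarrow> 'a"
  assumes A: "linear A" and B: "finite B" "pairwise orthogonal B" "\<And>b. b \<in> B \<Longrightarrow> norm b = 1" "span B = V"
    and eig: "\<And>b. b \<in> B \<Longrightarrow> A b = \<mu> b *\<^sub>R b"
  shows "mset (eigenvalues_on V A) = image_mset \<mu> (mset_set B)"
proof -
  interpret linear A by fact
  have "dim {v \<in> V. A v = t *\<^sub>R v} = count (image_mset \<mu> (mset_set B)) t" for t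
  proof -
    let ?C = "{b \<in> B. \<mu> b = t}"
    have "{v \<in> V. A v = t *\<^sub>R v} = span ?C"
    proof
      have "b \<in> {v \<in> V. A v = t *\<^sub>R v}" if "b \<in> ?C" for b
        using that B(4) eig span_base by fastforce
      moreover have "subspace {v \<in> V. A v = t *\<^sub>R v}"
        unfolding B(4)[symmetric] subspace_def
        by (auto simp: span_0 span_add span_scale add scale zero scaleR_add_right)
      ultimately show "span ?C \<subseteq> {v \<in> V. A v = t *\<^sub>R v}" by (intro span_minimal) blast
      show "{v \<in> V. A v = t *\<^sub>R v} \<subseteq> span ?C"
      proof
        fix v assume v: "v \<in> {v \<in> V. A v = t *\<^sub>R v}"
        have ex: "v = (\<Sum>b\<in>B. (v \<bullet> b) *\<^sub>R b)"
          using orthonormal_basis_expand[OF B(2,3) _ B(1), of v] v B(4) by simp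
        have on: "b \<bullet> c = (if b = c then 1 else 0)" if "b \<in> B" "c \<in> B" for b c
          using that B(2,3) by (auto simp: pairwise_def orthogonal_def norm_eq_1)
        have z: "v \<bullet> c = 0" if "c \<in> B - ?C" for c
        proof -
          have c: "c \<in> B" using that by simp
          have "A v = (\<Sum>b\<in>B. (v \<bullet> b) *\<^sub>R (\<mu> b *\<^sub>R b))"
            using eig by (subst ex) (simp add: sum scale)
          then have "A v \<bullet> c = (\<Sum>b\<in>B. (v \<bullet> b) * (\<mu> b * (b \<bullet> c)))" by (simp add: inner_sum_left mult.assoc)
          also have "\<dots> = (\<Sum>b\<in>B. if b = c then (v \<bullet> c) * \<mu> c else 0)"
            using c on by (intro sum.cong) auto
          also have "\<dots> = (v \<bullet> c) * \<mu> c" using c B(1) by simp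
          finally have "t * (v \<bullet> c) = (v \<bullet> c) * \<mu> c" using v by simp
          then show ?thesis using that by auto
        qed
        have "v = (\<Sum>b\<in>?C. (v \<bullet> b) *\<^sub>R b)"
          by (subst ex, rule sum.mono_neutral_right) (use B(1) z in auto)
        then show "v \<in> span ?C" by (metis (no_types, lifting) span_base span_scale span_sum)
      qed
    qed
    moreover have "independent ?C"
      using B(2) B(3)[of 0] by (intro pairwise_orthogonal_independent) (auto simp: pairwise_def)
    ultimately have "dim {v \<in> V. A v = t *\<^sub>R v} = card ?C" by (simp add: dim_eq_card_independent)
    also have "\<dots> = count (image_mset \<mu> (mset_set B)) t"
    proof -
      have "\<mu> -` {t} \<inter> B = ?C" by auto
      then show ?thesis using B(1) by (simp add: count_image_mset)
    qed
    finally show ?thesis .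
  qed
  \<comment> \<open>The dimension function is the counting function of an actual finite multiset, so
    \<open>Abs_multiset\<close> returns that multiset.\<close>
  then have "(\<lambda>t. dim {v \<in> V. A v = t *\<^sub>R v}) = count (image_mset \<mu> (mset_set B))" by auto
  then show ?thesis by (simp add: eigenvalues_on_def count_inverse)
qed

text \<open>Some basis vector is not orthogonal to \<open>v\<close>, and symmetry forces its
  eigenvalue to be 0. Read contrapositively, positive Gauss curvature makes the differential of the
  Gauss map injective on tangent vectors.\<close>

lemma prod_list_eigenvalues_on_eq_0:
  fixes A :: "'a::euclidean_space \<Rightarrow> 'a"
  assumes V: "subspace V" and A: "linear A" "\<And>v. v \<in> V \<Longrightarrow> A v \<in> V"
    and sym: "\<And>v w. v \<in> V \<Longrightarrow> w \<in> V \<Longrightarrow> A v \<bullet> w = v \<bullet> A w"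
    and v: "v \<in> V" "v \<noteq> 0" "A v = 0"
  shows "prod_list (eigenvalues_on V A) = 0"
proof -
  obtain B \<mu> where B: "finite B" "B \<subseteq> V" "pairwise orthogonal B" "\<And>b. b \<in> B \<Longrightarrow> norm b = 1"
    "span B = V" "card B = dim V" "\<And>b. b \<in> B \<Longrightarrow> A b = \<mu> b *\<^sub>R b"
    using self_adjoint_on_orthonormal_eigenbasis[OF V A sym] by metis
  have "(\<Sum>b\<in>B. (v \<bullet> b) *\<^sub>R b) = v"
    using orthonormal_basis_expand[OF B(3,4) _ B(1), of v] v B(5) by simp
  then have "\<exists>b\<in>B. v \<bullet> b \<noteq> 0" using v(2) by (metis (mono_tags, lifting) scale_eq_0_iff sum.neutral)
  then obtain b where b: "b \<in> B" "v \<bullet> b \<noteq> 0" by blast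
  have "v \<bullet> A b = 0" using sym[OF v(1), of b] b B(2) v(3) by auto
  then have "\<mu> b = 0" using B(7) b by simp
  then have "0 \<in># mset (eigenvalues_on V A)"
    using b B by (subst mset_eigenvalues_on[OF A(1) B(1,3,4,5,7)]) force+
  then show ?thesis by (simp add: prod_list_zero_iff)
qed

section \<open>Divergence of compactly supported fields\<close>

lemma lborel_integral_translation:
  fixes f :: "'a::euclidean_space \<Rightarrow> real"
  assumes "f \<in> borel_measurable borel"
  shows "(\<integral>x. f (c + x) \<partial>lborel) = (\<integral>x. f x \<partial>lborel)"
proof -
  have "(\<integral>x. f x \<partial>lborel) = (\<integral>x. f x \<partial>distr lborel borel ((+) c))"
    by (simp add: lborel_distr_plus)
  also have "\<dots> = (\<integral>x. f (c + x) \<partial>lborel)" using assms by (subst integral_distr) auto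
  finally show ?thesis by simp
qed

text \<open>By translation invariance the difference quotients have vanishing integral.\<close>
lemma integral_directional_derivative_compact_support:
  fixes f :: "'a::euclidean_space \<Rightarrow> real"
  assumes der: "\<And>x. (f has_derivative f' x) (at x)"
    and cont: "\<And>v. continuous_on UNIV (\<lambda>x. f' x v)"
    and S: "compact S" "\<And>x. x \<notin> S \<Longrightarrow> f x = 0"
  shows "integrable lborel (\<lambda>x. f' x v)" and "(\<integral>x. f' x v \<partial>lborel) = 0"
proof -
  have contf: "continuous_on UNIV f"
    by (intro continuous_at_imp_continuous_on ballI has_derivative_continuous[OF der])
  obtain R where R: "R > 0" "S \<subseteq> ball 0 R"
    using bounded_subset_ballD[OF compact_imp_bounded[OF S(1)], of 0] by auto
  have f0: "f x = 0" if "norm x \<ge> R" for x using S(2)[of x] R(2) that by (cases "x \<in> S") (auto simp: subset_iff)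
  \<comment> \<open>Outside this ball all difference quotients vanish, because a translation by at
    most \<open>norm v\<close> does not reach the support. Inside, the mean value theorem bounds
    them by \<open>C\<close>, so a constant times the indicator of the ball dominates.\<close>
  let ?Q = "cball (0::'a) (R + norm v + 1)"
  have "compact ((\<lambda>x. f' x v) ` ?Q)"
    by (intro compact_continuous_image continuous_on_subset[OF cont]) auto
  then obtain C where C: "\<And>x. x \<in> ?Q \<Longrightarrow> \<bar>f' x v\<bar> \<le> C"
    using compact_imp_bounded bounded_iff by (metis imageI real_norm_def)
  have C0: "C \<ge> 0" using C[of 0] R(1) by (smt (verit) mem_cball_0 norm_ge_zero norm_zero)
  have f'0: "f' x v = 0" if "norm x > R" for x
  proof -
    have "open {x::'a. norm x > R}" by (intro open_Collect_less continuous_intros)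
    moreover have "((\<lambda>x. 0) has_derivative (\<lambda>h. 0)) (at x)" by simp
    ultimately have "(f has_derivative (\<lambda>h. 0)) (at x)"
      using has_derivative_transform_within_open[of "\<lambda>x. 0" "\<lambda>h. 0" x UNIV "{x. norm x > R}" f] that f0 by fastforce
    then show ?thesis using has_derivative_unique[OF der[of x]] by metis
  qed
  define w where "w x = C * indicator ?Q x" for x :: 'a
  have w: "integrable lborel w"
    unfolding w_def by (intro integrable_mult_right integrable_real_indicator) (auto simp: emeasure_bounded_finite[unfolded infinity_ennreal_def])
  define q where "q n x = (f (x + (1 / real (Suc n)) *\<^sub>R v) - f x) * real (Suc n)" for n x
  have lim: "(\<lambda>n. q n x) \<longlonglongrightarrow> f' x v" for x
  proof -
    have "((\<lambda>t. f (x + t *\<^sub>R v)) has_derivative (\<lambda>t. f' (x + 0 *\<^sub>R v) (t *\<^sub>R v))) (at 0)"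
      by (rule has_derivative_compose[OF _ der]) (auto intro!: derivative_eq_intros)
    then have "((\<lambda>t. f (x + t *\<^sub>R v)) has_real_derivative f' x v) (at 0)"
      using linear_scale[OF has_derivative_linear[OF der[of x]]]
      by (simp add: has_field_derivative_def mult_commute_abs)
    then have "((\<lambda>t. (f (x + t *\<^sub>R v) - f x) / t) \<longlongrightarrow> f' x v) (at 0)"
      by (simp add: DERIV_def)
    moreover have "filterlim (\<lambda>n. 1 / real (Suc n)) (at 0) sequentially"
      using lim_1_over_n LIMSEQ_Suc[OF lim_1_over_n] by (intro filterlim_atI) auto
    ultimately have "(\<lambda>n. (f (x + (1 / real (Suc n)) *\<^sub>R v) - f x) / (1 / real (Suc n))) \<longlonglongrightarrow> f' x v"
      by (rule filterlim_compose)
    then show ?thesis by (simp add: q_def)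
  qed
  have bound: "\<bar>q n x\<bar> \<le> w x" for n x
  proof (cases "x \<in> ?Q")
    case False
    have "norm ((1 / real (Suc n)) *\<^sub>R v) \<le> norm v" by (simp add: divide_simps distrib_left)
    moreover have nx: "norm x > R + norm v + 1" using False by simp
    ultimately have "norm (x + (1 / real (Suc n)) *\<^sub>R v) \<ge> R" "norm x \<ge> R"
      using nx norm_diff_ineq[of x "(1 / real (Suc n)) *\<^sub>R v"] norm_ge_zero[of v] by linarith+
    then have "q n x = 0" by (simp add: q_def f0)
    then show ?thesis using C0 by (simp add: w_def)
  next
    case True
    let ?s = "1 / real (Suc n)"
    have s: "0 < ?s" by simp
    have "((\<lambda>t. f (x + t *\<^sub>R v)) has_derivative (\<lambda>h. f' (x + t *\<^sub>R v) (h *\<^sub>R v))) (at t)" for t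
      by (rule has_derivative_compose[OF _ der]) (auto intro!: derivative_eq_intros)
    then have d: "((\<lambda>t. f (x + t *\<^sub>R v)) has_real_derivative f' (x + t *\<^sub>R v) v) (at t)" for t
      using linear_scale[OF has_derivative_linear[OF der]]
      by (simp add: has_field_derivative_def mult_commute_abs)
    obtain t where t: "f (x + ?s *\<^sub>R v) - f (x + 0 *\<^sub>R v) = (?s - 0) * f' (x + t *\<^sub>R v) v"
      using MVT2[OF s, of "\<lambda>t. f (x + t *\<^sub>R v)" "\<lambda>t. f' (x + t *\<^sub>R v) v"] d by blast
    have "\<bar>f' y v\<bar> \<le> C" for y
    proof (cases "norm y > R")
      case False
      then have "y \<in> ?Q" using norm_ge_zero[of v] unfolding mem_cball_0 by linarith
      then show ?thesis by (rule C)
    qed (use f'0 C0 in simp)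
    then show ?thesis using t True by (simp add: q_def w_def)
  qed
  have mf: "f \<in> borel_measurable borel" by (rule borel_measurable_continuous_onI[OF contf])
  have mq: "q n \<in> borel_measurable lborel" for n
  proof -
    have "continuous_on UNIV (q n)"
      unfolding q_def by (intro continuous_intros continuous_on_compose2[OF contf]) auto
    then show ?thesis using borel_measurable_continuous_onI by simp
  qed
  note dom = mq borel_measurable_continuous_onI[OF cont[of v]]
  show "integrable lborel (\<lambda>x. f' x v)"
    by (rule integrable_dominated_convergence[of _ _ q w]) (use dom w lim bound in auto)
  have "(\<lambda>n. \<integral>x. q n x \<partial>lborel) \<longlonglongrightarrow> (\<integral>x. f' x v \<partial>lborel)"
    by (rule integral_dominated_convergence[of _ _ q w]) (use dom w lim bound in auto)
  moreover have "(\<integral>x. q n x \<partial>lborel) = 0" for n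
  proof -
    have intf: "integrable lborel f"
    proof -
      have "integrable lborel (\<lambda>x. indicator (cball 0 R) x *\<^sub>R f x)"
        by (intro borel_integrable_compact continuous_on_subset[OF contf]) auto
      moreover have "(\<lambda>x. indicator (cball 0 R) x *\<^sub>R f x) = f"
        using f0 by (auto simp: indicator_def fun_eq_iff)
      ultimately show ?thesis by simp
    qed
    let ?c = "(1 / real (Suc n)) *\<^sub>R v"
    have "integrable (distr lborel borel ((+) ?c)) f" using intf by (simp add: lborel_distr_plus)
    then have intc: "integrable lborel (\<lambda>x. f (?c + x))" using mf by (subst (asm) integrable_distr_eq) auto
    have "(\<integral>x. q n x \<partial>lborel) = ((\<integral>x. f (?c + x) \<partial>lborel) - (\<integral>x. f x \<partial>lborel)) * real (Suc n)"
      unfolding q_def using intf intc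
      by (simp add: add.commute[of _ ?c] del: of_nat_Suc)
    then show ?thesis by (simp add: lborel_integral_translation[OF mf])
  qed
  ultimately show "(\<integral>x. f' x v \<partial>lborel) = 0" by (simp add: LIMSEQ_const_iff)
qed

text \<open>A compactly supported field has divergence of integral zero. A nonnegative one vanishes
  almost everywhere, hence everywhere by continuity, as balls have positive measure.\<close>

lemma divergence_nonneg_imp_zero:
  fixes V :: "'a::euclidean_space \<Rightarrow> 'a"
  assumes der: "\<And>x. (V has_derivative V' x) (at x)"
    and cont: "\<And>v. continuous_on UNIV (\<lambda>x. V' x v)"
    and S: "compact S" "\<And>x. x \<notin> S \<Longrightarrow> V x = 0"
    and nonneg: "\<And>x. op_trace (V' x) \<ge> 0"
  shows "op_trace (V' x) = 0"
proof -
  let ?d = "\<lambda>x. op_trace (V' x)"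
  have 1: "((\<lambda>x. b \<bullet> V x) has_derivative (\<lambda>v. b \<bullet> V' x v)) (at x)" for b x
    using der by (intro has_derivative_inner_right)
  have 2: "continuous_on UNIV (\<lambda>x. b \<bullet> V' x v)" for b v
    using cont by (intro continuous_intros)
  have i: "integrable lborel (\<lambda>x. b \<bullet> V' x b)" "(\<integral>x. b \<bullet> V' x b \<partial>lborel) = 0" for b
    using integral_directional_derivative_compact_support[of "\<lambda>x. b \<bullet> V x" "\<lambda>x v. b \<bullet> V' x v", OF 1 2 S(1)] S(2)
    by auto
  have int: "integrable lborel ?d" "(\<integral>x. ?d x \<partial>lborel) = 0" using i by (auto simp: op_trace_def)
  then have "AE x in lborel. ?d x = 0"
    using integral_nonneg_eq_0_iff_AE[OF int(1)] nonneg by auto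
  have "continuous_on UNIV ?d" unfolding op_trace_def using cont by (intro continuous_intros)
  show ?thesis
  proof (rule ccontr)
    assume "?d x \<noteq> 0"
    then have "?d x > 0" using nonneg[of x] by linarith
    let ?U = "{y. ?d y > 0}"
    have op: "open ?U" using \<open>continuous_on UNIV ?d\<close> by (intro open_Collect_less) auto
    obtain e where e: "e > 0" "ball x e \<subseteq> ?U"
      using op \<open>?d x > 0\<close> open_contains_ball by blast
    have "AE y in lborel. y \<notin> ball x e" using \<open>AE x in lborel. ?d x = 0\<close>
      by eventually_elim (use e(2) in auto)
    then have "emeasure lborel (ball x e) = 0"
      by (subst (asm) AE_iff_measurable[OF _ refl]) (auto simp: ball_def)
    moreover have "emeasure lborel (ball x e) > 0" using e(1) by (simp add: emeasure_ball)
    ultimately show False by simp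
  qed
qed

text \<open>Squaring the positive part yields a continuously differentiable cut-off, which is as
  much regularity as the divergence argument asks for.\<close>

lemma has_real_derivative_max_0_square:
  "((\<lambda>x. (max 0 x)\<^sup>2) has_real_derivative 2 * max 0 x) (at (x::real))"
proof -
  consider "x > 0" | "x < 0" | "x = 0" by linarith
  then show ?thesis
  proof cases
    case 1
    have "((\<lambda>x. x\<^sup>2) has_real_derivative 2 * max 0 x) (at x)"
      using 1 by (auto intro!: derivative_eq_intros)
    then show ?thesis
      by (rule has_field_derivative_transform_within_open[of _ _ _ "{0<..}"]) (use 1 in auto)
  next
    case 2
    have "((\<lambda>x. 0) has_real_derivative 2 * max 0 x) (at x)" using 2 by simp
    then show ?thesis
      by (rule has_field_derivative_transform_within_open[of _ _ _ "{..<0}"]) (use 2 in auto)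
  next
    case 3
    have "((\<lambda>h::real. (max 0 h)\<^sup>2 / h) \<longlongrightarrow> 0) (at 0)"
    proof (rule Lim_null_comparison)
      have "norm ((max 0 h)\<^sup>2 / h) \<le> \<bar>h\<bar>" for h :: real
        by (cases "h > 0") (auto simp: power2_eq_square max_def)
      then show "\<forall>\<^sub>F h in at 0. norm ((max 0 h)\<^sup>2 / h) \<le> \<bar>h\<bar>" for h :: real by simp
      show "((\<lambda>h::real. \<bar>h\<bar>) \<longlongrightarrow> 0) (at 0)" by (auto intro!: tendsto_eq_intros)
    qed
    then show ?thesis using 3 by (simp add: DERIV_def)
  qed
qed

text \<open>A radial cut-off does not contribute to the divergence of a field tangent to the spheres.\<close>
lemma tangential_divergence_nonneg_imp_zero:
  fixes V :: "'a::euclidean_space \<Rightarrow> 'a"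
  assumes der: "\<And>y. y \<noteq> 0 \<Longrightarrow> (V has_derivative V' y) (at y)"
    and cont: "\<And>y v. y \<noteq> 0 \<Longrightarrow> isCont (\<lambda>y. V' y v) y"
    and tang: "\<And>y. y \<noteq> 0 \<Longrightarrow> y \<bullet> V y = 0"
    and nonneg: "\<And>y. y \<noteq> 0 \<Longrightarrow> op_trace (V' y) \<ge> 0"
    and y: "1 < norm y" "norm y < 2"
  shows "op_trace (V' y) = 0"
proof -
  \<comment> \<open>\<open>p\<close> is positive exactly for 1 < |y| < 2, so the cut-off also
    removes the origin, where homogeneous fields are singular.\<close>
  define p where "p y = (y \<bullet> y - 1) * (4 - y \<bullet> y)" for y :: 'a
  define \<beta> where "\<beta> y = (max 0 (p y))\<^sup>2" for y
  define \<beta>' where "\<beta>' y v = 2 * max 0 (p y) * ((5 - 2 * (y \<bullet> y)) * (2 * (y \<bullet> v)))" for y v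
  define F where "F y = \<beta> y *\<^sub>R V y" for y
  define F' where "F' y v = \<beta> y *\<^sub>R V' y v + \<beta>' y v *\<^sub>R V y" for y v
  have p0: "max 0 (p y) = 0" if "norm y \<le> 1 \<or> norm y \<ge> 2" for y
  proof -
    have "y \<bullet> y \<le> 1 \<or> y \<bullet> y \<ge> 4"
      using that power_mono[of "norm y" 1 2] power_mono[of 2 "norm y" 2] by (auto simp: dot_square_norm)
    then have "p y \<le> 0" unfolding p_def by (auto intro: mult_nonpos_nonneg mult_nonneg_nonpos)
    then show ?thesis by simp
  qed
  have p: "(p has_derivative (\<lambda>v. (5 - 2 * (y \<bullet> y)) * (2 * (y \<bullet> v)))) (at y)" for y
    unfolding p_def[abs_def] by (auto intro!: derivative_eq_intros simp: inner_commute algebra_simps)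
  have \<beta>: "(\<beta> has_derivative \<beta>' y) (at y)" for y
    using has_derivative_compose[OF p has_field_derivative_imp_has_derivative[OF has_real_derivative_max_0_square], of y]
    by (simp add: \<beta>_def[abs_def] \<beta>'_def[abs_def])
  \<comment> \<open>The gradient of the cut-off is a multiple of the position vector, so it pairs to
    zero with a field tangent to the spheres.\<close>
  have sum_\<beta>': "(\<Sum>b\<in>Basis. \<beta>' x b * (b \<bullet> w)) = 4 * max 0 (p x) * (5 - 2 * (x \<bullet> x)) * (x \<bullet> w)" for x w
    unfolding \<beta>'_def euclidean_inner[of x w] sum_distrib_left
    by (intro sum.cong refl) (simp add: inner_commute[of w])
  have F0: "F y = 0" "F' y v = 0" if "norm y \<le> 1 \<or> norm y \<ge> 2" for y v
    using p0[OF that] by (simp_all add: F_def F'_def \<beta>_def \<beta>'_def)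
  have ball0: "y \<in> ball (0::'a) 1 \<Longrightarrow> norm y \<le> 1 \<or> norm y \<ge> 2" for y by simp
  have zero: "op_trace (F' y) = 0" for y
  proof (rule divergence_nonneg_imp_zero[where V=F and V'=F' and S="cball 0 2"])
    fix x :: 'a
    show "(F has_derivative F' x) (at x)"
    proof (cases "x = 0")
      case False
      show ?thesis unfolding F_def[abs_def] F'_def[abs_def]
        by (rule has_derivative_scaleR[OF \<beta> der[OF False]])
    next
      case True
      have F'x: "F' x = (\<lambda>v. 0)" using F0(2)[of x] True by auto
      have "((\<lambda>y. 0) has_derivative F' x) (at x)" unfolding F'x by simp
      then show ?thesis
        by (rule has_derivative_transform_within_open[of _ _ _ UNIV "ball 0 1"])
          (use True F0(1)[OF ball0] in auto)
    qed
    show "op_trace (F' x) \<ge> 0"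
    proof (cases "x = 0")
      case True
      then show ?thesis using F0(2)[of x] by (simp add: op_trace_def)
    next
      case False
      have "op_trace (F' x) = \<beta> x * op_trace (V' x) + (\<Sum>b\<in>Basis. \<beta>' x b * (b \<bullet> V x))"
        by (simp add: op_trace_def F'_def inner_add_right sum.distrib sum_distrib_left)
      also have "(\<Sum>b\<in>Basis. \<beta>' x b * (b \<bullet> V x)) = 0"
        using tang[OF False] by (simp add: sum_\<beta>')
      finally show ?thesis using nonneg[OF False] by (simp add: \<beta>_def)
    qed
  next
    show "continuous_on UNIV (\<lambda>x. F' x v)" for v
      unfolding continuous_on_eq_continuous_at[OF open_UNIV]
    proof
      fix x :: 'a
      show "isCont (\<lambda>x. F' x v) x"
      proof (cases "x = 0")
        case True
        have "\<forall>\<^sub>F z in nhds x. F' z v = 0"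
          using eventually_nhds_in_open[of "ball 0 1" x] True by (auto elim!: eventually_mono intro!: F0(2))
        then show ?thesis by (subst isCont_cong) auto
      next
        case False
        have "isCont V x" using has_derivative_continuous[OF der[OF False]] .
        moreover have "isCont \<beta> x" using has_derivative_continuous[OF \<beta>] .
        moreover have "isCont p x" using has_derivative_continuous[OF p] .
        ultimately show ?thesis unfolding F'_def \<beta>'_def using cont[OF False]
          by (intro continuous_intros) auto
      qed
    qed
  qed (use F0 in auto)
  have "y \<noteq> 0" using y by auto
  have "y \<bullet> y > 1" "y \<bullet> y < 4"
    using y power_strict_mono[of 1 "norm y" 2] power_strict_mono[of "norm y" 2 2] by (auto simp: dot_square_norm)
  then have "p y > 0" by (simp add: p_def)
  then have "\<beta> y > 0" by (simp add: \<beta>_def)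
  have "op_trace (F' y) = \<beta> y * op_trace (V' y) + (\<Sum>b\<in>Basis. \<beta>' y b * (b \<bullet> V y))"
    by (simp add: op_trace_def F'_def inner_add_right sum.distrib sum_distrib_left)
  also have "(\<Sum>b\<in>Basis. \<beta>' y b * (b \<bullet> V y)) = 0"
    using tang[OF \<open>y \<noteq> 0\<close>] by (simp add: sum_\<beta>')
  finally show ?thesis using zero[of y] \<open>\<beta> y > 0\<close> by simp
qed

section \<open>Implicitly defined maps and second derivatives\<close>

lemma linear_eq_sum_Basis:
  fixes M :: "'b::euclidean_space \<Rightarrow> 'c::real_vector"
  assumes "linear M"
  shows "M v = (\<Sum>b\<in>Basis. (v \<bullet> b) *\<^sub>R M b)"
proof -
  interpret linear M by fact
  show ?thesis by (subst euclidean_representation[of v, symmetric]) (simp add: sum scale)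
qed

text \<open>The implicit function \<xi> and its continuity are given and only differentiability is
  at stake, so injectivity of \<open>L\<close> suffices. A left inverse of \<open>L\<close> gives a
  Lipschitz bound for \<xi>, and this converts the error of \<open>F\<close>, small relative to the
  increment of \<xi>, into one small relative to z - y.\<close>

lemma implicit_differentiable:
  fixes \<xi> :: "'a::euclidean_space \<Rightarrow> 'b::euclidean_space" and F :: "'b \<Rightarrow> 'c::euclidean_space"
  assumes F: "(F has_derivative L) (at (\<xi> y))" and L: "inj L"
    and \<xi>: "isCont \<xi> y" and G: "(G has_derivative G') (at y)"
    and eq: "\<forall>\<^sub>F z in nhds y. F (\<xi> z) = G z"
  shows "\<exists>\<xi>'. (\<xi> has_derivative \<xi>') (at y) \<and> (\<forall>v. L (\<xi>' v) = G' v)"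
proof -
  have linL: "linear L" using F has_derivative_linear by blast
  obtain R where R: "linear R" "R \<circ> L = id" using linear_injective_left_inverse[OF linL L] by blast
  have RL: "R (L v) = v" for v using R(2) by (metis comp_apply id_apply)
  obtain C where C: "C > 0" "\<And>x. norm (R x) \<le> C * norm x"
    using linear_bounded_pos[OF R(1)] by blast
  have FG: "F (\<xi> y) = G y" using eq eventually_nhds_x_imp_x by blast
  interpret R: linear R by fact
  interpret L: linear L by fact
  interpret G': bounded_linear G' using G has_derivative_bounded_linear by blast
  obtain D where D: "D > 0" "\<And>x. norm (G' x) \<le> norm x * D" using G'.pos_bounded by blast
  have evF: "\<forall>\<^sub>F z in nhds y. norm (F (\<xi> z) - F (\<xi> y) - L (\<xi> z - \<xi> y)) \<le> e * norm (\<xi> z - \<xi> y)"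
    if "e > 0" for e
  proof -
    obtain d where d: "d > 0" "\<And>u. norm (u - \<xi> y) < d \<Longrightarrow> norm (F u - F (\<xi> y) - L (u - \<xi> y)) \<le> e * norm (u - \<xi> y)"
      using F \<open>e > 0\<close> unfolding has_derivative_at_alt by blast
    have "\<forall>\<^sub>F z in nhds y. dist (\<xi> z) (\<xi> y) < d"
      using \<xi> d(1) by (simp add: isCont_def tendsto_iff eventually_nhds_conv_at)
    then show ?thesis by eventually_elim (use d in \<open>simp add: dist_norm\<close>)
  qed
  have evG: "\<forall>\<^sub>F z in nhds y. norm (G z - G y - G' (z - y)) \<le> e * norm (z - y)" if "e > 0" for e
  proof -
    obtain d where d: "d > 0" "\<And>z. norm (z - y) < d \<Longrightarrow> norm (G z - G y - G' (z - y)) \<le> e * norm (z - y)"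
      using G \<open>e > 0\<close> unfolding has_derivative_at_alt by blast
    then show ?thesis unfolding eventually_nhds_metric by (auto simp: dist_norm)
  qed
  have key: "norm (\<xi> z - \<xi> y - R (G' (z - y))) \<le> C * (norm (G z - G y - G' (z - y)) + norm (F (\<xi> z) - F (\<xi> y) - L (\<xi> z - \<xi> y)))"
    if "F (\<xi> z) = G z" for z
  proof -
    have "\<xi> z - \<xi> y - R (G' (z - y)) = R ((G z - G y - G' (z - y)) - (F (\<xi> z) - F (\<xi> y) - L (\<xi> z - \<xi> y)))"
      using that FG by (simp add: R.diff RL)
    also have "norm \<dots> \<le> C * norm ((G z - G y - G' (z - y)) - (F (\<xi> z) - F (\<xi> y) - L (\<xi> z - \<xi> y)))" by (rule C(2))
    also have "\<dots> \<le> C * (norm (G z - G y - G' (z - y)) + norm (F (\<xi> z) - F (\<xi> y) - L (\<xi> z - \<xi> y)))"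
      using C(1) norm_triangle_ineq4 by (intro mult_left_mono) auto
    finally show ?thesis .
  qed
  define E where "E = 2 * C * (1 + D)"
  \<comment> \<open>The choice 1/(2C) leaves half of the increment of \<xi> on the right, where it
    is absorbed; this is the origin of E = 2C(1 + D).\<close>
  have lip: "\<forall>\<^sub>F z in nhds y. norm (\<xi> z - \<xi> y) \<le> E * norm (z - y)"
  proof -
    have e: "1 / (2 * C) > 0" using C by simp
    show ?thesis
      using eq evF[OF e] evG[of 1, OF zero_less_one]
    proof eventually_elim
      case (elim z)
      have "norm (\<xi> z - \<xi> y) \<le> norm (R (G' (z - y))) + norm (\<xi> z - \<xi> y - R (G' (z - y)))"
        using norm_triangle_sub by blast
      also have "\<dots> \<le> C * (norm (z - y) * D) + C * (1 * norm (z - y) + 1 / (2 * C) * norm (\<xi> z - \<xi> y))"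
      proof (rule add_mono)
        show "norm (R (G' (z - y))) \<le> C * (norm (z - y) * D)"
          using C(2)[of "G' (z - y)"] D(2)[of "z - y"] C(1) by (meson mult_left_mono order_trans less_imp_le)
        show "norm (\<xi> z - \<xi> y - R (G' (z - y))) \<le> C * (1 * norm (z - y) + 1 / (2 * C) * norm (\<xi> z - \<xi> y))"
          using key[OF elim(1)] mult_left_mono[OF add_mono[OF elim(3) elim(2)], of C] C(1) by linarith
      qed
      also have "\<dots> = E / 2 * norm (z - y) + norm (\<xi> z - \<xi> y) / 2"
        using C(1) by (simp add: E_def field_simps)
      finally show ?case by simp
    qed
  qed
  have E: "E > 0" using C D by (simp add: E_def)
  have "(\<xi> has_derivative (\<lambda>v. R (G' v))) (at y)"
    unfolding has_derivative_at_alt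
  proof (intro conjI allI impI)
    show "bounded_linear (\<lambda>v. R (G' v))"
      using bounded_linear_compose[of R G'] G'.bounded_linear_axioms R(1) linear_conv_bounded_linear by blast
    fix e :: real assume "e > 0"
    define e1 e2 where "e1 = e / (2 * C)" and "e2 = e / (2 * C * E)"
    have pos: "e1 > 0" "e2 > 0" using \<open>e > 0\<close> C E by (auto simp: e1_def e2_def)
    have "\<forall>\<^sub>F z in nhds y. norm (\<xi> z - \<xi> y - R (G' (z - y))) \<le> e * norm (z - y)"
      using eq evF[OF pos(2)] evG[OF pos(1)] lip
    proof eventually_elim
      case (elim z)
      have "norm (\<xi> z - \<xi> y - R (G' (z - y))) \<le> C * (e1 * norm (z - y) + e2 * norm (\<xi> z - \<xi> y))"
        using key[OF elim(1)] mult_left_mono[OF add_mono[OF elim(3) elim(2)], of C] C(1) by linarith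
      also have "\<dots> \<le> C * (e1 * norm (z - y) + e2 * (E * norm (z - y)))"
        using C(1) pos elim(4) by (intro mult_left_mono add_left_mono) auto
      also have "\<dots> = e * norm (z - y)" using C(1) E by (simp add: e1_def e2_def field_simps)
      finally show ?case .
    qed
    then show "\<exists>d>0. \<forall>z. norm (z - y) < d \<longrightarrow> norm (\<xi> z - \<xi> y - R (G' (z - y))) \<le> e * norm (z - y)"
      unfolding eventually_nhds_metric by (auto simp: dist_norm)
  qed
  \<comment> \<open>\<open>R\<close> is only a left inverse. That G' v lies in the range of
    \<open>L\<close> comes from differentiating F(\<xi> z) = G z by the chain rule.\<close>
  moreover have "L (R (G' v)) = G' v" for v
  proof -
    have "((\<lambda>z. F (\<xi> z)) has_derivative (\<lambda>v. L (R (G' v)))) (at y)"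
      using has_derivative_compose[OF calculation F] .
    moreover have "((\<lambda>z. F (\<xi> z)) has_derivative G') (at y)"
    proof -
      obtain T where T: "open T" "y \<in> T" "\<And>z. z \<in> T \<Longrightarrow> F (\<xi> z) = G z"
        using eq unfolding eventually_nhds by blast
      show ?thesis
        by (rule has_derivative_transform_within_open[OF G T(1,2)]) (simp add: T(3))
    qed
    ultimately show ?thesis using has_derivative_unique by metis
  qed
  ultimately show ?thesis by blast
qed

lemma tendsto_linear_family:
  fixes L :: "'a \<Rightarrow> 'b::euclidean_space \<Rightarrow> 'c::real_normed_vector"
  assumes lin: "\<forall>\<^sub>F x in F. linear (L x)" "linear L0"
    and L: "\<And>b. b \<in> Basis \<Longrightarrow> ((\<lambda>x. L x b) \<longlongrightarrow> L0 b) F" and f: "(f \<longlongrightarrow> f0) F"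
  shows "((\<lambda>x. L x (f x)) \<longlongrightarrow> L0 f0) F"
proof -
  note ex = linear_eq_sum_Basis
  have "((\<lambda>x. \<Sum>b\<in>Basis. (f x \<bullet> b) *\<^sub>R L x b) \<longlongrightarrow> (\<Sum>b\<in>Basis. (f0 \<bullet> b) *\<^sub>R L0 b)) F"
    by (intro tendsto_intros f L)
  then have "((\<lambda>x. \<Sum>b\<in>Basis. (f x \<bullet> b) *\<^sub>R L x b) \<longlongrightarrow> L0 f0) F" by (simp only: ex[OF lin(2), symmetric])
  then show ?thesis
    by (rule Lim_transform_eventually) (use lin(1) in eventually_elim, simp add: ex[symmetric])
qed

text \<open>Continuity of the solution of a linear system with varying coefficients.
  \<open>S x\<close> bounds the distance of \<open>L x\<close> from \<open>L0\<close> in operator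
  norm; a left inverse of \<open>L0\<close> controls f x - f0 up to a term that is absorbed once S x
  < 1/(2C).\<close>

lemma tendsto_injective_linear_family:
  fixes L :: "'a \<Rightarrow> 'b::euclidean_space \<Rightarrow> 'c::euclidean_space"
  assumes lin: "\<forall>\<^sub>F x in F. linear (L x)" "linear L0" and inj: "inj L0"
    and L: "\<And>b. b \<in> Basis \<Longrightarrow> ((\<lambda>x. L x b) \<longlongrightarrow> L0 b) F"
    and f: "((\<lambda>x. L x (f x)) \<longlongrightarrow> L0 f0) F"
  shows "(f \<longlongrightarrow> f0) F"
proof -
  obtain R where R: "linear R" "R \<circ> L0 = id" using linear_injective_left_inverse[OF lin(2) inj] by blast
  have RL: "R (L0 v) = v" for v using R(2) by (metis comp_apply id_apply)
  obtain C where C: "C > 0" "\<And>x. norm (R x) \<le> C * norm x"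
    using linear_bounded_pos[OF R(1)] by blast
  interpret R: linear R by fact
  interpret L0: linear L0 by fact
  define S where "S x = (\<Sum>b\<in>Basis. norm (L x b - L0 b))" for x
  have S: "(S \<longlongrightarrow> 0) F"
  proof -
    have "(S \<longlongrightarrow> (\<Sum>b\<in>(Basis::'b set). norm (L0 b - L0 b))) F"
      unfolding S_def by (intro tendsto_intros L)
    then show ?thesis by simp
  qed
  have est: "norm (L x v - L0 v) \<le> S x * norm v" if "linear (L x)" for x v
  proof -
    have "L x v - L0 v = (\<Sum>b\<in>Basis. (v \<bullet> b) *\<^sub>R (L x b - L0 b))"
      using linear_eq_sum_Basis[OF that, of v] linear_eq_sum_Basis[OF lin(2), of v]
      by (simp add: sum_subtractf scaleR_diff_right)
    also have "norm \<dots> \<le> (\<Sum>b\<in>Basis. norm v * norm (L x b - L0 b))"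
      by (intro sum_norm_le) (simp add: mult_right_mono Basis_le_norm)
    finally show ?thesis by (simp add: S_def sum_distrib_left mult.commute)
  qed
  have d: "\<forall>\<^sub>F x in F. norm (f x - f0) \<le> 2 * C * (norm (L x (f x) - L0 f0) + S x * norm f0)"
  proof -
    have "\<forall>\<^sub>F x in F. S x < 1 / (2 * C)" using S C(1) by (intro order_tendstoD) auto
    then show ?thesis using lin(1)
    proof eventually_elim
      case (elim x)
      have S0: "S x \<ge> 0" by (simp add: S_def sum_nonneg)
      have "f x - f0 = R ((L x (f x) - L0 f0) - (L x (f x) - L0 (f x)))" by (simp add: R.diff RL)
      then have "norm (f x - f0) \<le> C * norm ((L x (f x) - L0 f0) - (L x (f x) - L0 (f x)))" using C(2) by metis
      also have "\<dots> \<le> C * (norm (L x (f x) - L0 f0) + S x * norm (f x))"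
        using C(1) norm_triangle_ineq4[of "L x (f x) - L0 f0" "L x (f x) - L0 (f x)"] est[OF elim(2), of "f x"]
        by (intro mult_left_mono) auto
      also have "\<dots> \<le> C * (norm (L x (f x) - L0 f0) + S x * (norm f0 + norm (f x - f0)))"
        using C(1) S0 norm_triangle_sub[of "f x" f0] by (intro mult_left_mono add_left_mono) auto
      also have "\<dots> = C * (norm (L x (f x) - L0 f0) + S x * norm f0) + C * S x * norm (f x - f0)"
        by (simp add: algebra_simps)
      also have "C * S x * norm (f x - f0) \<le> 1 / 2 * norm (f x - f0)"
        using elim(1) C(1) by (intro mult_right_mono) (auto simp: field_simps)
      finally show ?case by simp
    qed
  qed
  have "((\<lambda>x. 2 * C * (norm (L x (f x) - L0 f0) + S x * norm f0)) \<longlongrightarrow> 2 * C * (norm (L0 f0 - L0 f0) + 0 * norm f0)) F"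
    by (intro tendsto_intros f S)
  then have lim: "((\<lambda>x. 2 * C * (norm (L x (f x) - L0 f0) + S x * norm f0)) \<longlongrightarrow> 0) F" by simp
  have "((\<lambda>x. f x - f0) \<longlongrightarrow> 0) F"
    by (rule Lim_null_comparison[OF _ lim]) (use d in simp)
  then show ?thesis by (rule Lim_null[THEN iffD2])
qed

text \<open>The family is known to be differentiable only at each fixed vector; expansion in the
  basis reduces its evaluation at a moving vector to finitely many products.\<close>

lemma has_derivative_linear_family:
  fixes L :: "'a::real_normed_vector \<Rightarrow> 'b::euclidean_space \<Rightarrow> 'c::real_normed_vector"
  assumes S: "open S" "x \<in> S" and lin: "\<And>y. y \<in> S \<Longrightarrow> linear (L y)"
    and L: "\<And>v. ((\<lambda>x. L x v) has_derivative (\<lambda>w. K w v)) (at x)"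
    and f: "(f has_derivative f') (at x)"
  shows "((\<lambda>x. L x (f x)) has_derivative (\<lambda>w. K w (f x) + L x (f' w))) (at x)"
proof -
  note ex = linear_eq_sum_Basis
  have K: "K w v = (\<Sum>b\<in>Basis. (v \<bullet> b) *\<^sub>R K w b)" for w v
  proof -
    have "((\<lambda>x. \<Sum>b\<in>Basis. (v \<bullet> b) *\<^sub>R L x b) has_derivative (\<lambda>w. \<Sum>b\<in>Basis. (v \<bullet> b) *\<^sub>R K w b)) (at x)"
      by (intro has_derivative_sum has_derivative_scaleR_right L)
    then have "((\<lambda>x. L x v) has_derivative (\<lambda>w. \<Sum>b\<in>Basis. (v \<bullet> b) *\<^sub>R K w b)) (at x)"
      by (rule has_derivative_transform_within_open[OF _ S]) (rule ex[OF lin, symmetric])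
    then show ?thesis using has_derivative_unique[OF L[of v]] by metis
  qed
  have "((\<lambda>x. \<Sum>b\<in>Basis. (f x \<bullet> b) *\<^sub>R L x b) has_derivative
     (\<lambda>w. \<Sum>b\<in>Basis. (f x \<bullet> b) *\<^sub>R K w b + (f' w \<bullet> b) *\<^sub>R L x b)) (at x)"
    by (intro has_derivative_sum has_derivative_scaleR has_derivative_inner_left f L)
  then have "((\<lambda>x. \<Sum>b\<in>Basis. (f x \<bullet> b) *\<^sub>R L x b) has_derivative (\<lambda>w. K w (f x) + L x (f' w))) (at x)"
    unfolding sum.distrib K[symmetric] ex[OF lin[OF S(2)], symmetric] .
  then show ?thesis
    by (rule has_derivative_transform_within_open[OF _ S]) (rule ex[OF lin, symmetric])
qed

text \<open>By the mean value theorem, the mixed second difference is a value of either mixed derivative.\<close>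
lemma second_derivative_symmetric_real:
  fixes f :: "'a::euclidean_space \<Rightarrow> real"
  assumes S: "open S" "x \<in> S"
    and d1: "\<And>y. y \<in> S \<Longrightarrow> (f has_derivative f' y) (at y)"
    and d2: "\<And>y v. y \<in> S \<Longrightarrow> ((\<lambda>z. f' z v) has_derivative (\<lambda>w. f'' y w v)) (at y)"
    and c: "\<And>v w. isCont (\<lambda>y. f'' y w v) x"
  shows "f'' x w v = f'' x v w"
proof -
  obtain r where r: "r > 0" "cball x r \<subseteq> S" using S open_contains_cball by blast
  have mvt: "\<exists>p. dist x p \<le> s * (norm v + norm w) \<and>
      f (x + s *\<^sub>R v + s *\<^sub>R w) - f (x + s *\<^sub>R v) - f (x + s *\<^sub>R w) + f x = s * s * f'' p w v"
    if s: "s > 0" "s * (norm v + norm w) \<le> r" for s v w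
  proof -
    have inS: "x + a *\<^sub>R v + b *\<^sub>R w \<in> S \<and> dist x (x + a *\<^sub>R v + b *\<^sub>R w) \<le> s * (norm v + norm w)"
      if "0 \<le> a" "a \<le> s" "0 \<le> b" "b \<le> s" for a b
    proof -
      have "norm (a *\<^sub>R v + b *\<^sub>R w) \<le> a * norm v + b * norm w"
        using norm_triangle_ineq[of "a *\<^sub>R v" "b *\<^sub>R w"] that by simp
      also have "\<dots> \<le> s * (norm v + norm w)"
        using that by (simp add: distrib_left add_mono mult_right_mono)
      finally have "dist x (x + a *\<^sub>R v + b *\<^sub>R w) \<le> s * (norm v + norm w)"
        by (simp add: dist_norm norm_minus_commute add.assoc add.commute[of "b *\<^sub>R w"])
      then show ?thesis using s(2) r(2) by auto
    qed
    have g: "((\<lambda>a. f (x + a *\<^sub>R v + b *\<^sub>R w)) has_real_derivative f' (x + a *\<^sub>R v + b *\<^sub>R w) v) (at a)"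
      if "0 \<le> a" "a \<le> s" "0 \<le> b" "b \<le> s" for a b
    proof -
      have "((\<lambda>a. f (x + a *\<^sub>R v + b *\<^sub>R w)) has_derivative (\<lambda>h. f' (x + a *\<^sub>R v + b *\<^sub>R w) (h *\<^sub>R v))) (at a)"
        by (rule has_derivative_compose[OF _ d1]) (use inS[OF that] in \<open>auto intro!: derivative_eq_intros\<close>)
      then show ?thesis
        using linear_scale[OF has_derivative_linear[OF d1]] inS[OF that]
        by (simp add: has_field_derivative_def mult_commute_abs)
    qed
    have g2: "((\<lambda>b. f' (x + a *\<^sub>R v + b *\<^sub>R w) v) has_real_derivative f'' (x + a *\<^sub>R v + b *\<^sub>R w) w v) (at b)"
      if "0 \<le> a" "a \<le> s" "0 \<le> b" "b \<le> s" for a b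
    proof -
      have "((\<lambda>b. f' (x + a *\<^sub>R v + b *\<^sub>R w) v) has_derivative (\<lambda>h. f'' (x + a *\<^sub>R v + b *\<^sub>R w) (h *\<^sub>R w) v)) (at b)"
        by (rule has_derivative_compose[where g="\<lambda>z. f' z v", OF _ d2]) (use inS[OF that] in \<open>auto intro!: derivative_eq_intros\<close>)
      then show ?thesis
        using linear_scale[OF has_derivative_linear[OF d2]] inS[OF that]
        by (simp add: has_field_derivative_def mult_commute_abs)
    qed
    obtain a where a: "0 < a" "a < s" and ea: "(f (x + s *\<^sub>R v + s *\<^sub>R w) - f (x + s *\<^sub>R v + 0 *\<^sub>R w)) - (f (x + 0 *\<^sub>R v + s *\<^sub>R w) - f (x + 0 *\<^sub>R v + 0 *\<^sub>R w))
        = (s - 0) * (f' (x + a *\<^sub>R v + s *\<^sub>R w) v - f' (x + a *\<^sub>R v + 0 *\<^sub>R w) v)"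
      using MVT2[OF s(1), of "\<lambda>a. f (x + a *\<^sub>R v + s *\<^sub>R w) - f (x + a *\<^sub>R v + 0 *\<^sub>R w)"
          "\<lambda>a. f' (x + a *\<^sub>R v + s *\<^sub>R w) v - f' (x + a *\<^sub>R v + 0 *\<^sub>R w) v", OF DERIV_diff[OF g g]] s(1)
      by auto
    obtain b where b: "0 < b" "b < s" and eb: "f' (x + a *\<^sub>R v + s *\<^sub>R w) v - f' (x + a *\<^sub>R v + 0 *\<^sub>R w) v
        = (s - 0) * f'' (x + a *\<^sub>R v + b *\<^sub>R w) w v"
      using MVT2[OF s(1), of "\<lambda>b. f' (x + a *\<^sub>R v + b *\<^sub>R w) v" "\<lambda>b. f'' (x + a *\<^sub>R v + b *\<^sub>R w) w v", OF g2] a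
      by auto
    show ?thesis
      using inS[of a b] a b ea eb by (intro exI[of _ "x + a *\<^sub>R v + b *\<^sub>R w"]) simp
  qed
  show ?thesis
  proof (rule ccontr)
    assume ne: "f'' x w v \<noteq> f'' x v w"
    define e where "e = \<bar>f'' x w v - f'' x v w\<bar> / 2"
    have e: "e > 0" using ne by (simp add: e_def)
    obtain d1 where d1: "d1 > 0" "\<And>y. dist y x < d1 \<Longrightarrow> dist (f'' y w v) (f'' x w v) < e"
      using c[where v=v and w=w] e unfolding continuous_at_eps_delta by blast
    obtain d2 where d2: "d2 > 0" "\<And>y. dist y x < d2 \<Longrightarrow> dist (f'' y v w) (f'' x v w) < e"
      using c[where v=w and w=v] e unfolding continuous_at_eps_delta by blast
    \<comment> \<open>The mean value points for both orders of v and w then lie within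
      \<open>m\<close> of \<open>x\<close>, where each mixed derivative is within \<open>e\<close>
      of its value at \<open>x\<close>. As the second difference is symmetric, these values cannot
      be 2e apart.\<close>
    define m where "m = min r (min d1 d2)"
    define s where "s = m / (2 * (norm v + norm w + 1))"
    have m: "m > 0" "m \<le> r" "m \<le> d1" "m \<le> d2" using r d1 d2 by (auto simp: m_def)
    have pos: "norm v + norm w + 1 > 0" using norm_ge_zero[of v] norm_ge_zero[of w] by linarith
    have s: "s > 0" using m pos by (simp add: s_def)
    have "s * (norm v + norm w) \<le> s * (norm v + norm w + 1)" using s by simp
    also have "\<dots> = m / 2"
    proof -
      have "a / (2 * N) * N = a / 2" if "N > 0" for a N :: real using that by simp
      then show ?thesis using pos unfolding s_def by blast
    qed
    finally have sm: "s * (norm v + norm w) < m" using m by simp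
    obtain p where p: "dist x p \<le> s * (norm v + norm w)"
      "f (x + s *\<^sub>R v + s *\<^sub>R w) - f (x + s *\<^sub>R v) - f (x + s *\<^sub>R w) + f x = s * s * f'' p w v"
      using mvt[OF s, of v w] sm m by auto
    obtain q where q: "dist x q \<le> s * (norm w + norm v)"
      "f (x + s *\<^sub>R w + s *\<^sub>R v) - f (x + s *\<^sub>R w) - f (x + s *\<^sub>R v) + f x = s * s * f'' q v w"
      using mvt[OF s, of w v] sm m by (auto simp: add.commute)
    have "s * s * f'' p w v = s * s * f'' q v w"
    proof -
      have "x + s *\<^sub>R w + s *\<^sub>R v = x + s *\<^sub>R v + s *\<^sub>R w" by simp
      then show ?thesis using p(2) q(2) by (smt (verit))
    qed
    then have pq: "f'' p w v = f'' q v w" using s by simp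
    have "dist (f'' p w v) (f'' x w v) < e" using d1(2)[of p] p(1) sm m by (simp add: dist_commute)
    moreover have "dist (f'' q v w) (f'' x v w) < e" using d2(2)[of q] q(1) sm m by (simp add: dist_commute add.commute)
    ultimately show False unfolding pq e_def dist_real_def by (auto simp: abs_if split: if_splits)
  qed
qed

lemma second_derivative_symmetric:
  fixes f :: "'a::euclidean_space \<Rightarrow> 'b::euclidean_space"
  assumes S: "open S" "x \<in> S"
    and d1: "\<And>y. y \<in> S \<Longrightarrow> (f has_derivative f' y) (at y)"
    and d2: "\<And>y v. y \<in> S \<Longrightarrow> ((\<lambda>z. f' z v) has_derivative (\<lambda>w. f'' y w v)) (at y)"
    and c: "\<And>v w. isCont (\<lambda>y. f'' y w v) x"
  shows "f'' x w v = f'' x v w"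
proof (rule euclidean_eqI)
  fix b :: 'b
  show "f'' x w v \<bullet> b = f'' x v w \<bullet> b"
    by (rule second_derivative_symmetric_real[where f="\<lambda>y. f y \<bullet> b" and f'="\<lambda>y v. f' y v \<bullet> b"
        and f''="\<lambda>y w v. f'' y w v \<bullet> b", OF S])
      (use d1 d2 c in \<open>auto intro!: has_derivative_inner_left continuous_intros\<close>)
qed

section \<open>Level sets and their normals\<close>

text \<open>A substitute for a parametrization: for small t, \<phi> has opposite signs at x + t(v +
  c g) and x + t(v - c g), hence a zero in between. The size c = e/|g| makes the correction at most
  e t.\<close>

lemma level_set_tangent_direction:
  fixes \<phi> :: "'a::euclidean_space \<Rightarrow> real"
  assumes U: "open U" "x \<in> U" and x: "\<phi> x = 0" and cont: "continuous_on U \<phi>"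
    and der: "(\<phi> has_derivative (\<lambda>v. g \<bullet> v)) (at x)" and g: "g \<noteq> 0" "g \<bullet> v = 0"
    and e: "e > 0" and d: "d > 0"
  obtains t y where "0 < t" "t < d" "y \<in> U" "\<phi> y = 0" "norm (y - x - t *\<^sub>R v) \<le> e * t"
proof -
  define c where "c = e / norm g"
  have c: "c > 0" using e g by (simp add: c_def)
  obtain r where r: "r > 0" "ball x r \<subseteq> U" using U open_contains_ball by blast
  have line: "((\<lambda>s. \<phi> (x + s *\<^sub>R w)) has_real_derivative g \<bullet> w) (at 0)" for w
  proof -
    have "(\<phi> has_derivative (\<lambda>v. g \<bullet> v)) (at (x + 0 *\<^sub>R w))" using der by simp
    then have "((\<lambda>s. \<phi> (x + s *\<^sub>R w)) has_derivative (\<lambda>h. g \<bullet> (h *\<^sub>R w))) (at 0)"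
      by (rule has_derivative_compose[rotated]) (auto intro!: derivative_eq_intros)
    then show ?thesis by (simp add: has_field_derivative_def mult_commute_abs)
  qed
  have gg: "g \<bullet> g > 0" using g by simp
  obtain d1 where d1: "d1 > 0" "\<And>h. 0 < h \<Longrightarrow> h < d1 \<Longrightarrow> \<phi> (x + h *\<^sub>R (v + c *\<^sub>R g)) > 0"
    using DERIV_pos_inc_right[OF line[of "v + c *\<^sub>R g"]] g gg c x by (auto simp: inner_add_right)
  obtain d2 where d2: "d2 > 0" "\<And>h. 0 < h \<Longrightarrow> h < d2 \<Longrightarrow> \<phi> (x + h *\<^sub>R (v + (- c) *\<^sub>R g)) < 0"
    using DERIV_neg_dec_right[OF line[of "v + (- c) *\<^sub>R g"]] g gg c x by (auto simp: inner_diff_right)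
  define m where "m = min (min d d1) (min d2 (r / (norm v + e + 1)))"
  define t where "t = m / 2"
  have pos: "norm v + e + 1 > 0" using e norm_ge_zero[of v] by linarith
  have t: "0 < t" "t < d" "t < d1" "t < d2" "t < r / (norm v + e + 1)"
  proof -
    have "m > 0" "m \<le> d" "m \<le> d1" "m \<le> d2" "m \<le> r / (norm v + e + 1)"
      unfolding m_def using d d1(1) d2(1) r(1) pos by simp_all
    then show "0 < t" "t < d" "t < d1" "t < d2" "t < r / (norm v + e + 1)"
      unfolding t_def by linarith+
  qed
  have tr: "t * (norm v + e) < r"
  proof -
    have "t * (norm v + e + 1) < r" using t(5) pos by (simp add: pos_less_divide_eq)
    then show ?thesis using t(1) by (simp add: distrib_left)
  qed
  have inU: "x + t *\<^sub>R (v + s *\<^sub>R g) \<in> U" if "\<bar>s\<bar> \<le> c" for s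
  proof -
    have "norm (s *\<^sub>R g) \<le> c * norm g" using that by (simp add: mult_right_mono)
    also have "\<dots> = e" using g by (simp add: c_def)
    finally have "norm (v + s *\<^sub>R g) \<le> norm v + e" using norm_triangle_ineq[of v "s *\<^sub>R g"] by linarith
    then have "norm (t *\<^sub>R (v + s *\<^sub>R g)) \<le> t * (norm v + e)" using t(1) by simp
    then have "dist x (x + t *\<^sub>R (v + s *\<^sub>R g)) < r" using tr by (simp add: dist_norm)
    then show ?thesis using r by auto
  qed
  have "continuous_on {-c..c} (\<lambda>s. \<phi> (x + t *\<^sub>R (v + s *\<^sub>R g)))"
    by (rule continuous_on_compose2[OF cont]) (use inU in \<open>auto intro!: continuous_intros\<close>)
  moreover have "\<phi> (x + t *\<^sub>R (v + (- c) *\<^sub>R g)) \<le> 0" "0 \<le> \<phi> (x + t *\<^sub>R (v + c *\<^sub>R g))"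
    using d1(2)[OF t(1,3)] d2(2)[OF t(1,4)] by linarith+
  ultimately obtain s where s: "- c \<le> s" "s \<le> c" "\<phi> (x + t *\<^sub>R (v + s *\<^sub>R g)) = 0"
    using IVT'[of "\<lambda>s. \<phi> (x + t *\<^sub>R (v + s *\<^sub>R g))" "- c" 0 c] c by auto
  let ?y = "x + t *\<^sub>R (v + s *\<^sub>R g)"
  have "?y - x - t *\<^sub>R v = (t * s) *\<^sub>R g" by (simp add: algebra_simps)
  then have "norm (?y - x - t *\<^sub>R v) = t * (\<bar>s\<bar> * norm g)" using t(1) by (simp add: abs_mult)
  also have "\<dots> \<le> t * (c * norm g)" using s t(1) by (intro mult_left_mono mult_right_mono) auto
  also have "\<dots> = e * t" using g by (simp add: c_def)
  finally show thesis using that[of t ?y] t inU[of s] s by auto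
qed

text \<open>Meant for the difference of two derivatives of one map within \<open>M\<close>. Points
  of \<open>M\<close> close to x + t v show that a linear map of size o(|y - x|) on \<open>M\<close>
  annihilates tangent vectors.\<close>

lemma linear_map_zero_on_tangent:
  fixes \<phi> :: "'a::euclidean_space \<Rightarrow> real" and E :: "'a \<Rightarrow> 'b::euclidean_space"
  assumes U: "open U" "x \<in> U" and M: "M \<inter> U = {y \<in> U. \<phi> y = 0}" "x \<in> M" and cont: "continuous_on U \<phi>"
    and der: "(\<phi> has_derivative (\<lambda>v. g \<bullet> v)) (at x)" and g: "g \<noteq> 0" "g \<bullet> v = 0"
    and E: "linear E" and small: "\<And>e. e > 0 \<Longrightarrow> \<exists>d>0. \<forall>y\<in>M. norm (y - x) < d \<longrightarrow> norm (E (y - x)) \<le> e * norm (y - x)"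
  shows "E v = 0"
proof -
  interpret linear E by fact
  obtain C where C: "C > 0" "\<And>x. norm (E x) \<le> C * norm x"
    using linear_bounded_pos[OF E] by blast
  have le: "norm (E v) \<le> e * (norm v + 1 + C)" if e: "0 < e" "e \<le> 1" for e
  proof -
    obtain d where d: "d > 0" "\<And>y. y \<in> M \<Longrightarrow> norm (y - x) < d \<Longrightarrow> norm (E (y - x)) \<le> e * norm (y - x)"
      using small[OF e(1)] by blast
    have dd: "d / (norm v + 1) > 0" using d by (simp add: add_nonneg_pos)
    have "\<phi> x = 0" using M U by blast
    then obtain t y where t: "0 < t" "t < d / (norm v + 1)" "y \<in> U" "\<phi> y = 0" "norm (y - x - t *\<^sub>R v) \<le> e * t"
      using level_set_tangent_direction[OF U _ cont der g e(1) dd] by blast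
    have yM: "y \<in> M" using t M by blast
    have nv: "norm v + 1 > 0" by (simp add: add_nonneg_pos)
    have "norm (y - x) \<le> norm (t *\<^sub>R v) + norm (y - x - t *\<^sub>R v)" using norm_triangle_sub by blast
    also have "\<dots> \<le> t * norm v + 1 * t" using order_trans[OF t(5) mult_right_mono[OF e(2) less_imp_le[OF t(1)]]] t(1) by simp
    finally have n: "norm (y - x) \<le> t * (norm v + 1)" by (simp add: algebra_simps)
    also have "\<dots> < d" using t(2) nv by (simp add: pos_less_divide_eq)
    finally have "norm (E (y - x)) \<le> e * norm (y - x)" using d yM by blast
    also have "\<dots> \<le> e * (t * (norm v + 1))" using n e by simp
    finally have 1: "norm (E (y - x)) \<le> e * (t * (norm v + 1))" .
    have "E (t *\<^sub>R v) = E (y - x) - E (y - x - t *\<^sub>R v)" by (simp add: diff)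
    then have "norm (E (t *\<^sub>R v)) \<le> norm (E (y - x)) + norm (E (y - x - t *\<^sub>R v))"
      using norm_triangle_ineq4 by metis
    also have "\<dots> \<le> e * (t * (norm v + 1)) + C * (e * t)"
      using 1 C(2)[of "y - x - t *\<^sub>R v"] t(5) C(1) by (intro add_mono) (auto intro: order_trans mult_left_mono)
    finally have "t * norm (E v) \<le> t * (e * (norm v + 1 + C))"
      using t(1) by (simp add: scale algebra_simps)
    then show ?thesis using t(1) by simp
  qed
  have "norm (E v) \<le> 0"
  proof (rule field_le_epsilon)
    fix \<epsilon> :: real assume \<epsilon>: "\<epsilon> > 0"
    have P: "norm v + 1 + C > 0" using C norm_ge_zero[of v] by linarith
    define e where "e = min 1 (\<epsilon> / (norm v + 1 + C))"
    have "norm (E v) \<le> e * (norm v + 1 + C)" using le[of e] P \<epsilon> by (auto simp: e_def)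
    also have "\<dots> \<le> \<epsilon> / (norm v + 1 + C) * (norm v + 1 + C)" using P by (intro mult_right_mono) (auto simp: e_def)
    finally show "norm (E v) \<le> 0 + \<epsilon>" using P by simp
  qed
  then show ?thesis by simp
qed

text \<open>\<open>differential\<close> is an arbitrarily chosen derivative within \<open>M\<close>;
  on tangent vectors this allows any known one to be used instead.\<close>

lemma differential_eq_on_tangent:
  fixes \<phi> :: "'a::euclidean_space \<Rightarrow> real" and f :: "'a \<Rightarrow> 'b::euclidean_space"
  assumes U: "open U" "x \<in> U" and M: "M \<inter> U = {y \<in> U. \<phi> y = 0}" "x \<in> M" and cont: "continuous_on U \<phi>"
    and der: "(\<phi> has_derivative (\<lambda>v. g \<bullet> v)) (at x)" and g: "g \<noteq> 0" "g \<bullet> v = 0"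
    and f: "(f has_derivative D) (at x within M)"
  shows "differential M f x v = D v"
proof -
  let ?D = "differential M f x"
  have D': "(f has_derivative ?D) (at x within M)"
    using f frechet_derivative_works differentiable_def unfolding differential_def by blast
  have lin: "linear (\<lambda>v. ?D v - D v)"
    using has_derivative_linear[OF D'] has_derivative_linear[OF f] by (intro linear_compose_sub)
  have "(\<lambda>v. ?D v - D v) v = 0"
  proof (rule linear_map_zero_on_tangent[OF U M cont der g lin])
    fix e :: real assume e: "e > 0"
    obtain d1 where d1: "d1 > 0" "\<And>y. y \<in> M \<Longrightarrow> norm (y - x) < d1 \<Longrightarrow> norm (f y - f x - ?D (y - x)) \<le> e / 2 * norm (y - x)"
      using D' e unfolding has_derivative_within_alt by (meson half_gt_zero)
    obtain d2 where d2: "d2 > 0" "\<And>y. y \<in> M \<Longrightarrow> norm (y - x) < d2 \<Longrightarrow> norm (f y - f x - D (y - x)) \<le> e / 2 * norm (y - x)"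
      using f e unfolding has_derivative_within_alt by (meson half_gt_zero)
    have "norm (?D (y - x) - D (y - x)) \<le> e * norm (y - x)" if "y \<in> M" "norm (y - x) < min d1 d2" for y
    proof -
      have "?D (y - x) - D (y - x) = (f y - f x - D (y - x)) - (f y - f x - ?D (y - x))" by simp
      then have "norm (?D (y - x) - D (y - x)) \<le> norm (f y - f x - D (y - x)) + norm (f y - f x - ?D (y - x))"
        using norm_triangle_ineq4 by metis
      then show ?thesis using d1(2)[of y] d2(2)[of y] that by simp
    qed
    then show "\<exists>d>0. \<forall>y\<in>M. norm (y - x) < d \<longrightarrow> norm (?D (y - x) - D (y - x)) \<le> e * norm (y - x)"
      using d1(1) d2(1) by (intro exI[of _ "min d1 d2"]) auto
  qed
  then show ?thesis by simp
qed

text \<open>A functional that is maximal over \<open>M\<close> at \<open>x\<close> is nonpositive on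
  tangent vectors. Tested on the tangential part of \<open>z\<close> itself, this forces that part
  to vanish.\<close>

lemma normal_parallel_gradient:
  fixes \<phi> :: "'a::euclidean_space \<Rightarrow> real"
  assumes U: "open U" "x \<in> U" and M: "M \<inter> U = {y \<in> U. \<phi> y = 0}" "x \<in> M" and cont: "continuous_on U \<phi>"
    and der: "(\<phi> has_derivative (\<lambda>v. g \<bullet> v)) (at x)" and g: "g \<noteq> 0"
    and z: "\<And>y. y \<in> M \<Longrightarrow> z \<bullet> y \<le> z \<bullet> x"
  obtains c where "z = c *\<^sub>R g"
proof -
  have le: "z \<bullet> v \<le> 0" if v: "g \<bullet> v = 0" for v
  proof (rule field_le_epsilon)
    fix e :: real assume e: "e > 0"
    define e' where "e' = e / (norm z + 1)"
    have n: "norm z + 1 > 0" by (simp add: add_nonneg_pos)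
    have e': "e' > 0" using e n by (simp add: e'_def)
    have "\<phi> x = 0" using M U by blast
    then obtain t y where t: "0 < t" "y \<in> U" "\<phi> y = 0" "norm (y - x - t *\<^sub>R v) \<le> e' * t"
      using level_set_tangent_direction[OF U _ cont der g v e' zero_less_one] by blast
    have "z \<bullet> (y - x) \<le> 0" using z[of y] t M by (auto simp: inner_diff_right)
    then have "t * (z \<bullet> v) \<le> z \<bullet> (t *\<^sub>R v - (y - x))" by (simp add: inner_diff_right)
    also have "\<dots> \<le> norm z * norm (t *\<^sub>R v - (y - x))" by (rule norm_cauchy_schwarz)
    also have "\<dots> \<le> norm z * (e' * t)" using t(4) by (intro mult_left_mono) (auto simp: norm_minus_commute)
    also have "\<dots> = t * (e' * norm z)" by simp
    finally have "z \<bullet> v \<le> e' * norm z" using t(1) by simp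
    also have "\<dots> \<le> e' * (norm z + 1)" using e' by simp
    also have "\<dots> = e" using n by (simp add: e'_def)
    finally show "z \<bullet> v \<le> 0 + e" by simp
  qed
  define v where "v = z - ((z \<bullet> g) / (g \<bullet> g)) *\<^sub>R g"
  have v: "g \<bullet> v = 0" using g by (simp add: v_def inner_diff_right inner_commute)
  have "z \<bullet> v \<le> 0" by (rule le[OF v])
  moreover have "v \<bullet> v = z \<bullet> v" using v by (simp add: v_def inner_diff_left)
  ultimately have "v = 0" using inner_ge_zero[of v] inner_eq_zero_iff[of v] by linarith
  then show thesis using that[of "(z \<bullet> g) / (g \<bullet> g)"] by (simp add: v_def)
qed

text \<open>Three derivatives are extracted because the inverse Gauss map is determined by the
  gradient and has to be differentiated twice.\<close>

lemma smooth_on_gradient: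
  fixes \<phi> :: "'a::euclidean_space \<Rightarrow> real"
  assumes "smooth_on \<phi> U" "open U"
  obtains g H T where
    "\<And>x. x \<in> U \<Longrightarrow> (\<phi> has_derivative (\<lambda>v. g x \<bullet> v)) (at x)"
    "\<And>x. x \<in> U \<Longrightarrow> (g has_derivative H x) (at x)"
    "\<And>x v. x \<in> U \<Longrightarrow> ((\<lambda>y. H y v) has_derivative (\<lambda>w. T x w v)) (at x)"
    "\<And>v w. continuous_on U (\<lambda>x. T x w v)"
    "\<And>x v w. x \<in> U \<Longrightarrow> H x v \<bullet> w = v \<bullet> H x w"
proof -
  define D1 where "D1 b x = frechet_derivative \<phi> (at x) b" for b x
  define D2 where "D2 b v x = frechet_derivative (D1 b) (at x) v" for b v x
  define D3 where "D3 b v w x = frechet_derivative (D2 b v) (at x) w" for b v w x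
  have "Ck_on (Suc (Suc (Suc 0))) \<phi> U" using assms(1) unfolding smooth_on_def by blast
  then have diff: "\<phi> differentiable_on U" "D1 b differentiable_on U" "D2 b v differentiable_on U"
    and contD3: "continuous_on U (D3 b v w)" for b v w
    unfolding D3_def D2_def D1_def by auto
  have d1: "(\<phi> has_derivative (\<lambda>b. D1 b x)) (at x)" if "x \<in> U" for x
    using diff(1) that assms(2) unfolding D1_def
    by (simp add: differentiable_on_eq_differentiable_at frechet_derivative_works[symmetric])
  have d2: "(D1 b has_derivative (\<lambda>v. D2 b v x)) (at x)" if "x \<in> U" for x b
    using diff(2)[of b] that assms(2) unfolding D2_def
    by (simp add: differentiable_on_eq_differentiable_at frechet_derivative_works[symmetric])
  have d3: "(D2 b v has_derivative (\<lambda>w. D3 b v w x)) (at x)" if "x \<in> U" for x b v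
    using diff(3)[of b v] that assms(2) unfolding D3_def
    by (simp add: differentiable_on_eq_differentiable_at frechet_derivative_works[symmetric])
  define g where "g x = (\<Sum>b\<in>Basis. D1 b x *\<^sub>R b)" for x
  define H where "H x v = (\<Sum>b\<in>Basis. D2 b v x *\<^sub>R b)" for x v
  define T where "T x w v = (\<Sum>b\<in>Basis. D3 b v w x *\<^sub>R b)" for x v w
  have 1: "(\<phi> has_derivative (\<lambda>v. g x \<bullet> v)) (at x)" if "x \<in> U" for x
  proof -
    interpret linear "\<lambda>b. D1 b x" using d1[OF that] has_derivative_linear by blast
    have "D1 v x = g x \<bullet> v" for v
    proof -
      have "D1 v x = D1 (\<Sum>b\<in>Basis. (v \<bullet> b) *\<^sub>R b) x" by (simp add: euclidean_representation)
      also have "\<dots> = (\<Sum>b\<in>Basis. (v \<bullet> b) * D1 b x)" by (simp only: sum scale real_scaleR_def)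
      also have "\<dots> = g x \<bullet> v" by (simp add: g_def inner_sum_left mult.commute inner_commute[of v])
      finally show ?thesis .
    qed
    then show ?thesis using d1[OF that] by simp
  qed
  have 2: "(g has_derivative H x) (at x)" if "x \<in> U" for x
    unfolding g_def[abs_def] H_def[abs_def]
    by (intro has_derivative_sum has_derivative_scaleR_left d2 that)
  have 3: "((\<lambda>y. H y v) has_derivative (\<lambda>w. T x w v)) (at x)" if "x \<in> U" for x v
    unfolding H_def[abs_def] T_def[abs_def]
    by (intro has_derivative_sum has_derivative_scaleR_left d3 that)
  have 4: "continuous_on U (\<lambda>x. T x w v)" for v w
    unfolding T_def using contD3 by (intro continuous_intros) auto
  have 5: "H x v \<bullet> w = v \<bullet> H x w" if "x \<in> U" for x v w
  proof -
    have "H x v \<bullet> w = H x w \<bullet> v"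
    proof (rule second_derivative_symmetric_real[where f=\<phi> and f'="\<lambda>x v. g x \<bullet> v" and f''="\<lambda>x w v. H x w \<bullet> v", OF assms(2) that 1])
      show "((\<lambda>z. g z \<bullet> v) has_derivative (\<lambda>w. H y w \<bullet> v)) (at y)" if "y \<in> U" for y v
        using 2[OF that] by (rule has_derivative_inner_left)
      show "isCont (\<lambda>y. H y w \<bullet> v) x" for v w
        using has_derivative_continuous[OF 3[OF that]] by (intro continuous_intros)
    qed
    then show ?thesis by (simp add: inner_commute)
  qed
  show thesis by (rule that[OF 1 2 3 4 5])
qed

lemma has_derivative_normalize:
  fixes g :: "'a::euclidean_space \<Rightarrow> 'b::euclidean_space"
  assumes g: "(g has_derivative H) (at x within S)" and nz: "g x \<noteq> 0"
  shows "((\<lambda>y. g y /\<^sub>R norm (g y)) has_derivative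
    (\<lambda>v. (1 / norm (g x)) *\<^sub>R H v - ((g x \<bullet> H v) / norm (g x) ^ 3) *\<^sub>R g x)) (at x within S)"
proof -
  have n: "((\<lambda>y. sqrt (g y \<bullet> g y)) has_derivative (\<lambda>v. (g x \<bullet> H v) / norm (g x))) (at x within S)"
    using nz
    by (auto intro!: derivative_eq_intros g simp: norm_eq_sqrt_inner inner_commute field_simps)
  then have n: "((\<lambda>y. norm (g y)) has_derivative (\<lambda>v. (g x \<bullet> H v) / norm (g x))) (at x within S)"
    by (simp add: norm_eq_sqrt_inner)
  have "((\<lambda>y. inverse (norm (g y)) *\<^sub>R g y) has_derivative
    (\<lambda>v. inverse (norm (g x)) *\<^sub>R H v +
        (- (inverse (norm (g x)) * ((g x \<bullet> H v) / norm (g x)) * inverse (norm (g x)))) *\<^sub>R g x)) (at x within S)"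
    by (rule has_derivative_scaleR[OF Deriv.has_derivative_inverse[OF _ n] g]) (use nz in auto)
  moreover have "inverse (norm (g x)) * ((g x \<bullet> H v) / norm (g x)) * inverse (norm (g x)) = (g x \<bullet> H v) / norm (g x) ^ 3" for v
    using nz by (simp add: field_simps power3_eq_cube)
  ultimately show ?thesis by (simp add: inverse_eq_divide power3_eq_cube)
qed

section \<open>Smooth strictly convex bodies\<close>

locale smooth_convex_body =
  fixes M K :: "'a::euclidean_space set"
  assumes smooth_strictly_convex: "smooth_strictly_convex M K"
begin

lemma K: "compact K" "convex K" "0 \<in> interior K" and M_eq: "M = frontier K"
  and gauss: "x \<in> M \<Longrightarrow> gauss_curvature K x > 0"
  using smooth_strictly_convex by (auto simp: smooth_strictly_convex_def)

lemma M_subset: "M \<subseteq> K"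
  using K(1) M_eq by (simp add: compact_imp_closed frontier_subset_closed)

definition is_chart where
  "is_chart U \<phi> g H T \<longleftrightarrow> open U \<and> M \<inter> U = {y \<in> U. \<phi> y = 0} \<and> continuous_on U \<phi> \<and>
    (\<forall>y\<in>U. (\<phi> has_derivative (\<lambda>v. g y \<bullet> v)) (at y) \<and> g y \<noteq> 0 \<and> (g has_derivative H y) (at y) \<and>
      (\<forall>v. ((\<lambda>z. H z v) has_derivative (\<lambda>w. T y w v)) (at y)) \<and> (\<forall>v w. H y v \<bullet> w = v \<bullet> H y w)) \<and>
    (\<forall>v w. continuous_on U (\<lambda>y. T y w v))"

lemma is_chartD:
  assumes "is_chart U \<phi> g H T"
  shows "open U" "M \<inter> U = {y \<in> U. \<phi> y = 0}" "continuous_on U \<phi>"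
    "y \<in> U \<Longrightarrow> (\<phi> has_derivative (\<lambda>v. g y \<bullet> v)) (at y)" "y \<in> U \<Longrightarrow> g y \<noteq> 0"
    "y \<in> U \<Longrightarrow> (g has_derivative H y) (at y)"
    "y \<in> U \<Longrightarrow> ((\<lambda>z. H z v) has_derivative (\<lambda>w. T y w v)) (at y)"
    "continuous_on U (\<lambda>y. T y w v)"
    "y \<in> U \<Longrightarrow> H y v \<bullet> w = v \<bullet> H y w"
  using assms unfolding is_chart_def by auto

lemma exists_chart:
  assumes "x \<in> M"
  obtains U \<phi> g H T where "is_chart U \<phi> g H T" "x \<in> U"
proof -
  have "smooth_hypersurface M" using smooth_strictly_convex unfolding smooth_strictly_convex_def by blast
  then obtain U and \<phi> :: "'a \<Rightarrow> real" where U: "open U" "x \<in> U" "smooth_on \<phi> U"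
    and nz: "\<And>y. y \<in> U \<Longrightarrow> frechet_derivative \<phi> (at y) \<noteq> (\<lambda>v. 0)" and M: "M \<inter> U = {y \<in> U. \<phi> y = 0}"
    using assms unfolding smooth_hypersurface_def by meson
  obtain g H T where 1: "\<And>x. x \<in> U \<Longrightarrow> (\<phi> has_derivative (\<lambda>v. g x \<bullet> v)) (at x)"
    and *: "\<And>x. x \<in> U \<Longrightarrow> (g has_derivative H x) (at x)"
    "\<And>x v. x \<in> U \<Longrightarrow> ((\<lambda>y. H y v) has_derivative (\<lambda>w. T x w v)) (at x)"
    "\<And>v w. continuous_on U (\<lambda>x. T x w v)"
    "\<And>x v w. x \<in> U \<Longrightarrow> H x v \<bullet> w = v \<bullet> H x w"
    using smooth_on_gradient[OF U(3,1)] by metis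
  have c: "continuous_on U \<phi>"
    using 1 has_derivative_continuous by (metis continuous_at_imp_continuous_on)
  have g: "g y \<noteq> 0" if "y \<in> U" for y
  proof
    assume "g y = 0"
    then have "frechet_derivative \<phi> (at y) = (\<lambda>v. 0)"
      using frechet_derivative_at[OF 1[OF that]] by simp
    then show False using nz[OF that] by simp
  qed
  show thesis by (rule that[OF _ U(2), of \<phi> g H T]) (use U(1) M c 1 g * in \<open>simp add: is_chart_def\<close>)
qed

section \<open>Outer normals and the Gauss map\<close>

definition normal_at :: "'a \<Rightarrow> 'a \<Rightarrow> bool" where
  "normal_at z x \<longleftrightarrow> (\<forall>y\<in>K. z \<bullet> y \<le> z \<bullet> x)"

text \<open>A small multiple of \<open>z\<close> lies in \<open>K\<close> because the origin is
  interior. This positivity fixes the sign of normals otherwise known only up to a factor.\<close>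

lemma normal_at_inner_pos:
  assumes "z \<noteq> 0" "normal_at z x"
  shows "z \<bullet> x > 0"
proof -
  obtain e where e: "e > 0" "cball 0 e \<subseteq> K" using K(3) mem_interior_cball by blast
  have "(e / norm z) *\<^sub>R z \<in> K" using e assms(1) by (auto simp: subset_iff)
  then have "z \<bullet> ((e / norm z) *\<^sub>R z) \<le> z \<bullet> x" using assms(2) unfolding normal_at_def by blast
  moreover have "z \<bullet> ((e / norm z) *\<^sub>R z) > 0" using e(1) assms(1) by simp
  ultimately show ?thesis by linarith
qed

lemma normal_at_imp_frontier:
  assumes "z \<noteq> 0" "x \<in> K" "normal_at z x"
  shows "x \<in> M"
proof (rule ccontr)
  assume "x \<notin> M"
  then have "x \<in> interior K"
    using assms(2) M_eq K(1) by (simp add: frontier_def compact_imp_closed)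
  then obtain e where e: "e > 0" "cball x e \<subseteq> K" using mem_interior_cball by blast
  have "x + (e / norm z) *\<^sub>R z \<in> K" using e assms(1) by (auto simp: subset_iff dist_norm)
  then have "z \<bullet> (x + (e / norm z) *\<^sub>R z) \<le> z \<bullet> x" using assms(3) by (simp add: normal_at_def)
  moreover have "z \<bullet> ((e / norm z) *\<^sub>R z) > 0" using e(1) assms(1) by simp
  ultimately show False by (simp add: inner_add_right)
qed

lemma exists_normal_at:
  assumes "x \<in> M"
  obtains z where "norm z = 1" "normal_at z x"
proof -
  have "x \<notin> rel_interior K"
    using assms M_eq K(3) rel_interior_nonempty_interior[of K] by (auto simp: frontier_def)
  then obtain a where a: "a \<noteq> 0" "\<And>y. y \<in> K \<Longrightarrow> a \<bullet> x \<le> a \<bullet> y"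
      and "\<And>y. y \<in> rel_interior K \<Longrightarrow> a \<bullet> x < a \<bullet> y"
    using assms M_subset by (elim supporting_hyperplane_rel_boundary[OF K(2), rotated]) auto
  have "normal_at (- a /\<^sub>R norm a) x"
    unfolding normal_at_def
  proof
    fix y assume "y \<in> K"
    then have "a \<bullet> x / norm a \<le> a \<bullet> y / norm a" using a(2) by (intro divide_right_mono) auto
    then show "(- a /\<^sub>R norm a) \<bullet> y \<le> (- a /\<^sub>R norm a) \<bullet> x" by (simp add: divide_inverse mult.commute)
  qed
  then show thesis using that[of "- a /\<^sub>R norm a"] a(1) by simp
qed

text \<open>Both normals are multiples of the gradient of a defining function; unit length leaves a
  sign, and the positivity of z . x decides it. This justifies the definite description in
  \<open>outer_normal\<close>.\<close>

lemma normal_at_unique: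
  assumes x: "x \<in> M" and z: "norm z = 1" "normal_at z x" and z': "norm z' = 1" "normal_at z' x"
  shows "z = z'"
proof -
  obtain U \<phi> g H T where C: "is_chart U \<phi> g H T" and xU: "x \<in> U" by (rule exists_chart[OF x])
  note g = is_chartD(5)[OF C]
  note par = normal_parallel_gradient[OF is_chartD(1)[OF C] xU is_chartD(2)[OF C] x is_chartD(3)[OF C] is_chartD(4)[OF C xU] g[OF xU]]
  obtain c where c: "z = c *\<^sub>R g x" using par[of z] z(2) M_subset by (auto simp: normal_at_def)
  obtain c' where c': "z' = c' *\<^sub>R g x" using par[of z'] z'(2) M_subset by (auto simp: normal_at_def)
  have "z \<bullet> x > 0" "z' \<bullet> x > 0" using z z' by (auto intro!: normal_at_inner_pos)
  then have "c * (g x \<bullet> x) > 0" "c' * (g x \<bullet> x) > 0" using c c' by auto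
  then have s: "sgn c = sgn c'" by (auto simp: zero_less_mult_iff sgn_if)
  have "\<bar>c\<bar> * norm (g x) = \<bar>c'\<bar> * norm (g x)" using z(1) z'(1) c c' by simp
  then have "\<bar>c\<bar> = \<bar>c'\<bar>" using g[OF xU] by simp
  then have "c = c'" using s by (metis sgn_mult_abs)
  then show ?thesis using c c' by simp
qed

lemma outer_normal:
  assumes x: "x \<in> M"
  shows "norm (outer_normal K x) = 1" "normal_at (outer_normal K x) x"
proof -
  have "\<exists>!z. norm z = 1 \<and> (\<forall>y\<in>K. z \<bullet> y \<le> z \<bullet> x)"
    using exists_normal_at[OF x] normal_at_unique[OF x] unfolding normal_at_def by metis
  from theI'[OF this] show "norm (outer_normal K x) = 1" "normal_at (outer_normal K x) x"
    by (auto simp: outer_normal_def normal_at_def)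
qed

lemma outer_normal_eq:
  assumes "x \<in> M" "norm z = 1" "normal_at z x"
  shows "outer_normal K x = z"
  using normal_at_unique[OF assms(1)] outer_normal[OF assms(1)] assms by blast

text \<open>The normal is the normalized gradient times the sign of g y . y, and by continuity this
  sign is constant near \<open>x\<close>.\<close>

lemma outer_normal_has_derivative:
  assumes C: "is_chart U \<phi> g H T" and x: "x \<in> M" "x \<in> U"
  obtains c where "c \<noteq> 0" "outer_normal K x = (c / norm (g x)) *\<^sub>R g x"
    "(outer_normal K has_derivative
      (\<lambda>v. c *\<^sub>R ((1 / norm (g x)) *\<^sub>R H x v - ((g x \<bullet> H x v) / norm (g x) ^ 3) *\<^sub>R g x))) (at x within M)"
proof -
  note U = is_chartD(1,2,3)[OF C] and d = is_chartD(4)[OF C] and g = is_chartD(5)[OF C] and H = is_chartD(6)[OF C x(2)]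
  have nu: "outer_normal K y = (sgn (g y \<bullet> y) / norm (g y)) *\<^sub>R g y \<and> g y \<bullet> y \<noteq> 0" if y: "y \<in> M" "y \<in> U" for y
  proof -
    obtain c where c: "outer_normal K y = c *\<^sub>R g y"
      using normal_parallel_gradient[OF U(1) y(2) U(2) y(1) U(3) d[OF y(2)] g[OF y(2)], of "outer_normal K y"]
        outer_normal(2)[OF y(1)] M_subset by (auto simp: normal_at_def)
    have n: "\<bar>c\<bar> * norm (g y) = 1" using outer_normal(1)[OF y(1)] c by simp
    then have ab: "\<bar>c\<bar> = 1 / norm (g y)" using g[OF y(2)] by (simp add: field_simps)
    have "outer_normal K y \<noteq> 0" using outer_normal(1)[OF y(1)] by auto
    then have "outer_normal K y \<bullet> y > 0" using outer_normal(2)[OF y(1)] normal_at_inner_pos by blast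
    then have p: "c * (g y \<bullet> y) > 0" using c by simp
    then have "sgn c = sgn (g y \<bullet> y)" by (auto simp: zero_less_mult_iff sgn_if)
    then have "c = sgn (g y \<bullet> y) / norm (g y)" using ab by (metis sgn_mult_abs times_divide_eq_right mult_1_right)
    then show ?thesis using c p by auto
  qed
  define c where "c = sgn (g x \<bullet> x)"
  have c: "c \<noteq> 0" using nu[OF x] by (simp add: c_def sgn_if)
  have isc: "isCont (\<lambda>y. c * (g y \<bullet> y)) x"
    using has_derivative_continuous[OF H] by (intro continuous_intros)
  have "c * (g x \<bullet> x) > 0" using nu[OF x] by (auto simp: c_def sgn_if)
  then have "\<forall>\<^sub>F y in at x. c * (g y \<bullet> y) > 0"
    using isc by (intro order_tendstoD(1)) (auto simp: isCont_def)
  then have "\<forall>\<^sub>F y in nhds x. c * (g y \<bullet> y) > 0" using \<open>c * (g x \<bullet> x) > 0\<close>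
    by (simp add: eventually_nhds_conv_at)
  moreover have "\<forall>\<^sub>F y in nhds x. y \<in> U" using U(1) x(2) by (rule eventually_nhds_in_open)
  ultimately have "\<forall>\<^sub>F y in nhds x. c * (g y \<bullet> y) > 0 \<and> y \<in> U" by (rule eventually_conj)
  then obtain e where e: "e > 0" "\<And>y. dist y x < e \<Longrightarrow> c * (g y \<bullet> y) > 0 \<and> y \<in> U"
    unfolding eventually_nhds_metric by blast
  have "((\<lambda>y. c *\<^sub>R (g y /\<^sub>R norm (g y))) has_derivative
      (\<lambda>v. c *\<^sub>R ((1 / norm (g x)) *\<^sub>R H x v - ((g x \<bullet> H x v) / norm (g x) ^ 3) *\<^sub>R g x))) (at x within M)"
    using has_derivative_at_withinI[OF H] g[OF x(2)]
    by (intro has_derivative_scaleR_right has_derivative_normalize)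
  then have "(outer_normal K has_derivative
      (\<lambda>v. c *\<^sub>R ((1 / norm (g x)) *\<^sub>R H x v - ((g x \<bullet> H x v) / norm (g x) ^ 3) *\<^sub>R g x))) (at x within M)"
  proof (rule has_derivative_transform_within[OF _ e(1) x(1)])
    fix y assume y: "y \<in> M" "dist y x < e"
    have "sgn (g y \<bullet> y) = c" using e(2)[OF y(2)] c unfolding c_def by (auto simp: zero_less_mult_iff sgn_if split: if_splits)
    then show "c *\<^sub>R (g y /\<^sub>R norm (g y)) = outer_normal K y" using nu[OF y(1)] e(2)[OF y(2)] by (simp add: divide_inverse)
  qed
  then show thesis using that[of c] c nu[OF x] by (simp add: c_def)
qed

text \<open>A nonzero \<open>v\<close> of this kind would lie in the kernel of the differential of
  the Gauss map, a symmetric operator on the tangent space, and the Gauss curvature would be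
  zero.\<close>

lemma second_fundamental_form_nondegenerate:
  assumes C: "is_chart U \<phi> g H T" and x: "x \<in> M" "x \<in> U"
    and v: "g x \<bullet> v = 0" "H x v = \<tau> *\<^sub>R g x"
  shows "v = 0"
proof (rule ccontr)
  assume nz: "v \<noteq> 0"
  note g = is_chartD(5)[OF C x(2)] and sym = is_chartD(9)[OF C x(2)]
  obtain c where c: "c \<noteq> 0" "outer_normal K x = (c / norm (g x)) *\<^sub>R g x"
    and D0: "(outer_normal K has_derivative
      (\<lambda>v. c *\<^sub>R ((1 / norm (g x)) *\<^sub>R H x v - ((g x \<bullet> H x v) / norm (g x) ^ 3) *\<^sub>R g x))) (at x within M)"
    using outer_normal_has_derivative[OF C x] by blast
  define D where "D = (\<lambda>v. c *\<^sub>R ((1 / norm (g x)) *\<^sub>R H x v - ((g x \<bullet> H x v) / norm (g x) ^ 3) *\<^sub>R g x))"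
  have D: "(outer_normal K has_derivative D) (at x within M)" using D0 unfolding D_def .
  have gx: "norm (g x) > 0" using g by simp
  define V where "V = tangent_space (outer_normal K x)"
  have V: "w \<in> V \<longleftrightarrow> g x \<bullet> w = 0" for w
    using c gx by (simp add: V_def tangent_space_def)
  have sub: "subspace V" by (simp add: subspace_def V inner_add_right)
  \<comment> \<open>The curvature is built from some derivative within \<open>M\<close>, determined
    only on tangent vectors; the eigenspaces are taken inside \<open>V\<close> and see nothing
    else.\<close>
  have "differential M (outer_normal K) x w = D w" if "w \<in> V" for w
    using differential_eq_on_tangent[OF is_chartD(1)[OF C] x(2) is_chartD(2)[OF C] x(1) is_chartD(3)[OF C] is_chartD(4)[OF C x(2)] g _ D, of w] that by (simp add: V)
  then have eig: "{w \<in> V. differential M (outer_normal K) x w = t *\<^sub>R w} = {w \<in> V. D w = t *\<^sub>R w}" for t by auto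
  have "prod_list (eigenvalues_on V D) = 0"
  proof (rule prod_list_eigenvalues_on_eq_0[OF sub])
    show "linear D" using D has_derivative_linear by blast
    show "D w \<in> V" for w
    proof -
      have "g x \<bullet> g x = norm (g x) * norm (g x)" by (simp add: norm_eq_sqrt_inner)
      then show ?thesis unfolding V using gx by (simp add: D_def inner_diff_right field_simps power3_eq_cube)
    qed
    show "D w \<bullet> w' = w \<bullet> D w'" if "w \<in> V" "w' \<in> V" for w w'
      using that by (simp add: V D_def inner_diff_left inner_diff_right sym inner_commute[of w "g x"])
    show "v \<in> V" "v \<noteq> 0" using v nz by (auto simp: V)
    have "g x \<bullet> g x = norm (g x) * norm (g x)" by (simp add: norm_eq_sqrt_inner)
    then show "D v = 0" using gx by (simp add: D_def v(2) field_simps power3_eq_cube)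
  qed
  then have "gauss_curvature K x = 0"
    unfolding gauss_curvature_def V_def[symmetric] eigenvalues_on_def M_eq[symmetric] eig .
  then show False using gauss[OF x(1)] by simp
qed

text \<open>Strict convexity: a segment between two points with normal \<open>y\<close> would lie in
  \<open>M\<close> with constant normal, so the differential of the Gauss map at its endpoint
  \<open>x\<close> would annihilate a tangent vector. The derivative along the segment is one-sided,
  hence taken within [0, 1].\<close>

lemma normal_at_determines_point:
  assumes y: "y \<noteq> 0" and x: "x \<in> K" "normal_at y x" and x': "x' \<in> K" "normal_at y x'"
  shows "x = x'"
proof -
  define v where "v = x' - x"
  have yv: "y \<bullet> v = 0" using x x' by (simp add: v_def normal_at_def inner_diff_right eq_iff)
  have xM: "x \<in> M" using normal_at_imp_frontier[OF y x] .
  obtain U \<phi> g H T where C: "is_chart U \<phi> g H T" and xU: "x \<in> U" by (rule exists_chart[OF xM])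
  obtain c where c: "c \<noteq> 0" "outer_normal K x = (c / norm (g x)) *\<^sub>R g x"
    and D: "(outer_normal K has_derivative
      (\<lambda>v. c *\<^sub>R ((1 / norm (g x)) *\<^sub>R H x v - ((g x \<bullet> H x v) / norm (g x) ^ 3) *\<^sub>R g x))) (at x within M)"
    using outer_normal_has_derivative[OF C xM xU] by blast
  define D' where "D' = (\<lambda>v. c *\<^sub>R ((1 / norm (g x)) *\<^sub>R H x v - ((g x \<bullet> H x v) / norm (g x) ^ 3) *\<^sub>R g x))"
  have gx: "norm (g x) > 0" using is_chartD(5)[OF C xU] by simp
  have seg: "x + s *\<^sub>R v \<in> M \<and> outer_normal K (x + s *\<^sub>R v) = y /\<^sub>R norm y" if "s \<in> {0..1}" for s
  proof -
    have "x + s *\<^sub>R v = (1 - s) *\<^sub>R x + s *\<^sub>R x'" by (simp add: v_def algebra_simps)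
    then have sK: "x + s *\<^sub>R v \<in> K" using K(2) x x' that by (simp add: convex_alt)
    have "normal_at y (x + s *\<^sub>R v)" using x(2) yv by (simp add: normal_at_def inner_add_right)
    then have "x + s *\<^sub>R v \<in> M" "normal_at (y /\<^sub>R norm y) (x + s *\<^sub>R v)"
      using normal_at_imp_frontier[OF y sK] y by (auto simp: normal_at_def divide_simps)
    then show ?thesis using y by (auto intro: outer_normal_eq)
  qed
  have "((\<lambda>s. outer_normal K (x + s *\<^sub>R v)) has_derivative (\<lambda>s. D' (s *\<^sub>R v))) (at 0 within {0..1})"
  proof (rule has_derivative_in_compose[where f="\<lambda>s. x + s *\<^sub>R v" and g="outer_normal K" and g'=D'])
    show "((\<lambda>s. x + s *\<^sub>R v) has_derivative (\<lambda>s. s *\<^sub>R v)) (at 0 within {0..1})"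
      by (auto intro!: derivative_eq_intros)
    have "(\<lambda>s. x + s *\<^sub>R v) ` {0..1} \<subseteq> M" using seg by auto
    then show "(outer_normal K has_derivative D') (at (x + 0 *\<^sub>R v) within (\<lambda>s. x + s *\<^sub>R v) ` {0..1})"
      using has_derivative_subset[OF D[folded D'_def]] by simp
  qed
  then have "((\<lambda>s. outer_normal K (x + s *\<^sub>R v)) has_vector_derivative D' v) (at 0 within cbox 0 1)"
    using linear_scale[OF has_derivative_linear[OF D[folded D'_def]]] by (simp add: has_vector_derivative_def cbox_interval)
  moreover have "((\<lambda>s. outer_normal K (x + s *\<^sub>R v)) has_vector_derivative 0) (at 0 within cbox 0 1)"
    by (rule has_vector_derivative_transform[of _ _ _ "\<lambda>s. y /\<^sub>R norm y"]) (use seg in \<open>auto simp: cbox_interval\<close>)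
  ultimately have "D' v = 0"
    using vector_derivative_unique_within_closed_interval[of 0 1 0] by auto
  then have "(1 / norm (g x)) *\<^sub>R H x v = ((g x \<bullet> H x v) / norm (g x) ^ 3) *\<^sub>R g x"
    using c by (simp add: D'_def)
  then have "norm (g x) *\<^sub>R ((1 / norm (g x)) *\<^sub>R H x v) = norm (g x) *\<^sub>R (((g x \<bullet> H x v) / norm (g x) ^ 3) *\<^sub>R g x)" by simp
  then have Hv: "H x v = (norm (g x) * ((g x \<bullet> H x v) / norm (g x) ^ 3)) *\<^sub>R g x" using gx by simp
  have "outer_normal K x = y /\<^sub>R norm y" using seg[of 0] by simp
  then have "outer_normal K x \<bullet> v = 0" using yv by simp
  then have "g x \<bullet> v = 0" using c gx by simp
  then have "v = 0"
    using second_fundamental_form_nondegenerate[OF C xM xU _ Hv] by simp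
  then show ?thesis by (simp add: v_def)
qed

end

section \<open>Regularity of the inverse Gauss map\<close>

context smooth_convex_body
begin

text \<open>The inverse Gauss map, extended to normals of any length. For nonzero \<open>y\<close>
  the choice is unique by strict convexity; at 0 it is an arbitrary point of
  \<open>K\<close>.\<close>

definition X :: "'a \<Rightarrow> 'a" where
  "X y = (SOME x. x \<in> K \<and> normal_at y x)"

lemma X: "X y \<in> K" "normal_at y (X y)"
proof -
  have "K \<noteq> {}" using K(3) interior_subset by blast
  then have "\<exists>x\<in>K. \<forall>x'\<in>K. y \<bullet> x' \<le> y \<bullet> x"
    using K(1) by (intro continuous_attains_sup continuous_intros)
  then have "\<exists>x. x \<in> K \<and> normal_at y x" by (auto simp: normal_at_def)
  from someI_ex[OF this] show "X y \<in> K" "normal_at y (X y)" by (auto simp: X_def)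
qed

lemma X_eq:
  assumes "y \<noteq> 0" "x \<in> K" "normal_at y x"
  shows "X y = x"
  using normal_at_determines_point[OF assms(1)] X assms by blast

lemma X_in_M: "y \<noteq> 0 \<Longrightarrow> X y \<in> M"
  using X normal_at_imp_frontier by blast

lemma X_scale:
  assumes "c > 0" "y \<noteq> 0"
  shows "X (c *\<^sub>R y) = X y"
  using X[of y] assms by (intro X_eq) (auto simp: normal_at_def)

lemma X_outer_normal:
  assumes "x \<in> M"
  shows "X (outer_normal K x) = x"
proof (rule X_eq)
  show "outer_normal K x \<noteq> 0" using outer_normal(1)[OF assms] by auto
qed (use outer_normal[OF assms] M_subset assms in auto)

text \<open>By uniqueness the graph consists of all pairs satisfying the support inequalities, so it
  is relatively closed; a map with closed graph into a compact set is continuous.\<close>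

lemma continuous_on_X: "continuous_on (- {0}) X"
proof -
  have "X \<in> - {0} \<rightarrow> K" using X by auto
  moreover have "closedin (top_of_set ((- {0}) \<times> K)) ((\<lambda>y. (y, X y)) ` (- {0}))"
  proof -
    have "closed (\<Inter>x'\<in>K. {p :: 'a \<times> 'a. fst p \<bullet> x' \<le> fst p \<bullet> snd p})"
      by (intro closed_INT ballI closed_Collect_le continuous_intros)
    moreover have "(\<lambda>y. (y, X y)) ` (- {0}) = ((- {0}) \<times> K) \<inter> (\<Inter>x'\<in>K. {p :: 'a \<times> 'a. fst p \<bullet> x' \<le> fst p \<bullet> snd p})"
    proof (intro equalityI subsetI)
      fix p assume "p \<in> ((- {0}) \<times> K) \<inter> (\<Inter>x'\<in>K. {p :: 'a \<times> 'a. fst p \<bullet> x' \<le> fst p \<bullet> snd p})"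
      then have "fst p \<noteq> 0" "snd p \<in> K" "normal_at (fst p) (snd p)" by (auto simp: normal_at_def)
      then have "X (fst p) = snd p" by (rule X_eq)
      then show "p \<in> (\<lambda>y. (y, X y)) ` (- {0})" using \<open>fst p \<noteq> 0\<close> by (intro image_eqI[of _ _ "fst p"]) auto
    qed (use X in \<open>auto simp: normal_at_def\<close>)
    ultimately show ?thesis by (simp only: closedin_closed_Int)
  qed
  ultimately show ?thesis using continuous_closed_graph_eq[OF K(1)] by blast
qed

lemma isCont_X: "y \<noteq> 0 \<Longrightarrow> isCont X y"
  using continuous_on_X by (simp add: continuous_on_eq_continuous_at open_Compl)

lemma linear_chart_third_derivative:
  assumes C: "is_chart U \<phi> g H T" and y: "y \<in> U"
  shows "linear (T y w)"
proof -
  have lin: "linear (H z)" if "z \<in> U" for z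
    using is_chartD(6)[OF C that] has_derivative_linear by blast
  note U = is_chartD(1)[OF C]
  show ?thesis
  proof (rule linearI)
    fix a b :: 'a and r :: real
    have "((\<lambda>z. H z a + H z b) has_derivative (\<lambda>w. T y w a + T y w b)) (at y)"
      by (intro has_derivative_add is_chartD(7)[OF C y])
    then have "((\<lambda>z. H z (a + b)) has_derivative (\<lambda>w. T y w a + T y w b)) (at y)"
      by (rule has_derivative_transform_within_open[OF _ U y]) (simp add: linear_add[OF lin])
    then show "T y w (a + b) = T y w a + T y w b"
      using has_derivative_unique[OF is_chartD(7)[OF C y]] by metis
    have "((\<lambda>z. r *\<^sub>R H z a) has_derivative (\<lambda>w. r *\<^sub>R T y w a)) (at y)"
      by (intro has_derivative_scaleR_right is_chartD(7)[OF C y])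
    then have "((\<lambda>z. H z (r *\<^sub>R a)) has_derivative (\<lambda>w. r *\<^sub>R T y w a)) (at y)"
      by (rule has_derivative_transform_within_open[OF _ U y]) (simp add: linear_scale[OF lin])
    then show "T y w (r *\<^sub>R a) = r *\<^sub>R T y w a"
      using has_derivative_unique[OF is_chartD(7)[OF C y]] by metis
  qed
qed

text \<open>
  In a chart, \<open>X y\<close> is determined by the equations \<open>t \<nabla>\<phi>(X y) = y\<close> and \<open>\<phi>(X y) = 0\<close>,
  with the scalar \<open>t\<close> as an additional unknown. Differentiating this system once more gives a
  system of the same kind for the derivatives.
\<close>
lemma chart_X_C2:
  assumes C: "is_chart U \<phi> g H T" and y0: "y0 \<noteq> 0" "X y0 \<in> U"
  obtains S A B where "open S" "y0 \<in> S" "0 \<notin> S"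
    "\<And>y. y \<in> S \<Longrightarrow> (X has_derivative A y) (at y)"
    "\<And>y w. y \<in> S \<Longrightarrow> ((\<lambda>y. A y w) has_derivative (\<lambda>u. B y u w)) (at y)"
    "\<And>y u w. y \<in> S \<Longrightarrow> isCont (\<lambda>y. B y u w) y"
    "\<And>y v. y \<in> S \<Longrightarrow> A y v = 0 \<Longrightarrow> y \<bullet> v = 0 \<Longrightarrow> v = 0"
proof -
  define S where "S = - {0} \<inter> X -` U"
  have S: "open S" unfolding S_def
    using continuous_open_preimage[OF continuous_on_X _ is_chartD(1)[OF C]] by auto
  have Sx: "y \<noteq> 0" "X y \<in> U" "X y \<in> M" if "y \<in> S" for y using that X_in_M by (auto simp: S_def)
  have linH: "linear (H x)" if "x \<in> U" for x
    using is_chartD(6)[OF C that] has_derivative_linear by blast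
  \<comment> \<open>The factor in y = t g(X y), written explicitly so that it inherits continuity
    from \<open>X\<close>.\<close>
  define t where "t y = (y \<bullet> g (X y)) / (g (X y) \<bullet> g (X y))" for y
  have t: "t y *\<^sub>R g (X y) = y \<and> t y \<noteq> 0" if y: "y \<in> S" for y
  proof -
    note yS = Sx[OF y]
    obtain c where c: "y = c *\<^sub>R g (X y)"
      using normal_parallel_gradient[OF is_chartD(1)[OF C] yS(2) is_chartD(2)[OF C] yS(3)
          is_chartD(3)[OF C] is_chartD(4)[OF C yS(2)] is_chartD(5)[OF C yS(2)], of y]
        X(2)[of y] M_subset by (auto simp: normal_at_def)
    have gg: "g (X y) \<bullet> g (X y) \<noteq> 0" using is_chartD(5)[OF C yS(2)] by simp
    have "t y = c" unfolding t_def using gg by (subst (1) c) simp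
    then show ?thesis using c yS(1) by auto
  qed
  have contg: "isCont g x" "isCont (\<lambda>x. H x v) x" "isCont (\<lambda>x. T x w v) x" if "x \<in> U" for x v w
    using has_derivative_continuous[OF is_chartD(6)[OF C that]]
      has_derivative_continuous[OF is_chartD(7)[OF C that]]
      is_chartD(8)[OF C] is_chartD(1)[OF C] that by (auto simp: continuous_on_eq_continuous_at)
  have cX: "isCont X y" if "y \<in> S" for y using isCont_X Sx[OF that] by blast
  have cgX: "isCont (\<lambda>z. g (X z)) y" "isCont (\<lambda>z. H (X z) v) y" "isCont (\<lambda>z. T (X z) w v) y"
    if "y \<in> S" for y v w
    using isCont_o2[OF cX[OF that]] contg[OF Sx(2)[OF that]] by blast+
  have ct: "isCont t y" if "y \<in> S" for y
    unfolding t_def[abs_def] using cgX(1)[OF that] is_chartD(5)[OF C Sx(2)[OF that]]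
    by (intro continuous_intros) auto
  have evS: "\<forall>\<^sub>F z in nhds y. z \<in> S" "\<forall>\<^sub>F z in at y. z \<in> S" if "y \<in> S" for y
    using eventually_nhds_in_open[OF S that] eventually_at_in_open'[OF S that] by auto

  define F where "F p = (snd p *\<^sub>R g (fst p), \<phi> (fst p))" for p :: "'a \<times> real"
  define L where "L p q = (snd q *\<^sub>R g (fst p) + snd p *\<^sub>R H (fst p) (fst q), g (fst p) \<bullet> fst q)" for p q :: "'a \<times> real"
  define \<xi> where "\<xi> y = (X y, t y)" for y
  have gfst: "((\<lambda>p. g (fst p)) has_derivative (\<lambda>q. H (fst p) (fst q))) (at p)"
    and phifst: "((\<lambda>p. \<phi> (fst p)) has_derivative (\<lambda>q. g (fst p) \<bullet> fst q)) (at p)"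
    if "fst p \<in> U" for p :: "'a \<times> real"
    using is_chartD(6)[OF C that] is_chartD(4)[OF C that]
    by (auto intro: has_derivative_compose[OF has_derivative_fst[OF has_derivative_ident]])
  have F: "(F has_derivative L p) (at p)" if "fst p \<in> U" for p
  proof -
    have "(F has_derivative (\<lambda>q. (snd p *\<^sub>R H (fst p) (fst q) + snd q *\<^sub>R g (fst p), g (fst p) \<bullet> fst q))) (at p)"
      unfolding F_def[abs_def] using gfst[OF that] phifst[OF that]
      by (intro has_derivative_Pair has_derivative_scaleR has_derivative_snd has_derivative_ident)
    then show ?thesis by (simp add: L_def[abs_def] add.commute)
  qed
  have linL: "linear (L p)" if "fst p \<in> U" for p using F[OF that] has_derivative_linear by blast
  have F\<xi>: "F (\<xi> y) = (y, 0)" if "y \<in> S" for y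
  proof -
    have "\<phi> (X y) = 0" using Sx[OF that] is_chartD(2)[OF C] by blast
    then show ?thesis using t[OF that] by (simp add: F_def \<xi>_def)
  qed
  \<comment> \<open>A kernel element has a tangential first component that the Hessian maps to a
    multiple of the gradient. Nondegeneracy of the second fundamental form makes it zero, and then
    the scalar component is zero too.\<close>
  have injL: "inj (L (\<xi> y))" if y: "y \<in> S" for y
  proof -
    have "q = 0" if q: "L (\<xi> y) q = 0" for q
    proof -
      have 1: "snd q *\<^sub>R g (X y) + t y *\<^sub>R H (X y) (fst q) = 0" "g (X y) \<bullet> fst q = 0"
        using q by (auto simp: L_def \<xi>_def zero_prod_def)
      have "t y *\<^sub>R H (X y) (fst q) = (- snd q) *\<^sub>R g (X y)" using 1(1) by (simp add: add_eq_0_iff)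
      then have "H (X y) (fst q) = (1 / t y) *\<^sub>R ((- snd q) *\<^sub>R g (X y))"
        using t[OF y] by (metis divide_inverse mult_1 scaleR_one scaleR_scaleR left_inverse)
      then have "H (X y) (fst q) = (- snd q / t y) *\<^sub>R g (X y)" by simp
      then have "fst q = 0"
        using second_fundamental_form_nondegenerate[OF C Sx(3)[OF y] Sx(2)[OF y] 1(2)] by blast
      moreover have "snd q = 0"
        using 1(1) is_chartD(5)[OF C Sx(2)[OF y]] by (simp add: calculation linear_0[OF linH[OF Sx(2)[OF y]]])
      ultimately show ?thesis by (simp add: prod_eq_iff)
    qed
    then show ?thesis using linear_injective_0[OF linL[of "\<xi> y"]] Sx(2)[OF y] by (auto simp: \<xi>_def)
  qed
  have c\<xi>: "isCont \<xi> y" if "y \<in> S" for y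
    unfolding \<xi>_def[abs_def] using cX[OF that] ct[OF that] by (intro continuous_intros)
  have ex1: "\<exists>D. (\<xi> has_derivative D) (at y) \<and> (\<forall>v. L (\<xi> y) (D v) = (v, 0))" if y: "y \<in> S" for y
  proof (rule implicit_differentiable)
    show "(F has_derivative L (\<xi> y)) (at (\<xi> y))" using Sx(2)[OF y] by (intro F) (simp add: \<xi>_def)
    show "((\<lambda>z. (z, 0)) has_derivative (\<lambda>v. (v, 0))) (at y)"
      by (intro has_derivative_Pair has_derivative_ident) auto
    show "\<forall>\<^sub>F z in nhds y. F (\<xi> z) = (z, 0)" using evS(1)[OF y] by eventually_elim (rule F\<xi>)
  qed (use injL[OF y] c\<xi>[OF y] in auto)
  then obtain D where D: "\<And>y. y \<in> S \<Longrightarrow> (\<xi> has_derivative D y) (at y)"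
    and LD: "\<And>y v. y \<in> S \<Longrightarrow> L (\<xi> y) (D y v) = (v, 0)" by metis

  have tX: "(X \<longlongrightarrow> X y) (at y)" "(t \<longlongrightarrow> t y) (at y)" "((\<lambda>z. g (X z)) \<longlongrightarrow> g (X y)) (at y)"
    "((\<lambda>z. H (X z) v) \<longlongrightarrow> H (X y) v) (at y)" "((\<lambda>z. T (X z) w v) \<longlongrightarrow> T (X y) w v) (at y)"
    if "y \<in> S" for y v w
    using cX[OF that] ct[OF that] cgX[OF that] by (auto simp: isCont_def)
  have tL: "((\<lambda>z. L (\<xi> z) q) \<longlongrightarrow> L (\<xi> y) q) (at y)" if "y \<in> S" for y q
    unfolding L_def \<xi>_def fst_conv snd_conv using tX[OF that] by (intro tendsto_intros)
  \<comment> \<open>The derivative solves a linear system whose coefficients are continuous in the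
    base point. Its continuity is required before it can serve as an unknown of the second
    system.\<close>
  have cD: "isCont (\<lambda>z. D z w) y" if y: "y \<in> S" for y w
    unfolding isCont_def
  proof (rule tendsto_injective_linear_family[where L="\<lambda>z. L (\<xi> z)" and ?L0.0="L (\<xi> y)"])
    show "\<forall>\<^sub>F z in at y. linear (L (\<xi> z))"
      using evS(2)[OF y] by eventually_elim (auto intro!: linL Sx simp: \<xi>_def)
    show "linear (L (\<xi> y))" by (auto intro!: linL Sx y simp: \<xi>_def)
    show "((\<lambda>z. L (\<xi> z) (D z w)) \<longlongrightarrow> L (\<xi> y) (D y w)) (at y)"
      by (rule tendsto_eventually) (use evS(2)[OF y] in eventually_elim, simp add: LD y)
  qed (use injL[OF y] tL[OF y] in auto)

  \<comment> \<open>The unknowns are now \<xi> and its derivative in a fixed direction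
    \<open>w\<close>; \<open>F2\<close> joins the system with its linearization. The derivative
    \<open>L2\<close> is block triangular with \<open>L\<close> in both diagonal blocks, so
    injectivity carries over.\<close>
  define F2 where "F2 r = (F (fst r), L (fst r) (snd r))" for r :: "('a \<times> real) \<times> ('a \<times> real)"
  define L2 where "L2 r r' = (L (fst r) (fst r'),
    (snd (snd r') *\<^sub>R g (fst (fst r)) + snd (snd r) *\<^sub>R H (fst (fst r)) (fst (fst r'))
      + (snd (fst r') *\<^sub>R H (fst (fst r)) (fst (snd r)) + snd (fst r) *\<^sub>R
          (T (fst (fst r)) (fst (fst r')) (fst (snd r)) + H (fst (fst r)) (fst (snd r')))),
     H (fst (fst r)) (fst (fst r')) \<bullet> fst (snd r) + g (fst (fst r)) \<bullet> fst (snd r')))"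
    for r r' :: "('a \<times> real) \<times> ('a \<times> real)"
  have F2: "(F2 has_derivative L2 r) (at r)" if r: "fst (fst r) \<in> U" for r
  proof -
    note ffst = has_derivative_fst[OF has_derivative_ident]
    have 1: "((\<lambda>r. F (fst r)) has_derivative (\<lambda>r'. L (fst r) (fst r'))) (at r)"
      using F[OF r] by (rule has_derivative_compose[OF ffst])
    have 2: "((\<lambda>r. g (fst (fst r))) has_derivative (\<lambda>r'. H (fst (fst r)) (fst (fst r')))) (at r)"
      using gfst[OF r] by (rule has_derivative_compose[OF ffst])
    have op: "open {r :: ('a \<times> real) \<times> ('a \<times> real). fst (fst r) \<in> U}"
    proof -
      have "continuous_on UNIV (\<lambda>r :: ('a \<times> real) \<times> ('a \<times> real). fst (fst r))"
        by (intro continuous_intros)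
      from open_vimage[OF is_chartD(1)[OF C] this] show ?thesis by (simp add: vimage_def)
    qed
    have fst3: "((\<lambda>r. fst (snd r)) has_derivative (\<lambda>r'. fst (snd r'))) (at r)"
      by (intro has_derivative_fst has_derivative_snd has_derivative_ident)
    have 3: "((\<lambda>r. H (fst (fst r)) (fst (snd r))) has_derivative
        (\<lambda>r'. T (fst (fst r)) (fst (fst r')) (fst (snd r)) + H (fst (fst r)) (fst (snd r')))) (at r)"
    proof (rule has_derivative_linear_family[OF op, where K="\<lambda>r'. T (fst (fst r)) (fst (fst r'))", OF _ _ _ fst3])
      show "r \<in> {r. fst (fst r) \<in> U}" using r by simp
      show "linear (H (fst (fst s)))" if "s \<in> {r. fst (fst r) \<in> U}" for s using linH that by simp
      show "((\<lambda>r. H (fst (fst r)) v) has_derivative (\<lambda>r'. T (fst (fst r)) (fst (fst r')) v)) (at r)" for v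
        using is_chartD(7)[OF C r, of v]
        by (rule has_derivative_compose[OF has_derivative_fst[OF ffst]])
    qed
    have "(F2 has_derivative (\<lambda>r'. (L (fst r) (fst r'),
    ((snd (snd r) *\<^sub>R H (fst (fst r)) (fst (fst r')) + snd (snd r') *\<^sub>R g (fst (fst r)))
      + (snd (fst r) *\<^sub>R
          (T (fst (fst r)) (fst (fst r')) (fst (snd r)) + H (fst (fst r)) (fst (snd r'))) + snd (fst r') *\<^sub>R H (fst (fst r)) (fst (snd r))),
     g (fst (fst r)) \<bullet> fst (snd r') + H (fst (fst r)) (fst (fst r')) \<bullet> fst (snd r))))) (at r)"
      unfolding F2_def[abs_def] L_def[abs_def]
      by (intro has_derivative_Pair 1[unfolded L_def] has_derivative_add has_derivative_scaleR has_derivative_inner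
          2 3 has_derivative_snd has_derivative_fst has_derivative_ident)
    then show ?thesis by (simp add: L2_def[abs_def] add.commute)
  qed
  have linL2: "linear (L2 r)" if "fst (fst r) \<in> U" for r using F2[OF that] has_derivative_linear by blast
  define \<xi>2 where "\<xi>2 w y = (\<xi> y, D y w)" for w y
  have \<xi>2U: "fst (fst (\<xi>2 w y)) \<in> U" if "y \<in> S" for w y using Sx(2)[OF that] by (simp add: \<xi>2_def \<xi>_def)
  have injL2: "inj (L2 (\<xi>2 w y))" if y: "y \<in> S" for w y
  proof -
    note lin = linH[OF Sx(2)[OF y]]
    have L0: "q = 0" if "L (\<xi> y) q = 0" for q
    proof -
      have "linear (L (\<xi> y))" by (auto intro!: linL Sx y simp: \<xi>_def)
      then show ?thesis using injL[OF y] that linear_injective_0 by blast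
    qed
    have "r' = 0" if r': "L2 (\<xi>2 w y) r' = 0" for r'
    proof -
      have "L (\<xi> y) (fst r') = 0" using r' by (simp add: L2_def \<xi>2_def zero_prod_def)
      then have 0: "fst r' = 0" by (rule L0)
      have T0: "T (X y) 0 v = 0" for v
        using is_chartD(7)[OF C Sx(2)[OF y], of v] has_derivative_linear linear_0 by blast
      have "L (\<xi> y) (snd r') = 0"
        using r' 0 by (simp add: L2_def \<xi>2_def \<xi>_def L_def zero_prod_def linear_0[OF lin] T0)
      then have "snd r' = 0" by (rule L0)
      then show ?thesis using 0 by (simp add: prod_eq_iff)
    qed
    then show ?thesis using linear_injective_0[OF linL2[OF \<xi>2U[OF y]]] by blast
  qed
  have ex2: "\<exists>E. (\<xi>2 w has_derivative E) (at y) \<and> (\<forall>u. L2 (\<xi>2 w y) (E u) = ((u, 0), (0, 0)))" if y: "y \<in> S" for w y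
  proof (rule implicit_differentiable)
    show "(F2 has_derivative L2 (\<xi>2 w y)) (at (\<xi>2 w y))" by (rule F2[OF \<xi>2U[OF y]])
    show "inj (L2 (\<xi>2 w y))" by (rule injL2[OF y])
    show "isCont (\<xi>2 w) y" unfolding \<xi>2_def[abs_def] using c\<xi>[OF y] cD[OF y] by (intro continuous_intros)
    show "((\<lambda>z. ((z, 0), (w, 0))) has_derivative (\<lambda>u. ((u, 0), (0, 0)))) (at y)"
      by (intro has_derivative_Pair has_derivative_ident has_derivative_const)
    show "\<forall>\<^sub>F z in nhds y. F2 (\<xi>2 w z) = ((z, 0), (w, 0))"
      using evS(1)[OF y] by eventually_elim (simp add: F2_def \<xi>2_def F\<xi> LD)
  qed
  define E where "E w y = (SOME E. (\<xi>2 w has_derivative E) (at y) \<and> (\<forall>u. L2 (\<xi>2 w y) (E u) = ((u, 0), (0, 0))))" for w y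
  have E: "(\<xi>2 w has_derivative E w y) (at y)"
    and LE: "L2 (\<xi>2 w y) (E w y u) = ((u, 0), (0, 0))" if "y \<in> S" for w y u
    using someI_ex[OF ex2[OF that, of w]] by (auto simp: E_def)
  have tD: "((\<lambda>z. D z w) \<longlongrightarrow> D y w) (at y)" if "y \<in> S" for y w
    using cD[OF that] by (simp add: isCont_def)
  have cE: "isCont (\<lambda>z. E w z u) y" if y: "y \<in> S" for y w u
    unfolding isCont_def
  proof (rule tendsto_injective_linear_family[where L="\<lambda>z. L2 (\<xi>2 w z)" and ?L0.0="L2 (\<xi>2 w y)"])
    show "\<forall>\<^sub>F z in at y. linear (L2 (\<xi>2 w z))"
      using evS(2)[OF y] by eventually_elim (intro linL2 \<xi>2U)
    show "linear (L2 (\<xi>2 w y))" by (intro linL2 \<xi>2U y)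
    show "inj (L2 (\<xi>2 w y))" by (rule injL2[OF y])
    show "((\<lambda>z. L2 (\<xi>2 w z) r) \<longlongrightarrow> L2 (\<xi>2 w y) r) (at y)" for r
    proof -
      have h: "((\<lambda>z. H (X z) (fst (D z w))) \<longlongrightarrow> H (X y) (fst (D y w))) (at y)"
        by (rule tendsto_linear_family)
          (use evS(2)[OF y] linH Sx y tX(4)[OF y] tD[OF y] in \<open>auto intro!: tendsto_intros elim!: eventually_mono\<close>)
      have T: "((\<lambda>z. T (X z) v (fst (D z w))) \<longlongrightarrow> T (X y) v (fst (D y w))) (at y)" for v
        by (rule tendsto_linear_family)
          (use evS(2)[OF y] linear_chart_third_derivative[OF C] Sx y tX(5)[OF y] tD[OF y] in
            \<open>auto intro!: tendsto_intros elim!: eventually_mono\<close>)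
      show ?thesis
        unfolding L2_def \<xi>2_def fst_conv snd_conv
        using tL[OF y] tX[OF y] tD[OF y] h T unfolding \<xi>_def fst_conv snd_conv
        by (intro tendsto_Pair tendsto_intros) auto
    qed
    show "((\<lambda>z. L2 (\<xi>2 w z) (E w z u)) \<longlongrightarrow> L2 (\<xi>2 w y) (E w y u)) (at y)"
      by (rule tendsto_eventually) (use evS(2)[OF y] in eventually_elim, simp add: LE y)
  qed

  show thesis
  proof (rule that[of S "\<lambda>y v. fst (D y v)" "\<lambda>y u w. fst (snd (E w y u))"])
    show "y0 \<in> S" "0 \<notin> S" using y0 by (auto simp: S_def)
    show "(X has_derivative (\<lambda>v. fst (D y v))) (at y)" if "y \<in> S" for y
      using has_derivative_fst[OF D[OF that]] by (simp add: \<xi>_def)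
    show "((\<lambda>y. fst (D y w)) has_derivative (\<lambda>u. fst (snd (E w y u)))) (at y)" if "y \<in> S" for y w
      using has_derivative_fst[OF has_derivative_snd[OF E[OF that, of w]]] by (simp add: \<xi>2_def)
    show "isCont (\<lambda>y. fst (snd (E w y u))) y" if "y \<in> S" for y u w
      using cE[OF that] by (intro continuous_intros)
    \<comment> \<open>If X does not move in direction v, the linearized system makes v a multiple of
      the gradient, hence of \<open>y\<close>.\<close>
    show "v = 0" if y: "y \<in> S" and v: "fst (D y v) = 0" "y \<bullet> v = 0" for y v
    proof -
      have "v = snd (D y v) *\<^sub>R g (X y)"
        using LD[OF y, of v] v linear_0[OF linH[OF Sx(2)[OF y]]] by (simp add: L_def \<xi>_def)
      moreover have "y = t y *\<^sub>R g (X y)" "t y \<noteq> 0" using t[OF y] by auto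
      ultimately have "v = (snd (D y v) / t y) *\<^sub>R y"
        by (metis nonzero_mult_div_cancel_right scaleR_scaleR times_divide_eq_left)
      then show ?thesis using v(2) Sx(1)[OF y] by (metis inner_commute inner_eq_zero_iff inner_scaleR_right scale_zero_left mult_eq_0_iff)
    qed
  qed (rule S)
qed

end

section \<open>The Hessian of the support function\<close>

text \<open>The radial unit vector completes a tangential eigenbasis to one of the whole space, with
  eigenvalue 0. Zero entries leave \<open>esym\<close> unchanged, so on tangent vectors the ambient
  Newton operators are those of the restriction of \<open>A\<close>.\<close>

lemma tangential_eigenbasis:
  fixes A :: "'a::euclidean_space \<Rightarrow> 'a"
  assumes A: "linear A" and sym: "\<And>v w. A v \<bullet> w = v \<bullet> A w" and y: "y \<noteq> 0" "A y = 0"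
    and psd: "\<And>v. v \<bullet> A v \<ge> 0" and nondeg: "\<And>v. A v = 0 \<Longrightarrow> y \<bullet> v = 0 \<Longrightarrow> v = 0"
  obtains B \<mu> where "finite B" "pairwise orthogonal B" "\<And>b. b \<in> B \<Longrightarrow> norm b = 1"
    "span B = tangent_space y" "card B = DIM('a) - 1" "\<And>b. b \<in> B \<Longrightarrow> A b = \<mu> b *\<^sub>R b"
    "\<And>b. b \<in> B \<Longrightarrow> \<mu> b > 0" "\<And>m. sigma_op A m = esym m \<mu> B"
    "\<And>m v. y \<bullet> v = 0 \<Longrightarrow> v \<bullet> newton_op A m v = (\<Sum>b\<in>B. (v \<bullet> b)\<^sup>2 * esym m \<mu> (B - {b}))"
    "\<And>m v. y \<bullet> v = 0 \<Longrightarrow> A v \<bullet> newton_op A m v = (\<Sum>b\<in>B. (v \<bullet> b)\<^sup>2 * (\<mu> b * esym m \<mu> (B - {b})))"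
proof -
  define V where "V = tangent_space y"
  have V: "subspace V" "\<And>v. v \<in> V \<longleftrightarrow> y \<bullet> v = 0"
    by (auto simp: V_def tangent_space_def subspace_def inner_add_right)
  have inv: "A v \<in> V" if "v \<in> V" for v using sym[of y v] y(2) by (simp add: V(2))
  obtain B \<mu>0 where B: "finite B" "B \<subseteq> V" "pairwise orthogonal B" "\<And>b. b \<in> B \<Longrightarrow> norm b = 1"
    "span B = V" "card B = dim V" "\<And>b. b \<in> B \<Longrightarrow> A b = \<mu>0 b *\<^sub>R b"
    using self_adjoint_on_orthonormal_eigenbasis[OF V(1) A inv sym] by metis
  define e where "e = y /\<^sub>R norm y"
  \<comment> \<open>The eigenvalue function obtained for \<open>B\<close> has no meaning at the
    added vector \<open>e\<close>, so it is reset there.\<close>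
  define \<mu> where "\<mu> = \<mu>0(e := 0)"
  interpret A: linear A by fact
  have e: "norm e = 1" "A e = 0" using y by (auto simp: e_def A.scale)
  have eV: "e \<notin> V" using y by (simp add: e_def V(2))
  then have eB: "e \<notin> B" using B(2) by blast
  have eig: "A b = \<mu> b *\<^sub>R b" if "b \<in> insert e B" for b using that B(7) e eB by (auto simp: \<mu>_def)
  have ye: "y = norm y *\<^sub>R e" using y by (simp add: e_def)
  have orth: "pairwise orthogonal (insert e B)"
    using B(2,3) by (auto simp: pairwise_insert orthogonal_def e_def V(2) inner_commute subset_iff)
  have nrm: "norm b = 1" if "b \<in> insert e B" for b using that B(4) e by auto
  have "v \<in> span (insert e B)" for v
  proof -
    have "v - (e \<bullet> v) *\<^sub>R e \<in> V" using e(1) by (subst V(2), subst ye) (simp add: inner_diff_right norm_eq_1)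
    then show ?thesis using B(5) span_breakdown_eq by metis
  qed
  then have sp: "span (insert e B) = UNIV" by auto
  have fin: "finite (insert e B)" using B(1) by simp
  have rem: "insert e B - {b} = insert e (B - {b})" if "b \<in> B" for b using that eB by auto
  have e0: "\<mu> e = 0" by (simp add: \<mu>_def)
  have sig: "sigma_op A m = esym m \<mu> B" for m
    using newton_op_eigenvector(2)[OF A fin orth nrm sp eig, of m] esym_insert_zero[of B \<mu> e m, OF B(1) e0] by simp
  have new: "newton_op A m b = esym m \<mu> (B - {b}) *\<^sub>R b" if "b \<in> B" for m b
    using newton_op_eigenvector(1)[OF A fin orth nrm sp eig, of b m] that rem[OF that] esym_insert_zero[of "B - {b}" \<mu> e m] B(1) e0 by simp
  have ex: "v = (\<Sum>b\<in>B. (v \<bullet> b) *\<^sub>R b)" if "y \<bullet> v = 0" for v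
    using orthonormal_basis_expand[OF B(3,4) _ B(1), of v] that B(5) V(2) by simp
  have quad: "w \<bullet> L v = (\<Sum>b\<in>B. (v \<bullet> b) * (w \<bullet> L b))" if "linear L" "y \<bullet> v = 0" for L w v
  proof -
    interpret linear L by fact
    have "L v = (\<Sum>b\<in>B. (v \<bullet> b) *\<^sub>R L b)" by (subst ex[OF that(2)]) (simp add: sum scale)
    then show ?thesis by (simp add: inner_sum_right)
  qed
  have pos: "\<mu> b > 0" if b: "b \<in> B" for b
  proof -
    have "\<mu> b = b \<bullet> A b" using eig[of b] b B(4) by (simp add: norm_eq_1)
    then have "\<mu> b \<ge> 0" using psd by simp
    moreover have "\<mu> b \<noteq> 0"
    proof
      assume "\<mu> b = 0"
      then have "A b = 0" using eig b by simp
      then have "b = 0" using nondeg b B(2) V(2) by blast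
      then show False using B(4)[OF b] by simp
    qed
    ultimately show ?thesis by simp
  qed
  show thesis
  proof (rule that[of B \<mu>])
    show "span B = tangent_space y" using B(5) by (simp add: V_def)
    have "V = {v. y \<bullet> v = 0}" using V(2) by auto
    then show "card B = DIM('a) - 1" using B(6) dim_hyperplane[OF y(1)] by simp
    show "v \<bullet> newton_op A m v = (\<Sum>b\<in>B. (v \<bullet> b)\<^sup>2 * esym m \<mu> (B - {b}))" if "y \<bullet> v = 0" for m v
      using quad[OF linear_newton_op[OF A] that, of v m] new by (simp add: power2_eq_square algebra_simps)
    show "A v \<bullet> newton_op A m v = (\<Sum>b\<in>B. (v \<bullet> b)\<^sup>2 * (\<mu> b * esym m \<mu> (B - {b})))" if "y \<bullet> v = 0" for m v
      using quad[OF linear_newton_op[OF A] that, of "A v" m] new eig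
      by (simp add: power2_eq_square algebra_simps sym)
  qed (use B(1,3,4) eig pos sig in auto)
qed

lemma newton_op_scale:
  assumes "linear A"
  shows "newton_op (\<lambda>v. c *\<^sub>R A v) m v = c ^ m *\<^sub>R newton_op A m v"
proof (induction m arbitrary: v)
  case (Suc m)
  interpret N: linear "newton_op A m" using assms by (rule linear_newton_op)
  have "op_trace (\<lambda>x. newton_op (\<lambda>v. c *\<^sub>R A v) m (c *\<^sub>R A x)) = c ^ Suc m * op_trace (\<lambda>x. newton_op A m (A x))"
    by (simp add: Suc N.scale op_trace_scale)
  then show ?case by (simp add: Suc N.scale algebra_simps)
qed simp

lemma sigma_op_scale:
  assumes "linear A"
  shows "sigma_op (\<lambda>v. c *\<^sub>R A v) m = c ^ m * sigma_op A m"
proof (cases m)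
  case (Suc l)
  interpret N: linear "newton_op A l" using assms by (rule linear_newton_op)
  show ?thesis unfolding Suc
    by (simp add: sigma_op_Suc newton_op_scale[OF assms] N.scale op_trace_scale)
qed simp

context smooth_convex_body
begin

definition DX :: "'a \<Rightarrow> 'a \<Rightarrow> 'a" where
  "DX y = frechet_derivative X (at y)"

definition D2X :: "'a \<Rightarrow> 'a \<Rightarrow> 'a \<Rightarrow> 'a" where
  "D2X y u v = frechet_derivative (\<lambda>z. DX z v) (at y) u"

lemma X_C2:
  assumes "y \<noteq> 0"
  shows has_derivative_X: "(X has_derivative DX y) (at y)"
    and has_derivative_DX: "((\<lambda>z. DX z v) has_derivative (\<lambda>u. D2X y u v)) (at y)"
    and isCont_D2X: "isCont (\<lambda>z. D2X z u v) y"
    and DX_nondegenerate: "DX y v = 0 \<Longrightarrow> y \<bullet> v = 0 \<Longrightarrow> v = 0"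
proof -
  obtain U \<phi> g H T where C: "is_chart U \<phi> g H T" and U: "X y \<in> U" by (rule exists_chart[OF X_in_M[OF assms]])
  obtain S A B where S: "open S" "y \<in> S" "0 \<notin> S"
    and A: "\<And>y. y \<in> S \<Longrightarrow> (X has_derivative A y) (at y)"
    and B: "\<And>y w. y \<in> S \<Longrightarrow> ((\<lambda>y. A y w) has_derivative (\<lambda>u. B y u w)) (at y)"
    and c: "\<And>y u w. y \<in> S \<Longrightarrow> isCont (\<lambda>y. B y u w) y"
    and nd: "\<And>y v. y \<in> S \<Longrightarrow> A y v = 0 \<Longrightarrow> y \<bullet> v = 0 \<Longrightarrow> v = 0"
    by (rule chart_X_C2[OF C assms U]) (rule that)
  have DA: "DX z = A z" if "z \<in> S" for z
    using frechet_derivative_at[OF A[OF that]] by (simp add: DX_def)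
  have dB: "((\<lambda>z. DX z v) has_derivative (\<lambda>u. B z u v)) (at z)" if "z \<in> S" for z v
    by (rule has_derivative_transform_within_open[OF B[OF that] S(1) that]) (simp add: DA)
  have DB: "D2X z u v = B z u v" if "z \<in> S" for z u v
    using frechet_derivative_at[OF dB[OF that, of v]] unfolding D2X_def by metis
  show "(X has_derivative DX y) (at y)" using A[OF S(2)] DA[OF S(2)] by simp
  show "((\<lambda>z. DX z v) has_derivative (\<lambda>u. D2X y u v)) (at y)" using dB[OF S(2)] DB[OF S(2)] by simp
  have ev: "\<forall>\<^sub>F z in nhds y. B z u v = D2X z u v"
    using eventually_nhds_in_open[OF S(1,2)] by eventually_elim (simp add: DB)
  then show "isCont (\<lambda>z. D2X z u v) y" using c[OF S(2), of u v] isCont_cong[OF ev] by simp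
  show "DX y v = 0 \<Longrightarrow> y \<bullet> v = 0 \<Longrightarrow> v = 0" using nd[OF S(2)] DA[OF S(2)] by simp
qed

lemma linear_DX: "y \<noteq> 0 \<Longrightarrow> linear (DX y)"
  using has_derivative_X has_derivative_linear by blast

text \<open>\<open>X y\<close> maximizes the product with \<open>y\<close> over \<open>K\<close>, so
  y . X z, as a function of z, is maximal at z = y and its derivative vanishes there.\<close>

lemma inner_DX_self:
  assumes "y \<noteq> 0"
  shows "y \<bullet> DX y v = 0"
proof -
  have "((\<lambda>z. y \<bullet> X z) has_derivative (\<lambda>v. y \<bullet> DX y v)) (at y)"
    using has_derivative_X[OF assms] by (rule has_derivative_inner_right)
  moreover have "\<forall>z\<in>UNIV. y \<bullet> X z \<le> y \<bullet> X y" using X by (auto simp: normal_at_def)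
  ultimately have "(\<lambda>v. y \<bullet> DX y v) = (\<lambda>v. 0)"
    by (intro differential_zero_maxmin[of y UNIV "\<lambda>z. y \<bullet> X z"]) auto
  then show ?thesis by metis
qed

text \<open>The support function, homogeneous of degree one; its gradient is \<open>X\<close>.\<close>
definition h :: "'a \<Rightarrow> real" where
  "h y = y \<bullet> X y"

lemma h_pos: "y \<noteq> 0 \<Longrightarrow> h y > 0"
  using normal_at_inner_pos X(2) by (simp add: h_def)

lemma has_derivative_h:
  assumes "y \<noteq> 0"
  shows "(h has_derivative (\<lambda>v. X y \<bullet> v)) (at y)"
proof -
  have "(h has_derivative (\<lambda>v. y \<bullet> DX y v + v \<bullet> X y)) (at y)"
    unfolding h_def[abs_def] by (intro has_derivative_inner has_derivative_ident has_derivative_X assms)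
  then show ?thesis using inner_DX_self[OF assms] by (simp add: inner_commute)
qed

lemma isCont_DX: "y \<noteq> 0 \<Longrightarrow> isCont (\<lambda>z. DX z v) y"
  using has_derivative_continuous[OF has_derivative_DX] by blast

lemma DX_symmetric:
  assumes "y \<noteq> 0"
  shows "DX y v \<bullet> w = v \<bullet> DX y w"
proof -
  have "DX y v \<bullet> w = DX y w \<bullet> v"
  proof (rule second_derivative_symmetric_real[where f=h and f'="\<lambda>y v. X y \<bullet> v" and f''="\<lambda>y w v. DX y w \<bullet> v" and S="- {0}"])
    show "((\<lambda>z. X z \<bullet> v) has_derivative (\<lambda>w. DX y w \<bullet> v)) (at y)" if "y \<in> - {0}" for y v
      using that by (intro has_derivative_inner_left has_derivative_X) auto
    show "isCont (\<lambda>y. DX y w \<bullet> v) y" for v w using isCont_DX[OF assms] by (intro continuous_intros)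
  qed (use assms has_derivative_h in auto)
  then show ?thesis by (simp add: inner_commute)
qed

text \<open>Euler's relation for a map of degree zero, obtained from symmetry: by
  \<open>inner_DX_self\<close> the vector is orthogonal to itself.\<close>

lemma DX_self:
  assumes "y \<noteq> 0"
  shows "DX y y = 0"
proof -
  have "DX y y \<bullet> DX y y = 0" using DX_symmetric[OF assms, of y] inner_DX_self[OF assms] by metis
  then show ?thesis by simp
qed

lemma D2X_symmetric:
  assumes "y \<noteq> 0"
  shows "D2X y u v = D2X y v u"
  by (rule second_derivative_symmetric[where f=X and f'=DX and f''=D2X and S="- {0}"])
    (use assms has_derivative_X has_derivative_DX isCont_D2X in auto)

lemma linear_D2X:
  assumes "y \<noteq> 0"
  shows "linear (D2X y u)"
proof -
  have "D2X y u = (\<lambda>v. D2X y v u)" using D2X_symmetric[OF assms] by auto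
  then show ?thesis using has_derivative_linear[OF has_derivative_DX[OF assms]] by simp
qed

text \<open>The derivative of the identity DX z z = 0; it is Euler's relation in degree -1.\<close>

lemma D2X_radial:
  assumes "y \<noteq> 0"
  shows "D2X y y v = - DX y v"
proof -
  have op: "open (- {0::'a})" by (simp add: open_Compl)
  have "((\<lambda>z. DX z z) has_derivative (\<lambda>w. D2X y w y + DX y w)) (at y)"
    by (rule has_derivative_linear_family[OF op _ _ has_derivative_DX has_derivative_ident])
      (use assms linear_DX in auto)
  moreover have "((\<lambda>z. DX z z) has_derivative (\<lambda>w. 0)) (at y)"
    by (rule has_derivative_transform_within_open[OF has_derivative_const op, of _ 0]) (use assms DX_self in auto)
  ultimately have "D2X y v y + DX y v = 0" using has_derivative_unique by metis
  then show ?thesis using D2X_symmetric[OF assms, of y v] by (simp add: add_eq_0_iff)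
qed

text \<open>Monotonicity of \<open>X\<close>: adding the support inequalities at y and at y + s v
  with s > 0 gives v . X y <= v . X(y + s v).\<close>

lemma DX_psd:
  assumes "y \<noteq> 0"
  shows "v \<bullet> DX y v \<ge> 0"
proof (rule ccontr)
  assume neg: "\<not> v \<bullet> DX y v \<ge> 0"
  have "(X has_derivative DX y) (at (y + 0 *\<^sub>R v))" using has_derivative_X[OF assms] by simp
  then have "((\<lambda>s. X (y + s *\<^sub>R v)) has_derivative (\<lambda>s. DX y (s *\<^sub>R v))) (at 0)"
    by (rule has_derivative_compose[rotated]) (auto intro!: derivative_eq_intros)
  then have "((\<lambda>s. v \<bullet> X (y + s *\<^sub>R v)) has_derivative (\<lambda>s. v \<bullet> DX y (s *\<^sub>R v))) (at 0)"
    by (rule has_derivative_inner_right)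
  then have "((\<lambda>s. v \<bullet> X (y + s *\<^sub>R v)) has_real_derivative (v \<bullet> DX y v)) (at 0)"
    using linear_scale[OF linear_DX[OF assms]] by (simp add: has_field_derivative_def mult_commute_abs)
  then obtain d where d: "d > 0" "\<And>s. 0 < s \<Longrightarrow> s < d \<Longrightarrow> v \<bullet> X (y + s *\<^sub>R v) < v \<bullet> X y"
    using DERIV_neg_dec_right[of "\<lambda>s. v \<bullet> X (y + s *\<^sub>R v)" "v \<bullet> DX y v" 0] neg by auto
  define s where "s = d / 2"
  have s: "0 < s" "s < d" using d by (auto simp: s_def)
  have "y \<bullet> X (y + s *\<^sub>R v) \<le> y \<bullet> X y" "(y + s *\<^sub>R v) \<bullet> X y \<le> (y + s *\<^sub>R v) \<bullet> X (y + s *\<^sub>R v)"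
    using X by (auto simp: normal_at_def)
  then have "s * (v \<bullet> X y) \<le> s * (v \<bullet> X (y + s *\<^sub>R v))" by (simp add: inner_add_left)
  then show False using d(2)[OF s] s by simp
qed

lemma DX_scale:
  assumes "y \<noteq> 0" "c > 0"
  shows "DX (c *\<^sub>R y) v = (1 / c) *\<^sub>R DX y v"
proof -
  have cy: "c *\<^sub>R y \<noteq> 0" using assms by simp
  have "((\<lambda>z. X (c *\<^sub>R z)) has_derivative (\<lambda>v. DX (c *\<^sub>R y) (c *\<^sub>R v))) (at y)"
    using has_derivative_X[OF cy] by (rule has_derivative_compose[rotated]) (auto intro!: derivative_eq_intros)
  moreover have "((\<lambda>z. X (c *\<^sub>R z)) has_derivative DX y) (at y)"
    by (rule has_derivative_transform_within_open[OF has_derivative_X[OF assms(1)], of "- {0}"])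
      (use assms X_scale in \<open>auto simp: open_Compl\<close>)
  ultimately have "DX (c *\<^sub>R y) (c *\<^sub>R v) = DX y v" using has_derivative_unique by metis
  then show ?thesis using assms linear_scale[OF linear_DX[OF cy]] by (metis divide_self_if inverse_eq_divide less_irrefl scaleR_one scaleR_scaleR left_inverse)
qed

lemma DX_eigenbasis:
  assumes "y \<noteq> 0"
  obtains B \<mu> where "finite B" "pairwise orthogonal B" "\<And>b. b \<in> B \<Longrightarrow> norm b = 1"
    "span B = tangent_space y" "card B = DIM('a) - 1" "\<And>b. b \<in> B \<Longrightarrow> DX y b = \<mu> b *\<^sub>R b"
    "\<And>b. b \<in> B \<Longrightarrow> \<mu> b > 0" "\<And>m. sigma_op (DX y) m = esym m \<mu> B"
    "\<And>m v. y \<bullet> v = 0 \<Longrightarrow> v \<bullet> newton_op (DX y) m v = (\<Sum>b\<in>B. (v \<bullet> b)\<^sup>2 * esym m \<mu> (B - {b}))"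
    "\<And>m v. y \<bullet> v = 0 \<Longrightarrow> DX y v \<bullet> newton_op (DX y) m v = (\<Sum>b\<in>B. (v \<bullet> b)\<^sup>2 * (\<mu> b * esym m \<mu> (B - {b})))"
  by (rule tangential_eigenbasis[OF linear_DX[OF assms] DX_symmetric[OF assms] assms DX_self[OF assms]
      DX_psd[OF assms] DX_nondegenerate[OF assms]]) (assumption | rule that)+

end

section \<open>Calculus on the sphere\<close>

lemma sphere_differential:
  fixes f :: "'a::euclidean_space \<Rightarrow> 'b::euclidean_space"
  assumes z: "z \<in> sphere 0 1" and v: "z \<bullet> v = 0" and f: "(f has_derivative D) (at z within sphere 0 1)"
  shows "differential (sphere 0 1) f z v = D v"
proof (rule differential_eq_on_tangent[where U=UNIV and \<phi>="\<lambda>x. x \<bullet> x - 1" and g="2 *\<^sub>R z"])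
  show "sphere 0 1 \<inter> UNIV = {y \<in> UNIV. y \<bullet> y - 1 = (0::real)}" by (auto simp: norm_eq_1)
  show "((\<lambda>x. x \<bullet> x - 1) has_derivative (\<lambda>v. (2 *\<^sub>R z) \<bullet> v)) (at z)"
    by (auto intro!: derivative_eq_intros simp: inner_commute)
qed (use z v f in \<open>auto intro!: continuous_intros\<close>)

lemma eigenvalues_on_cong:
  assumes "\<And>v. v \<in> V \<Longrightarrow> A v = B v"
  shows "eigenvalues_on V A = eigenvalues_on V B"
proof -
  have "{v \<in> V. A v = t *\<^sub>R v} = {v \<in> V. B v = t *\<^sub>R v}" for t using assms by auto
  then show ?thesis by (simp add: eigenvalues_on_def)
qed

context smooth_convex_body
begin

lemma support_function_eq_h: "support_function K y = h y"
  unfolding support_function_def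
proof (rule cSup_eq_maximum)
  show "h y \<in> (\<bullet>) y ` K" using X(1)[of y] by (auto simp: h_def)
qed (use X(2)[of y] in \<open>auto simp: normal_at_def h_def\<close>)

lemma sphere_grad_support_function:
  assumes z: "z \<in> sphere 0 1"
  shows "sphere_grad (support_function K) z = X z - h z *\<^sub>R z"
proof -
  have nz: "z \<noteq> 0" and zz: "z \<bullet> z = 1" using z by (auto simp: norm_eq_1)
  have "(support_function K has_derivative (\<lambda>v. X z \<bullet> v)) (at z within sphere 0 1)"
    using has_derivative_at_withinI[OF has_derivative_h[OF nz]]
    by (simp add: support_function_eq_h[abs_def])
  then have d: "differential (sphere 0 1) (support_function K) z v = X z \<bullet> v" if "v \<in> tangent_space z" for v
    using sphere_differential[OF z] that by (simp add: tangent_space_def)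
  let ?g = "X z - h z *\<^sub>R z"
  have T: "?g \<in> tangent_space z" using zz by (simp add: tangent_space_def h_def inner_diff_right)
  have g: "?g \<bullet> v = X z \<bullet> v" if "v \<in> tangent_space z" for v
    using that by (simp add: tangent_space_def inner_diff_left)
  show ?thesis
    unfolding sphere_grad_def
  proof (rule the_equality)
    show "?g \<in> tangent_space z \<and> (\<forall>v\<in>tangent_space z. ?g \<bullet> v = differential (sphere 0 1) (support_function K) z v)"
      using T g d by simp
    fix k assume k: "k \<in> tangent_space z \<and> (\<forall>v\<in>tangent_space z. k \<bullet> v = differential (sphere 0 1) (support_function K) z v)"
    have "k - ?g \<in> tangent_space z" using k T by (simp add: tangent_space_def inner_diff_right)
    then have "k \<bullet> (k - ?g) = ?g \<bullet> (k - ?g)" using k g d by simp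
    then have "(k - ?g) \<bullet> (k - ?g) = 0" by (simp add: inner_diff_left)
    then show "k = ?g" by simp
  qed
qed

lemma X_map_support_function:
  assumes "z \<in> sphere 0 1"
  shows "X_map (support_function K) z = X z"
  by (simp add: X_map_def sphere_grad_support_function[OF assms] support_function_eq_h)

text \<open>Along the sphere the gradient X - h z has derivative DX z v - h v up to a radial term,
  which the projection in the connection removes; adding u v leaves DX z v.\<close>

lemma W_support_function:
  assumes z: "z \<in> sphere 0 1" and v: "z \<bullet> v = 0"
  shows "W (support_function K) z v = DX z v"
proof -
  have nz: "z \<noteq> 0" and zz: "z \<bullet> z = 1" using z by (auto simp: norm_eq_1)
  have "((\<lambda>y. X y - h y *\<^sub>R y) has_derivative (\<lambda>v. DX z v - (h z *\<^sub>R v + (X z \<bullet> v) *\<^sub>R z))) (at z within sphere 0 1)"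
    by (rule has_derivative_diff[OF has_derivative_at_withinI[OF has_derivative_X[OF nz]]
        has_derivative_scaleR[OF has_derivative_at_withinI[OF has_derivative_h[OF nz]] has_derivative_ident]])
  then have "(sphere_grad (support_function K) has_derivative (\<lambda>v. DX z v - (h z *\<^sub>R v + (X z \<bullet> v) *\<^sub>R z))) (at z within sphere 0 1)"
    by (rule has_derivative_transform_within[OF _ zero_less_one z]) (simp add: sphere_grad_support_function)
  then have "differential (sphere 0 1) (sphere_grad (support_function K)) z v = DX z v - (h z *\<^sub>R v + (X z \<bullet> v) *\<^sub>R z)"
    by (rule sphere_differential[OF z v])
  then show ?thesis
    using v zz inner_DX_self[OF nz, of v]
    by (simp add: W_def sphere_hessian_def sphere_connection_def support_function_eq_h inner_diff_right inner_add_right)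
qed

lemma P_W_support_function:
  assumes z: "z \<in> sphere 0 1"
  shows "P_W k (support_function K) z = sigma_op (DX z) k / real (DIM('a) - 1 choose k)"
proof -
  have nz: "z \<noteq> 0" using z by auto
  obtain B \<mu> where B: "finite B" "pairwise orthogonal B" "\<And>b. b \<in> B \<Longrightarrow> norm b = 1"
    "span B = tangent_space z" "card B = DIM('a) - 1" "\<And>b. b \<in> B \<Longrightarrow> DX z b = \<mu> b *\<^sub>R b"
    "\<And>b. b \<in> B \<Longrightarrow> \<mu> b > 0" and sig: "\<And>m. sigma_op (DX z) m = esym m \<mu> B"
    and "\<And>m v. z \<bullet> v = 0 \<Longrightarrow> v \<bullet> newton_op (DX z) m v = (\<Sum>b\<in>B. (v \<bullet> b)\<^sup>2 * esym m \<mu> (B - {b}))"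
    "\<And>m v. z \<bullet> v = 0 \<Longrightarrow> DX z v \<bullet> newton_op (DX z) m v = (\<Sum>b\<in>B. (v \<bullet> b)\<^sup>2 * (\<mu> b * esym m \<mu> (B - {b})))"
    by (rule DX_eigenbasis[OF nz]) (rule that)
  have "eigenvalues_on (tangent_space z) (W (support_function K) z) = eigenvalues_on (tangent_space z) (DX z)"
    by (rule eigenvalues_on_cong) (use W_support_function[OF z] in \<open>simp add: tangent_space_def\<close>)
  then have "P_W k (support_function K) z = mean_esym k \<mu> B"
    unfolding P_W_def
    using normalized_esym_eq_mean_esym[OF B(1) mset_eigenvalues_on[OF linear_DX[OF nz] B(1-4,6)]] by simp
  then show ?thesis by (simp add: mean_esym_def sig B(5))
qed

end

section \<open>The tangential Newton fields\<close>

lemma has_derivative_newton_op: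
  assumes S: "open S" "y \<in> S" and lin: "\<And>z. z \<in> S \<Longrightarrow> linear (A z)" "\<And>w. linear (D w)"
    and der: "\<And>v. ((\<lambda>z. A z v) has_derivative (\<lambda>w. D w v)) (at y)"
  shows "((\<lambda>z. newton_op (A z) m v) has_derivative (\<lambda>w. newton_deriv (A y) (D w) m v)) (at y)"
proof (induction m arbitrary: v)
  case (Suc m)
  have g: "((\<lambda>z. newton_op (A z) m (A z v)) has_derivative
      (\<lambda>w. newton_deriv (A y) (D w) m (A y v) + newton_op (A y) m (D w v))) (at y)" for v
    by (rule has_derivative_linear_family[OF S _ Suc.IH der]) (simp add: linear_newton_op lin)
  have "((\<lambda>z. op_trace (\<lambda>x. newton_op (A z) m (A z x))) has_derivative
      (\<lambda>w. op_trace (\<lambda>x. newton_deriv (A y) (D w) m (A y x) + newton_op (A y) m (D w x)))) (at y)"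
    unfolding op_trace_def by (intro has_derivative_sum has_derivative_inner_right g)
  then have "((\<lambda>z. (op_trace (\<lambda>x. newton_op (A z) m (A z x)) * inverse (real (Suc m))) *\<^sub>R v
       - newton_op (A z) m (A z v)) has_derivative
      (\<lambda>w. (op_trace (\<lambda>x. newton_deriv (A y) (D w) m (A y x) + newton_op (A y) m (D w x)) * inverse (real (Suc m))) *\<^sub>R v
       - (newton_deriv (A y) (D w) m (A y v) + newton_op (A y) m (D w v)))) (at y)"
    by (intro has_derivative_diff has_derivative_scaleR_left has_derivative_mult_left g)
  then show ?case by (simp add: divide_inverse diff_diff_eq)
qed simp

text \<open>The variation of \<sigma>_m as tr(T_(m-1) D), the form to which
  \<open>op_trace_newton_deriv\<close> reduces it; \<sigma>_0 is constant.\<close>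

definition sigma_deriv :: "('a::euclidean_space \<Rightarrow> 'a) \<Rightarrow> ('a \<Rightarrow> 'a) \<Rightarrow> nat \<Rightarrow> real" where
  "sigma_deriv A D m = (case m of 0 \<Rightarrow> 0 | Suc l \<Rightarrow> op_trace (\<lambda>x. newton_op A l (D x)))"

lemma has_derivative_sigma_op:
  assumes S: "open S" "y \<in> S" and lin: "\<And>z. z \<in> S \<Longrightarrow> linear (A z)" "\<And>w. linear (D w)"
    and der: "\<And>v. ((\<lambda>z. A z v) has_derivative (\<lambda>w. D w v)) (at y)"
  shows "((\<lambda>z. sigma_op (A z) m) has_derivative (\<lambda>w. sigma_deriv (A y) (D w) m)) (at y)"
proof (cases m)
  case 0
  then show ?thesis by (simp add: sigma_deriv_def)
next
  case (Suc l)
  have g: "((\<lambda>z. newton_op (A z) l (A z v)) has_derivative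
      (\<lambda>w. newton_deriv (A y) (D w) l (A y v) + newton_op (A y) l (D w v))) (at y)" for v
    by (rule has_derivative_linear_family[OF S _ has_derivative_newton_op[OF S lin der] der])
      (simp add: linear_newton_op lin)
  have "((\<lambda>z. op_trace (\<lambda>x. newton_op (A z) l (A z x)) * inverse (real (Suc l))) has_derivative
      (\<lambda>w. op_trace (\<lambda>x. newton_deriv (A y) (D w) l (A y x) + newton_op (A y) l (D w x)) * inverse (real (Suc l)))) (at y)"
    unfolding op_trace_def by (intro has_derivative_mult_left has_derivative_sum has_derivative_inner_right g)
  moreover have "op_trace (\<lambda>x. newton_deriv (A y) (D w) l (A y x) + newton_op (A y) l (D w x)) * inverse (real (Suc l))
      = sigma_deriv (A y) (D w) m" for w
    using op_trace_newton_deriv[OF lin(1)[OF S(2)] lin(2), of w l]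
    by (simp add: Suc op_trace_add sigma_deriv_def field_simps)
  ultimately show ?thesis by (simp add: Suc sigma_op_Suc divide_inverse)
qed

lemma tendsto_newton_op:
  fixes A :: "'c \<Rightarrow> 'a::euclidean_space \<Rightarrow> 'a"
  assumes A: "\<And>v. ((\<lambda>z. A z v) \<longlongrightarrow> A0 v) F" and lin: "\<forall>\<^sub>F z in F. linear (A z)" "linear A0"
    and f: "(f \<longlongrightarrow> f0) F"
  shows "((\<lambda>z. newton_op (A z) m (f z)) \<longlongrightarrow> newton_op A0 m f0) F"
  using f
proof (induction m arbitrary: f f0)
  case (Suc m)
  have 1: "((\<lambda>z. newton_op (A z) m (A z (f z))) \<longlongrightarrow> newton_op A0 m (A0 f0)) F"
    by (rule Suc.IH[OF tendsto_linear_family[OF lin A Suc.prems]])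
  have "((\<lambda>z. op_trace (\<lambda>x. newton_op (A z) m (A z x))) \<longlongrightarrow> op_trace (\<lambda>x. newton_op A0 m (A0 x))) F"
    unfolding op_trace_def by (intro tendsto_sum tendsto_inner tendsto_const Suc.IH A)
  then show ?case unfolding newton_op.simps using 1 Suc.prems by (intro tendsto_intros) auto
qed simp

lemma tendsto_newton_deriv:
  fixes A D :: "'c \<Rightarrow> 'a::euclidean_space \<Rightarrow> 'a"
  assumes A: "\<And>v. ((\<lambda>z. A z v) \<longlongrightarrow> A0 v) F" and lin: "\<forall>\<^sub>F z in F. linear (A z)" "linear A0"
    and D: "\<And>v. ((\<lambda>z. D z v) \<longlongrightarrow> D0 v) F" and linD: "\<forall>\<^sub>F z in F. linear (D z)" "linear D0"
    and f: "(f \<longlongrightarrow> f0) F"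
  shows "((\<lambda>z. newton_deriv (A z) (D z) m (f z)) \<longlongrightarrow> newton_deriv A0 D0 m f0) F"
  using f
proof (induction m arbitrary: f f0)
  case (Suc m)
  have 1: "((\<lambda>z. newton_deriv (A z) (D z) m (A z (f z))) \<longlongrightarrow> newton_deriv A0 D0 m (A0 f0)) F"
    by (rule Suc.IH[OF tendsto_linear_family[OF lin A Suc.prems]])
  have 2: "((\<lambda>z. newton_op (A z) m (D z (f z))) \<longlongrightarrow> newton_op A0 m (D0 f0)) F"
    by (rule tendsto_newton_op[OF A lin tendsto_linear_family[OF linD D Suc.prems]])
  have "((\<lambda>z. op_trace (\<lambda>x. newton_deriv (A z) (D z) m (A z x) + newton_op (A z) m (D z x))) \<longlongrightarrow>
      op_trace (\<lambda>x. newton_deriv A0 D0 m (A0 x) + newton_op A0 m (D0 x))) F"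
    unfolding op_trace_def
    by (intro tendsto_sum tendsto_inner tendsto_add tendsto_const Suc.IH A tendsto_newton_op[OF A lin] D)
  then show ?case unfolding newton_deriv.simps using 1 2 Suc.prems by (intro tendsto_intros) auto
qed simp

context smooth_convex_body
begin

lemma punctured: "open (- {0::'a})"
  by (simp add: open_Compl)

lemma has_derivative_sigma_DX:
  assumes "y \<noteq> 0"
  shows "((\<lambda>z. sigma_op (DX z) m) has_derivative (\<lambda>w. sigma_deriv (DX y) (D2X y w) m)) (at y)"
  by (rule has_derivative_sigma_op[OF punctured, of y DX "D2X y"])
    (use assms linear_DX linear_D2X has_derivative_DX in auto)

text \<open>Euler's relation: \<sigma>_m of \<open>DX\<close> is homogeneous of degree -m.\<close>

lemma sigma_deriv_radial:
  assumes "y \<noteq> 0"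
  shows "sigma_deriv (DX y) (D2X y y) m = - real m * sigma_op (DX y) m"
proof (cases m)
  case (Suc l)
  interpret N: linear "newton_op (DX y) l" using linear_DX[OF assms] by (rule linear_newton_op)
  show ?thesis using D2X_radial[OF assms]
    by (simp add: Suc sigma_deriv_def sigma_op_Suc N.neg op_trace_uminus field_simps)
qed (simp add: sigma_deriv_def)

text \<open>
  The component of \<open>newton_op (DX y) m (X y)\<close> tangent to the spheres about the origin. On the
  unit sphere this is the Newton tensor of \<open>W\<close> applied to \<open>\<nabla>u\<close>.
\<close>
definition tfield :: "nat \<Rightarrow> 'a \<Rightarrow> 'a" where
  "tfield m y = newton_op (DX y) m (X y) - (sigma_op (DX y) m * h y / (y \<bullet> y)) *\<^sub>R y"

definition tfield_coeff :: "nat \<Rightarrow> 'a \<Rightarrow> 'a \<Rightarrow> real" where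
  "tfield_coeff m y v = (sigma_deriv (DX y) (D2X y v) m * h y + sigma_op (DX y) m * (X y \<bullet> v)) / (y \<bullet> y)
     - sigma_op (DX y) m * h y * (2 * (y \<bullet> v)) / (y \<bullet> y)\<^sup>2"

definition tfield_deriv :: "nat \<Rightarrow> 'a \<Rightarrow> 'a \<Rightarrow> 'a" where
  "tfield_deriv m y v = newton_deriv (DX y) (D2X y v) m (X y) + newton_op (DX y) m (DX y v)
     - (tfield_coeff m y v *\<^sub>R y + (sigma_op (DX y) m * h y / (y \<bullet> y)) *\<^sub>R v)"

lemma tfield_coeff:
  assumes "y \<noteq> 0"
  shows "((\<lambda>z. sigma_op (DX z) m * h z / (z \<bullet> z)) has_derivative tfield_coeff m y) (at y)"
proof -
  note * = has_derivative_sigma_DX[OF assms, of m] has_derivative_h[OF assms]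
  have "((\<lambda>z. sigma_op (DX z) m * h z / (z \<bullet> z)) has_derivative
    (\<lambda>v. - (sigma_op (DX y) m * h y) * (inverse (y \<bullet> y) * (y \<bullet> v + v \<bullet> y) * inverse (y \<bullet> y)) +
      (sigma_op (DX y) m * (X y \<bullet> v) + sigma_deriv (DX y) (D2X y v) m * h y) / (y \<bullet> y))) (at y)"
    by (intro has_derivative_divide has_derivative_mult has_derivative_inner has_derivative_ident *) (use assms in auto)
  moreover have "- (sigma_op (DX y) m * h y) * (inverse (y \<bullet> y) * (y \<bullet> v + v \<bullet> y) * inverse (y \<bullet> y)) +
      (sigma_op (DX y) m * (X y \<bullet> v) + sigma_deriv (DX y) (D2X y v) m * h y) / (y \<bullet> y) = tfield_coeff m y v" for v
    by (simp add: tfield_coeff_def divide_inverse power2_eq_square inner_commute algebra_simps)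
  ultimately show ?thesis by simp
qed

lemma has_derivative_tfield:
  assumes "y \<noteq> 0"
  shows "(tfield m has_derivative tfield_deriv m y) (at y)"
proof -
  have 1: "((\<lambda>z. newton_op (DX z) m (X z)) has_derivative
      (\<lambda>v. newton_deriv (DX y) (D2X y v) m (X y) + newton_op (DX y) m (DX y v))) (at y)"
  proof (rule has_derivative_linear_family[OF punctured _ _ _ has_derivative_X[OF assms]])
    show "((\<lambda>z. newton_op (DX z) m v) has_derivative (\<lambda>w. newton_deriv (DX y) (D2X y w) m v)) (at y)" for v
      by (rule has_derivative_newton_op[OF punctured]) (use assms linear_DX linear_D2X has_derivative_DX in auto)
    show "y \<in> - {0}" using assms by simp
    show "linear (newton_op (DX z) m)" if "z \<in> - {0}" for z
      using that by (intro linear_newton_op linear_DX) simp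
  qed
  have "(tfield m has_derivative (\<lambda>v. newton_deriv (DX y) (D2X y v) m (X y) + newton_op (DX y) m (DX y v)
     - ((sigma_op (DX y) m * h y / (y \<bullet> y)) *\<^sub>R v + tfield_coeff m y v *\<^sub>R y))) (at y)"
    unfolding tfield_def[abs_def]
    by (rule has_derivative_diff[OF 1 has_derivative_scaleR[OF tfield_coeff[OF assms] has_derivative_ident]])
  then show ?thesis by (simp add: tfield_deriv_def[abs_def] add.commute)
qed

lemma isCont_tfield_deriv:
  assumes "y \<noteq> 0"
  shows "isCont (\<lambda>z. tfield_deriv m z v) y"
proof -
  have ev: "\<forall>\<^sub>F z in at y. z \<in> - {0}" using eventually_at_in_open'[OF punctured] assms by simp
  have lin: "\<forall>\<^sub>F z in at y. linear (DX z)" "\<forall>\<^sub>F z in at y. linear (D2X z w)" for w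
    using ev by (auto elim!: eventually_mono intro: linear_DX linear_D2X)
  have DX: "((\<lambda>z. DX z w) \<longlongrightarrow> DX y w) (at y)" for w using isCont_DX[OF assms] by (simp add: isCont_def)
  have D2X: "((\<lambda>z. D2X z u w) \<longlongrightarrow> D2X y u w) (at y)" for u w using isCont_D2X[OF assms] by (simp add: isCont_def)
  have X: "(X \<longlongrightarrow> X y) (at y)" using isCont_X[OF assms] by (simp add: isCont_def)
  have h: "(h \<longlongrightarrow> h y) (at y)" using has_derivative_continuous[OF has_derivative_h[OF assms]] by (simp add: isCont_def)
  have s: "((\<lambda>z. sigma_op (DX z) m) \<longlongrightarrow> sigma_op (DX y) m) (at y)"
    using has_derivative_continuous[OF has_derivative_sigma_DX[OF assms]] by (simp add: isCont_def)
  have s': "((\<lambda>z. sigma_deriv (DX z) (D2X z v) m) \<longlongrightarrow> sigma_deriv (DX y) (D2X y v) m) (at y)"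
  proof (cases m)
    case (Suc l)
    have "((\<lambda>z. op_trace (\<lambda>x. newton_op (DX z) l (D2X z v x))) \<longlongrightarrow> op_trace (\<lambda>x. newton_op (DX y) l (D2X y v x))) (at y)"
      unfolding op_trace_def
      by (intro tendsto_sum tendsto_inner tendsto_const tendsto_newton_op[OF DX lin(1) linear_DX[OF assms]] D2X)
    then show ?thesis by (simp add: sigma_deriv_def Suc)
  qed (simp add: sigma_deriv_def)
  have n: "((\<lambda>z. newton_deriv (DX z) (D2X z v) m (X z)) \<longlongrightarrow> newton_deriv (DX y) (D2X y v) m (X y)) (at y)"
    by (rule tendsto_newton_deriv[OF DX lin(1) linear_DX[OF assms] D2X lin(2) linear_D2X[OF assms] X])
  have n': "((\<lambda>z. newton_op (DX z) m (DX z v)) \<longlongrightarrow> newton_op (DX y) m (DX y v)) (at y)"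
    by (rule tendsto_newton_op[OF DX lin(1) linear_DX[OF assms] DX])
  show ?thesis
    unfolding isCont_def tfield_deriv_def tfield_coeff_def
    using n n' s s' h X assms by (intro tendsto_intros) auto
qed

text \<open>As T_m is divergence free, the first part of the field contributes tr(T_m DX). The
  subtracted field q y, with q = \<sigma>_m h / |y|^2 of degree -(m + 1), has divergence (N - m - 1)
  q in dimension N by Euler's relation.\<close>

lemma divergence_tfield:
  assumes "y \<noteq> 0"
  shows "op_trace (tfield_deriv m y) =
    real (Suc m) * sigma_op (DX y) (Suc m) - (real DIM('a) - 1 - real m) * sigma_op (DX y) m * h y / (y \<bullet> y)"
proof -
  define q where "q = sigma_op (DX y) m * h y / (y \<bullet> y)"
  interpret c: linear "tfield_coeff m y" using tfield_coeff[OF assms] has_derivative_linear by blast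
  have 1: "(\<Sum>b\<in>Basis. b \<bullet> newton_deriv (DX y) (D2X y b) m (X y)) = 0"
    by (intro divergence_newton_deriv linear_DX DX_symmetric linear_D2X D2X_symmetric assms)
  have 2: "(\<Sum>b\<in>Basis. b \<bullet> newton_op (DX y) m (DX y b)) = real (Suc m) * sigma_op (DX y) (Suc m)"
    by (simp add: sigma_op_Suc op_trace_def)
  have "(\<Sum>b\<in>Basis. tfield_coeff m y b * (b \<bullet> y)) = tfield_coeff m y (\<Sum>b\<in>Basis. (y \<bullet> b) *\<^sub>R b)"
    by (simp add: c.sum c.scale inner_commute mult.commute)
  also have "\<dots> = tfield_coeff m y y" by (simp add: euclidean_representation)
  also have "\<dots> = - (real m + 1) * q"
    using assms by (simp add: q_def tfield_coeff_def sigma_deriv_radial h_def inner_commute power2_eq_square field_simps)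
  finally have 3: "(\<Sum>b\<in>Basis. tfield_coeff m y b * (b \<bullet> y)) = - (real m + 1) * q" .
  have 4: "(\<Sum>b\<in>(Basis::'a set). q * (b \<bullet> b)) = real DIM('a) * q" by (simp add: inner_Basis)
  have "op_trace (tfield_deriv m y) =
      (\<Sum>b\<in>Basis. b \<bullet> newton_deriv (DX y) (D2X y b) m (X y)) + (\<Sum>b\<in>Basis. b \<bullet> newton_op (DX y) m (DX y b))
      - ((\<Sum>b\<in>Basis. tfield_coeff m y b * (b \<bullet> y)) + (\<Sum>b\<in>(Basis::'a set). q * (b \<bullet> b)))"
    by (simp only: op_trace_def tfield_deriv_def q_def inner_add_right inner_diff_right inner_scaleR_right sum.distrib sum_subtractf)
  moreover have "(real DIM('a) - 1 - real m) * sigma_op (DX y) m * h y / (y \<bullet> y) = (real DIM('a) - 1 - real m) * q"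
    by (simp add: q_def)
  ultimately show ?thesis unfolding 1 2 3 4 by (simp add: left_diff_distrib distrib_right)
qed

lemma tfield_tangential:
  assumes "y \<noteq> 0"
  shows "y \<bullet> tfield m y = 0"
proof -
  have "y \<bullet> newton_op (DX y) m (X y) = newton_op (DX y) m y \<bullet> X y"
    by (rule newton_op_symmetric[symmetric]) (use assms linear_DX DX_symmetric in auto)
  also have "\<dots> = sigma_op (DX y) m * h y"
    using newton_op_kernel[OF linear_DX[OF assms] DX_self[OF assms]] by (simp add: h_def)
  finally show ?thesis using assms by (simp add: tfield_def inner_diff_right)
qed

text \<open>The radial direction is an eigenvector of T_m, so T_m commutes with the tangential
  projection. On the unit sphere \<open>tfield 0\<close> is the gradient of the support
  function.\<close>

lemma tfield_eq:
  assumes "y \<noteq> 0"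
  shows "tfield m y = newton_op (DX y) m (tfield 0 y)"
proof -
  interpret N: linear "newton_op (DX y) m" using linear_DX[OF assms] by (rule linear_newton_op)
  have "newton_op (DX y) m (tfield 0 y) = newton_op (DX y) m (X y) - (h y / (y \<bullet> y)) *\<^sub>R newton_op (DX y) m y"
    by (simp add: tfield_def N.diff N.scale)
  then show ?thesis
    by (simp add: tfield_def newton_op_kernel[OF linear_DX[OF assms] DX_self[OF assms]] mult.commute)
qed

lemma X_eq_tfield: "X y = tfield 0 y + (h y / (y \<bullet> y)) *\<^sub>R y"
  by (simp add: tfield_def)

text \<open>With t = \<open>tfield 0 y\<close>, the quantities are the pairings of t and of DX t
  with T_m t. In a tangential eigenbasis they are sums of squares with weights \<sigma>_m of the
  other eigenvalues, in the second case also times \<mu> b. Strictness needs m < n, because only n -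
  1 eigenvalues remain after removing one.\<close>

lemma inner_X_tfield:
  assumes "y \<noteq> 0"
  shows "X y \<bullet> tfield m y \<ge> 0"
    and "X y \<bullet> DX y (tfield m y) \<ge> 0"
    and "tfield 0 y \<noteq> 0 \<Longrightarrow> m < DIM('a) - 1 \<Longrightarrow> X y \<bullet> DX y (tfield m y) > 0"
proof -
  let ?t = "tfield 0 y"
  obtain B \<mu> where B: "finite B" "pairwise orthogonal B" "\<And>b. b \<in> B \<Longrightarrow> norm b = 1"
    "span B = tangent_space y" "card B = DIM('a) - 1" "\<And>b. b \<in> B \<Longrightarrow> DX y b = \<mu> b *\<^sub>R b"
    "\<And>b. b \<in> B \<Longrightarrow> \<mu> b > 0" "\<And>m. sigma_op (DX y) m = esym m \<mu> B"
    and q1: "\<And>m v. y \<bullet> v = 0 \<Longrightarrow> v \<bullet> newton_op (DX y) m v = (\<Sum>b\<in>B. (v \<bullet> b)\<^sup>2 * esym m \<mu> (B - {b}))"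
    and q2: "\<And>m v. y \<bullet> v = 0 \<Longrightarrow> DX y v \<bullet> newton_op (DX y) m v = (\<Sum>b\<in>B. (v \<bullet> b)\<^sup>2 * (\<mu> b * esym m \<mu> (B - {b})))"
    by (rule DX_eigenbasis[OF assms]) (rule that)
  have t: "y \<bullet> ?t = 0" by (rule tfield_tangential[OF assms])
  have nn: "esym m \<mu> (B - {b}) \<ge> 0" for b
    unfolding esym_def using B(7) by (intro sum_nonneg prod_nonneg) (auto intro: less_imp_le)
  have "X y \<bullet> tfield m y = ?t \<bullet> tfield m y"
    using tfield_tangential[OF assms, of m] by (subst X_eq_tfield) (simp add: inner_add_left)
  also have "\<dots> = (\<Sum>b\<in>B. (?t \<bullet> b)\<^sup>2 * esym m \<mu> (B - {b}))"
    by (subst tfield_eq[OF assms]) (rule q1[OF t])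
  also have "\<dots> \<ge> 0" using nn by (intro sum_nonneg mult_nonneg_nonneg) auto
  finally show "X y \<bullet> tfield m y \<ge> 0" .
  have "X y \<bullet> DX y (tfield m y) = DX y (X y) \<bullet> tfield m y" by (rule DX_symmetric[OF assms, symmetric])
  also have "DX y (X y) = DX y ?t"
    using linear_add[OF linear_DX[OF assms]] linear_scale[OF linear_DX[OF assms]]
    by (subst X_eq_tfield) (simp add: DX_self[OF assms])
  also have "DX y ?t \<bullet> tfield m y = (\<Sum>b\<in>B. (?t \<bullet> b)\<^sup>2 * (\<mu> b * esym m \<mu> (B - {b})))"
    by (subst (2) tfield_eq[OF assms]) (rule q2[OF t])
  finally have eq: "X y \<bullet> DX y (tfield m y) = (\<Sum>b\<in>B. (?t \<bullet> b)\<^sup>2 * (\<mu> b * esym m \<mu> (B - {b})))" .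
  have nn': "(?t \<bullet> b)\<^sup>2 * (\<mu> b * esym m \<mu> (B - {b})) \<ge> 0" if "b \<in> B" for b
    using nn[of b] B(7)[OF that] by (intro mult_nonneg_nonneg) auto
  then show "X y \<bullet> DX y (tfield m y) \<ge> 0" unfolding eq by (rule sum_nonneg)
  show "X y \<bullet> DX y (tfield m y) > 0" if nz: "?t \<noteq> 0" and m: "m < DIM('a) - 1"
    unfolding eq
  proof -
    have pos: "esym m \<mu> (B - {b}) > 0" if "b \<in> B" for b
      using B(1,5,7) m that by (intro esym_pos) auto
    have "(\<Sum>b\<in>B. (?t \<bullet> b) *\<^sub>R b) = ?t"
      using orthonormal_basis_expand[OF B(2,3) _ B(1), of ?t] t B(4) by (simp add: tangent_space_def)
    then have "\<exists>b\<in>B. ?t \<bullet> b \<noteq> 0" using nz by (metis (mono_tags, lifting) scale_eq_0_iff sum.neutral)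
    then obtain b where b: "b \<in> B" "?t \<bullet> b \<noteq> 0" by blast
    show "(\<Sum>b\<in>B. (?t \<bullet> b)\<^sup>2 * (\<mu> b * esym m \<mu> (B - {b}))) > 0"
    proof (rule sum_pos2[OF B(1) b(1)])
      show "(?t \<bullet> b)\<^sup>2 * (\<mu> b * esym m \<mu> (B - {b})) > 0"
        using b pos[OF b(1)] B(7)[OF b(1)] by (intro mult_pos_pos) auto
      show "(?t \<bullet> i)\<^sup>2 * (\<mu> i * esym m \<mu> (B - {i})) \<ge> 0" if "i \<in> B" for i
        by (rule nn'[OF that])
    qed
  qed
qed

end

section \<open>Rigidity\<close>

context smooth_convex_body
begin

text \<open>
  The logarithm of \<open>|y|\<^sup>j Q\<^sup>-\<^sup>\<alpha>\<close>, where \<open>Q\<close> is the extension of \<open>u\<^sup>p\<^sup>-\<^sup>1 exp (r\<^sup>2 / 2)\<close> that is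
  homogeneous of degree zero.
\<close>
definition weight_exponent :: "real \<Rightarrow> real \<Rightarrow> real \<Rightarrow> 'a \<Rightarrow> real" where
  "weight_exponent j \<alpha> p y =
     j * (ln (y \<bullet> y) / 2) - \<alpha> * ((p - 1) * (ln (h y) - ln (y \<bullet> y) / 2) + (X y \<bullet> X y) / 2)"

definition weight_exponent_deriv :: "real \<Rightarrow> real \<Rightarrow> real \<Rightarrow> 'a \<Rightarrow> 'a \<Rightarrow> real" where
  "weight_exponent_deriv j \<alpha> p y v = j * ((y \<bullet> v) / (y \<bullet> y))
     - \<alpha> * ((p - 1) * ((X y \<bullet> v) / h y - (y \<bullet> v) / (y \<bullet> y)) + X y \<bullet> DX y v)"

lemma has_derivative_weight_exponent:
  assumes "y \<noteq> 0"
  shows "(weight_exponent j \<alpha> p has_derivative weight_exponent_deriv j \<alpha> p y) (at y)"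
proof -
  have yy: "y \<bullet> y > 0" using assms by simp
  have l1: "((\<lambda>y. ln (y \<bullet> y) / 2) has_derivative (\<lambda>v. (y \<bullet> v) / (y \<bullet> y))) (at y)"
    using yy by (auto intro!: derivative_eq_intros simp: inner_commute field_simps)
  have l2: "((\<lambda>y. ln (h y)) has_derivative (\<lambda>v. (X y \<bullet> v) / h y)) (at y)"
    using has_derivative_ln[OF h_pos[OF assms] has_derivative_h[OF assms]] by (simp add: divide_inverse)
  have l3: "((\<lambda>y. (X y \<bullet> X y) / 2) has_derivative (\<lambda>v. X y \<bullet> DX y v)) (at y)"
    using has_derivative_mult_right[OF has_derivative_inner[OF has_derivative_X[OF assms] has_derivative_X[OF assms]], of "1 / 2"]
    by (simp add: inner_commute[of "DX y _"])
  show ?thesis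
    unfolding weight_exponent_def[abs_def] weight_exponent_deriv_def[abs_def]
    by (intro has_derivative_diff has_derivative_add has_derivative_mult_right l1 l2 l3)
qed

lemma isCont_weight_exponent_deriv:
  assumes "y \<noteq> 0"
  shows "isCont (\<lambda>z. weight_exponent_deriv j \<alpha> p z v) y"
  unfolding weight_exponent_deriv_def
  using assms isCont_X[OF assms] isCont_DX[OF assms, of v] h_pos[OF assms]
    has_derivative_continuous[OF has_derivative_h[OF assms]]
  by (intro continuous_intros) auto

text \<open>On a tangential field the powers of |y| contribute nothing. The derivatives of ln h and
  of |X|^2 / 2 have the same sign for p >= 1, and the latter gives strictness.\<close>

lemma weight_exponent_deriv_tfield:
  assumes y: "y \<noteq> 0" and p: "p \<ge> 1" and \<alpha>: "\<alpha> > 0"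
  shows "weight_exponent_deriv j 0 p y (tfield m y) = 0"
    and "weight_exponent_deriv j \<alpha> p y (tfield m y) \<le> 0"
    and "tfield 0 y \<noteq> 0 \<Longrightarrow> m < DIM('a) - 1 \<Longrightarrow> weight_exponent_deriv j \<alpha> p y (tfield m y) < 0"
proof -
  have t: "y \<bullet> tfield m y = 0" by (rule tfield_tangential[OF y])
  then show "weight_exponent_deriv j 0 p y (tfield m y) = 0" by (simp add: weight_exponent_deriv_def)
  have 1: "(p - 1) * ((X y \<bullet> tfield m y) / h y) \<ge> 0"
    using p inner_X_tfield(1)[OF y, of m] h_pos[OF y] by simp
  have eq: "weight_exponent_deriv j \<alpha> p y (tfield m y) =
      - (\<alpha> * ((p - 1) * ((X y \<bullet> tfield m y) / h y) + X y \<bullet> DX y (tfield m y)))"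
    using t by (simp add: weight_exponent_deriv_def)
  have "0 \<le> (p - 1) * ((X y \<bullet> tfield m y) / h y) + X y \<bullet> DX y (tfield m y)"
    using 1 inner_X_tfield(2)[OF y, of m] by linarith
  then show "weight_exponent_deriv j \<alpha> p y (tfield m y) \<le> 0" using \<alpha> unfolding eq by simp
  assume "tfield 0 y \<noteq> 0" "m < DIM('a) - 1"
  then have "X y \<bullet> DX y (tfield m y) > 0" by (rule inner_X_tfield(3)[OF y])
  then have "0 < (p - 1) * ((X y \<bullet> tfield m y) / h y) + X y \<bullet> DX y (tfield m y)" using 1 by linarith
  then show "weight_exponent_deriv j \<alpha> p y (tfield m y) < 0" using \<alpha> unfolding eq by simp
qed

lemma weighted_tfield:
  fixes m :: nat and j \<alpha> p :: real
  assumes y: "y \<noteq> 0"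
  defines "g \<equiv> \<lambda>y. exp (weight_exponent j \<alpha> p y)"
  shows "((\<lambda>y. g y *\<^sub>R tfield m y) has_derivative
      (\<lambda>v. g y *\<^sub>R tfield_deriv m y v + (g y * weight_exponent_deriv j \<alpha> p y v) *\<^sub>R tfield m y)) (at y)"
    and "isCont (\<lambda>y. g y *\<^sub>R tfield_deriv m y v + (g y * weight_exponent_deriv j \<alpha> p y v) *\<^sub>R tfield m y) y"
    and "op_trace (\<lambda>v. g y *\<^sub>R tfield_deriv m y v + (g y * weight_exponent_deriv j \<alpha> p y v) *\<^sub>R tfield m y) =
      g y * (op_trace (tfield_deriv m y) + weight_exponent_deriv j \<alpha> p y (tfield m y))"
proof -
  have g: "(g has_derivative (\<lambda>v. g y * weight_exponent_deriv j \<alpha> p y v)) (at y)"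
    unfolding g_def using has_derivative_exp[OF has_derivative_weight_exponent[OF y]] by (simp add: mult.commute)
  show "((\<lambda>y. g y *\<^sub>R tfield m y) has_derivative
      (\<lambda>v. g y *\<^sub>R tfield_deriv m y v + (g y * weight_exponent_deriv j \<alpha> p y v) *\<^sub>R tfield m y)) (at y)"
    by (rule has_derivative_scaleR[OF g has_derivative_tfield[OF y]])
  show "isCont (\<lambda>y. g y *\<^sub>R tfield_deriv m y v + (g y * weight_exponent_deriv j \<alpha> p y v) *\<^sub>R tfield m y) y"
    using has_derivative_continuous[OF g] has_derivative_continuous[OF has_derivative_tfield[OF y]]
      isCont_tfield_deriv[OF y] isCont_weight_exponent_deriv[OF y]
    by (intro continuous_intros)
  interpret E: linear "weight_exponent_deriv j \<alpha> p y"
    using has_derivative_weight_exponent[OF y] has_derivative_linear by blast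
  let ?t = "tfield m y"
  have "(\<Sum>b\<in>Basis. weight_exponent_deriv j \<alpha> p y b * (b \<bullet> ?t)) = weight_exponent_deriv j \<alpha> p y (\<Sum>b\<in>Basis. (?t \<bullet> b) *\<^sub>R b)"
    by (simp add: E.sum E.scale inner_commute mult.commute)
  then have "(\<Sum>b\<in>Basis. weight_exponent_deriv j \<alpha> p y b * (b \<bullet> ?t)) = weight_exponent_deriv j \<alpha> p y ?t"
    by (simp add: euclidean_representation)
  then show "op_trace (\<lambda>v. g y *\<^sub>R tfield_deriv m y v + (g y * weight_exponent_deriv j \<alpha> p y v) *\<^sub>R tfield m y) =
      g y * (op_trace (tfield_deriv m y) + weight_exponent_deriv j \<alpha> p y (tfield m y))"
    by (simp add: op_trace_def inner_add_right sum.distrib sum_distrib_left[symmetric] distrib_left mult.assoc)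
qed

lemma h_scale: "c > 0 \<Longrightarrow> y \<noteq> 0 \<Longrightarrow> h (c *\<^sub>R y) = c * h y"
  by (simp add: h_def X_scale)

lemma sigma_DX_scale:
  assumes "c > 0" "y \<noteq> 0"
  shows "sigma_op (DX (c *\<^sub>R y)) m = (1 / c) ^ m * sigma_op (DX y) m"
proof -
  have "DX (c *\<^sub>R y) = (\<lambda>v. (1 / c) *\<^sub>R DX y v)" using DX_scale[OF assms(2,1)] by auto
  then show ?thesis using sigma_op_scale[OF linear_DX[OF assms(2)], of "1 / c" m] by simp
qed

lemma weight_exponent_scale:
  assumes "c > 0" "z \<in> sphere 0 1"
  shows "weight_exponent j \<alpha> p (c *\<^sub>R z) = j * ln c - \<alpha> * ((p - 1) * ln (h z) + (X z \<bullet> X z) / 2)"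
proof -
  have z: "z \<noteq> 0" "z \<bullet> z = 1" using assms(2) by (auto simp: norm_eq_1)
  have l: "ln ((c *\<^sub>R z) \<bullet> (c *\<^sub>R z)) / 2 = ln c" using assms(1) z by (simp add: ln_mult)
  have l2: "ln (h (c *\<^sub>R z)) = ln c + ln (h z)" using assms(1) z h_pos[OF z(1)] by (simp add: h_scale ln_mult)
  show ?thesis unfolding weight_exponent_def l l2 X_scale[OF assms(1) z(1)] by simp
qed

text \<open>The degree -(m + 1) found here dictates the power m + 1 of |y| in the weight.\<close>

lemma divergence_tfield_scale:
  assumes "c > 0" "z \<in> sphere 0 1"
  shows "op_trace (tfield_deriv m (c *\<^sub>R z)) = (1 / c) ^ Suc m *
    (real (Suc m) * sigma_op (DX z) (Suc m) - (real DIM('a) - 1 - real m) * sigma_op (DX z) m * h z)"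
proof -
  have z: "z \<noteq> 0" "z \<bullet> z = 1" "c *\<^sub>R z \<noteq> 0" using assms by (auto simp: norm_eq_1)
  show ?thesis
    unfolding divergence_tfield[OF z(3)] sigma_DX_scale[OF assms(1) z(1)] h_scale[OF assms(1) z(1)]
    using assms(1) z(2) by (simp add: field_simps)
qed

lemma isotropic_rigidity:
  fixes k n :: nat and p :: real
  assumes n: "DIM('a) = n + 1" "2 \<le> n" and k: "1 \<le> k" "k \<le> n" and p: "p \<ge> 1"
    and eqn: "\<And>z. z \<in> sphere 0 1 \<Longrightarrow>
      sigma_op (DX z) k / real (n choose k) = exp ((p - 1) * ln (h z) + (X z \<bullet> X z) / 2)"
    and y: "y \<noteq> 0"
  shows "X y = (h y / (y \<bullet> y)) *\<^sub>R y"
proof -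
  define m where "m = (if k = 1 then 1 else k - 1)"
  define \<alpha> where "\<alpha> = (if k = 1 then 1 else 1 - 1 / real k)"
  \<comment> \<open>The common coefficient (n - m) binom(n, m) = (m + 1) binom(n, m + 1): on the
    unit sphere the m-th field has divergence c (P_(m+1) - u P_m).\<close>
  define c where "c = (real n - real m) * real (n choose m)"
  have m: "m < n" using n k by (auto simp: m_def)
  have \<alpha>: "\<alpha> > 0" using k by (auto simp: \<alpha>_def)
  have cm: "real (Suc m) * real (n choose Suc m) = c"
  proof -
    have "Suc m * (n choose Suc m) = (n - m) * (n choose m)"
      by (metis binomial_absorb_comp binomial_absorption mult.commute)
    then have "real (Suc m * (n choose Suc m)) = real ((n - m) * (n choose m))" by (rule arg_cong)
    then show ?thesis using m by (simp add: c_def of_nat_diff distrib_right)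
  qed
  have c: "c > 0" using m by (simp add: c_def)
  define g1 where "g1 = (\<lambda>y. exp (weight_exponent 1 0 p y))"
  define g2 where "g2 = (\<lambda>y. exp (weight_exponent (real (Suc m)) \<alpha> p y))"
  define D1 where "D1 = (\<lambda>y v. g1 y *\<^sub>R tfield_deriv 0 y v + (g1 y * weight_exponent_deriv 1 0 p y v) *\<^sub>R tfield 0 y)"
  define D2 where "D2 = (\<lambda>y v. g2 y *\<^sub>R tfield_deriv m y v + (g2 y * weight_exponent_deriv (real (Suc m)) \<alpha> p y v) *\<^sub>R tfield m y)"
  \<comment> \<open>The field with m = 0 has divergence n (P_1 - u) on the unit sphere, so the
    factor c/n brings both divergences to the same scale.\<close>
  define V where "V y = (c / real n) *\<^sub>R (g1 y *\<^sub>R tfield 0 y) - g2 y *\<^sub>R tfield m y" for y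
  define V' where "V' y v = (c / real n) *\<^sub>R D1 y v - D2 y v" for y v
  have der: "(V has_derivative V' y) (at y)" if "y \<noteq> 0" for y
    unfolding V_def[abs_def] V'_def[abs_def] D1_def D2_def g1_def g2_def
    by (intro has_derivative_diff has_derivative_scaleR_right weighted_tfield(1)[OF that])
  have cont: "isCont (\<lambda>y. V' y v) y" if "y \<noteq> 0" for y v
    unfolding V'_def D1_def D2_def g1_def g2_def
    by (intro continuous_diff continuous_scaleR continuous_const weighted_tfield(2)[OF that])
  have tang: "y \<bullet> V y = 0" if "y \<noteq> 0" for y
    by (simp add: V_def inner_diff_right tfield_tangential[OF that])
  have div: "op_trace (V' y) = (c / real n) * (g1 y * op_trace (tfield_deriv 0 y))
      - g2 y * (op_trace (tfield_deriv m y) + weight_exponent_deriv (real (Suc m)) \<alpha> p y (tfield m y))"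
    if "y \<noteq> 0" for y
  proof -
    have "op_trace (V' y) = (c / real n) * op_trace (D1 y) - op_trace (D2 y)"
      unfolding V'_def by (simp only: op_trace_diff op_trace_scale)
    also have "op_trace (D1 y) = g1 y * (op_trace (tfield_deriv 0 y) + weight_exponent_deriv 1 0 p y (tfield 0 y))"
      unfolding D1_def g1_def by (rule weighted_tfield(3)[OF that])
    also have "weight_exponent_deriv 1 0 p y (tfield 0 y) = 0"
      by (rule weight_exponent_deriv_tfield(1)[OF that p \<alpha>])
    also have "op_trace (D2 y) = g2 y * (op_trace (tfield_deriv m y) + weight_exponent_deriv (real (Suc m)) \<alpha> p y (tfield m y))"
      unfolding D2_def g2_def by (rule weighted_tfield(3)[OF that])
    finally show ?thesis by simp
  qed
  \<comment> \<open>The products of weights and unweighted divergences are constant along rays, so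
    the comparison takes place at z = y/|y|, where it is \<open>esym_inequality\<close> times
    c.\<close>
  have main: "g2 y * op_trace (tfield_deriv m y) \<le> (c / real n) * (g1 y * op_trace (tfield_deriv 0 y))"
    if "y \<noteq> 0" for y
  proof -
    define \<rho> where "\<rho> = norm y"
    define z where "z = y /\<^sub>R norm y"
    have \<rho>: "\<rho> > 0" using that by (simp add: \<rho>_def)
    have z: "z \<in> sphere 0 1" using that by (simp add: z_def)
    then have nz: "z \<noteq> 0" by auto
    have yz: "y = \<rho> *\<^sub>R z" using that by (simp add: \<rho>_def z_def)
    define Q where "Q = exp ((p - 1) * ln (h z) + (X z \<bullet> X z) / 2)"
    obtain B \<mu> where B: "finite B" "pairwise orthogonal B" "\<And>b. b \<in> B \<Longrightarrow> norm b = 1"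
      "span B = tangent_space z" "card B = DIM('a) - 1" "\<And>b. b \<in> B \<Longrightarrow> DX z b = \<mu> b *\<^sub>R b"
      "\<And>b. b \<in> B \<Longrightarrow> \<mu> b > 0" and sig: "\<And>m. sigma_op (DX z) m = esym m \<mu> B"
      and "\<And>m v. z \<bullet> v = 0 \<Longrightarrow> v \<bullet> newton_op (DX z) m v = (\<Sum>b\<in>B. (v \<bullet> b)\<^sup>2 * esym m \<mu> (B - {b}))"
      "\<And>m v. z \<bullet> v = 0 \<Longrightarrow> DX z v \<bullet> newton_op (DX z) m v = (\<Sum>b\<in>B. (v \<bullet> b)\<^sup>2 * (\<mu> b * esym m \<mu> (B - {b})))"
      by (rule DX_eigenbasis[OF nz]) (rule that)
    have cB: "card B = n" using B(5) n by simp
    let ?P = "\<lambda>i. mean_esym i \<mu> B"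
    have sigP: "sigma_op (DX z) i = real (n choose i) * ?P i" for i
      using esym_eq_mean_esym[OF B(1), of i \<mu>] cB sig by simp
    have PQ: "?P k = Q" using eqn[OF z] k by (simp add: mean_esym_def cB sig Q_def)
    have Q0: "Q > 0" unfolding Q_def by (rule exp_gt_zero)
    have ineq: "Q powr (- \<alpha>) * (?P (Suc m) - h z * ?P m) \<le> ?P 1 - h z"
      by (rule esym_inequality[OF B(1,7) cB n(2) k PQ Q0 h_pos[OF nz] m_def \<alpha>_def])
    have g2: "g2 y = \<rho> ^ Suc m * Q powr (- \<alpha>)"
    proof -
      have "g2 y = exp (real (Suc m) * ln \<rho>) * exp (- (\<alpha> * ((p - 1) * ln (h z) + (X z \<bullet> X z) / 2)))"
        by (simp only: g2_def yz weight_exponent_scale[OF \<rho> z] diff_conv_add_uminus exp_add)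
      moreover have "exp (real (Suc m) * ln \<rho>) = \<rho> ^ Suc m" using \<rho> by (simp only: exp_of_nat_mult exp_ln)
      moreover have "exp (- (\<alpha> * ((p - 1) * ln (h z) + (X z \<bullet> X z) / 2))) = Q powr (- \<alpha>)"
        by (simp add: Q_def powr_def)
      ultimately show ?thesis by simp
    qed
    have a: "real (Suc m) * (real (n choose Suc m) * ?P (Suc m)) = c * ?P (Suc m)"
      using cm by (metis mult.assoc)
    have b: "(real DIM('a) - 1 - real m) * (real (n choose m) * ?P m) * h z = c * (?P m * h z)"
      using n by (simp add: c_def)
    have "op_trace (tfield_deriv m y) = (1 / \<rho>) ^ Suc m * (c * (?P (Suc m) - h z * ?P m))"
      unfolding yz divergence_tfield_scale[OF \<rho> z] sigP
      unfolding a b by (simp only: right_diff_distrib mult.commute[of "h z"])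
    then have l: "g2 y * op_trace (tfield_deriv m y) = c * (Q powr (- \<alpha>) * (?P (Suc m) - h z * ?P m))"
      using \<rho> unfolding g2 by (simp add: power_one_over)
    have "g1 y = \<rho>"
      using \<rho> by (simp add: g1_def yz weight_exponent_scale[OF \<rho> z])
    moreover have "op_trace (tfield_deriv 0 y) = (1 / \<rho>) * (real n * (?P 1 - h z))"
      unfolding yz divergence_tfield_scale[OF \<rho> z] sigP
      using n esym_0[OF B(1)] by (simp add: mean_esym_def algebra_simps)
    ultimately have r: "(c / real n) * (g1 y * op_trace (tfield_deriv 0 y)) = c * (?P 1 - h z)"
      using \<rho> n by simp
    show ?thesis unfolding l r using ineq c by simp
  qed
  have nonneg: "op_trace (V' y) \<ge> 0" if "y \<noteq> 0" for y
  proof -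
    have "g2 y * weight_exponent_deriv (real (Suc m)) \<alpha> p y (tfield m y) \<le> 0"
      using weight_exponent_deriv_tfield(2)[OF that p \<alpha>] by (simp add: g2_def mult_nonneg_nonpos)
    then show ?thesis using main[OF that] unfolding div[OF that] by (simp add: distrib_left)
  qed
  have zero: "tfield 0 y = 0" if "1 < norm y" "norm y < 2" for y
  proof (rule ccontr)
    assume nz: "tfield 0 y \<noteq> 0"
    have y: "y \<noteq> 0" using that by auto
    have "weight_exponent_deriv (real (Suc m)) \<alpha> p y (tfield m y) < 0"
      using weight_exponent_deriv_tfield(3)[OF y p \<alpha> nz] m n by simp
    then have "g2 y * weight_exponent_deriv (real (Suc m)) \<alpha> p y (tfield m y) < 0"
      by (simp add: g2_def mult_pos_neg)
    then have "op_trace (V' y) > 0" using main[OF y] unfolding div[OF y] by (simp add: distrib_left)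
    then show False using tangential_divergence_nonneg_imp_zero[OF der cont tang nonneg that] by simp
  qed
  \<comment> \<open>The cut-off argument speaks only of 1 < |y| < 2; any other point is rescaled to
    radius 3/2, since \<open>X\<close> has degree 0 and \<open>h\<close> degree 1.\<close>
  define y' where "y' = (3 / 2 / norm y) *\<^sub>R y"
  have "norm y' = 3 / 2" using y by (simp add: y'_def)
  then have "tfield 0 y' = 0" by (intro zero) auto
  then have "X y' = (h y' / (y' \<bullet> y')) *\<^sub>R y'" using X_eq_tfield[of y'] by simp
  moreover have "X y' = X y" "h y' = (3 / 2 / norm y) * h y"
  proof -
    have pos: "3 / 2 / norm y > 0" using y by simp
    show "X y' = X y" unfolding y'_def by (rule X_scale[OF pos y])
    show "h y' = (3 / 2 / norm y) * h y" unfolding y'_def by (rule h_scale[OF pos y])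
  qed
  moreover have "(h y' / (y' \<bullet> y')) *\<^sub>R y' = (h y / (y \<bullet> y)) *\<^sub>R y"
    using y unfolding calculation(3) by (simp add: y'_def)
  ultimately show ?thesis by simp
qed

text \<open>The gradient \<open>X\<close> of \<open>h\<close> is radial, so h^2 / |y|^2 has
  derivative zero. It is constant because the punctured space is connected in dimension at least 2,
  and its square root is the radius.\<close>

lemma radial_imp_sphere:
  assumes dim: "2 \<le> DIM('a)" and X: "\<And>y. y \<noteq> 0 \<Longrightarrow> X y = (h y / (y \<bullet> y)) *\<^sub>R y"
  shows "\<exists>R>0. M = sphere 0 R"
proof -
  define f where "f y = (h y)\<^sup>2 / (y \<bullet> y)" for y
  have d: "(f has_derivative (\<lambda>v. 0)) (at y)" if "y \<in> - {0}" for y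
  proof -
    have y: "y \<noteq> 0" using that by simp
    have "((\<lambda>y. (h y * h y) / (y \<bullet> y)) has_derivative
      (\<lambda>v. - (h y * h y) * (inverse (y \<bullet> y) * (y \<bullet> v + v \<bullet> y) * inverse (y \<bullet> y)) +
         (h y * (X y \<bullet> v) + (X y \<bullet> v) * h y) / (y \<bullet> y))) (at y)"
      by (intro has_derivative_divide has_derivative_mult has_derivative_inner has_derivative_ident has_derivative_h[OF y]) (use y in auto)
    moreover have "- (h y * h y) * (inverse (y \<bullet> y) * (y \<bullet> v + v \<bullet> y) * inverse (y \<bullet> y)) +
         (h y * (X y \<bullet> v) + (X y \<bullet> v) * h y) / (y \<bullet> y) = 0" for v
      unfolding X[OF y] by (simp add: inner_commute divide_inverse algebra_simps)
    ultimately show ?thesis by (simp add: f_def[abs_def] power2_eq_square)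
  qed
  obtain e :: 'a where e: "norm e = 1" using vector_choose_size[of 1] by auto
  define R where "R = sqrt (f e)"
  have conn: "connected (- {0::'a})" by (rule connected_punctured_universe[OF dim])
  have fe: "f y = f e" if "y \<noteq> 0" for y
    by (rule has_derivative_zero_unique_connected[OF punctured conn d]) (use that e in auto)
  have hz: "h z = R" if "norm z = 1" for z
  proof -
    have "z \<noteq> 0" "z \<bullet> z = 1" using that by (auto simp: norm_eq_1)
    then have "f e = (h z)\<^sup>2" using fe[of z] unfolding f_def by simp
    then have "R = sqrt ((h z)\<^sup>2)" by (simp only: R_def)
    then show ?thesis using h_pos[OF \<open>z \<noteq> 0\<close>] by simp
  qed
  have Xz: "X z = R *\<^sub>R z" if "norm z = 1" for z
  proof -
    have "z \<noteq> 0" "z \<bullet> z = 1" using that by (auto simp: norm_eq_1)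
    then show ?thesis using X[of z] hz[OF that] by simp
  qed
  have "e \<noteq> 0" using e by (metis norm_zero zero_neq_one)
  then have R: "R > 0" using hz[OF e] h_pos[of e] by simp
  have "M = sphere 0 R"
  proof (intro equalityI subsetI)
    fix x assume x: "x \<in> M"
    have "x = R *\<^sub>R outer_normal K x" using Xz[OF outer_normal(1)[OF x]] X_outer_normal[OF x] by simp
    then have "norm x = R" using outer_normal(1)[OF x] R by (metis abs_of_pos mult_1_right norm_scaleR)
    then show "x \<in> sphere 0 R" by simp
  next
    fix x :: 'a assume "x \<in> sphere 0 R"
    then have x: "norm x = R" by simp
    have "norm (x /\<^sub>R R) = 1" using x R by simp
    then have "X (x /\<^sub>R R) = x" "x /\<^sub>R R \<noteq> 0" using Xz R by auto
    then show "x \<in> M" using X_in_M by metis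
  qed
  then show ?thesis using R by blast
qed

end

theorem corollary1p6:
  fixes n k :: nat and p :: real
    and M K :: "'a::euclidean_space set" and u :: "'a \<Rightarrow> real"
  assumes "n \<ge> 2" and "DIM('a) = n + 1"
    and "1 \<le> k" and "k \<le> n"
    and "p \<ge> 1"
    and "smooth_strictly_convex M K"
    and "u = support_function K"
    and "\<forall>z\<in>sphere 0 1. u z powr (1 - p) * exp (- ((radial u z)\<^sup>2 / 2)) * P_W k u z = 1"
  shows "\<exists>R>0. M = sphere 0 R"
proof -
  interpret smooth_convex_body M K by standard (rule assms(6))
  have "sigma_op (DX z) k / real (n choose k) = exp ((p - 1) * ln (h z) + (X z \<bullet> X z) / 2)"
    if z: "z \<in> sphere 0 1" for z
  proof -
    have nz: "z \<noteq> 0" using z by auto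
    let ?E = "(p - 1) * ln (h z) + (X z \<bullet> X z) / 2"
    \<comment> \<open>Positivity of the support function turns the power into an exponential, so the
      equation can be solved for P_k as a single exponential.\<close>
    have "u z powr (1 - p) = exp (- ((p - 1) * ln (h z)))"
      using h_pos[OF nz] by (simp add: assms(7) support_function_eq_h powr_def algebra_simps)
    moreover have "(radial u z)\<^sup>2 = X z \<bullet> X z"
      by (simp add: assms(7) radial_def X_map_support_function[OF z] dot_square_norm)
    moreover have "P_W k u z = sigma_op (DX z) k / real (n choose k)"
      using P_W_support_function[OF z, of k] assms(2,7) by simp
    ultimately have "exp (- ((p - 1) * ln (h z))) * exp (- ((X z \<bullet> X z) / 2)) * (sigma_op (DX z) k / real (n choose k)) = 1"
      using bspec[OF assms(8) z] by (simp only:)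
    then have "exp (- ?E) * (sigma_op (DX z) k / real (n choose k)) = 1"
      by (simp only: exp_add[symmetric] minus_add_distrib)
    then have "exp ?E * (exp (- ?E) * (sigma_op (DX z) k / real (n choose k))) = exp ?E" by (simp only: mult_1_right)
    moreover have "exp e * (exp (- e) * a) = a" for e a :: real by (simp add: exp_minus)
    ultimately show ?thesis by (simp only:)
  qed
  then have "X y = (h y / (y \<bullet> y)) *\<^sub>R y" if "y \<noteq> 0" for y
    using isotropic_rigidity[OF assms(2,1,3,4,5) _ that] by blast
  then show ?thesis using radial_imp_sphere assms(1,2) by simp
qed

end
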